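(* Let $p$ be a prime, let $k$ be a field of characteristic $p$ and let $A=k[x]/(x^p)$. The connected gradings of $A$ are of two types: (i) gradings by the cyclic group $C_p$ of order $p$ obtained by transporting the usual $C_p$-grading of the group algebra $kC_p$ through an algebra isomorphism $kC_p\cong A$ (the group algebra case); (ii) the remaining connected gradings, for which the grading group is either $\mathbb Z$ or any of its quotients. A grading of the first type and a grading of the second type have no common quotient except the trivial one.
   Context: A grading $X$ of a $k$-algebra $A$ by a group $G$ is a decomposition $A=\bigoplus_{s\in G}X^sA$ with $X^tA\,X^sA\subset X^{ts}A$; it is connected if its support $\{s\in G: X^sA\ne0\}$ generates $G$. The usual $G$-grading of a group algebra $kG$ has $g$ homogeneous of degree $g$ for all $g\in G$. The quotient of a $G$-grading $X$ by a normal subgroup $N$ of $G$ is the $G/N$-grading $X/N$ whose component of degree $\alpha\in G/N$ is $\bigoplus_{g\in\alpha}X^gA$. A common quotient of two gradings of $A$ is a grading of $A$ that is a quotient of both (gradings corresponding to each other under an isomorphism of grading groups, with the same homogeneous subspaces, being identified). The trivial grading is the one by the trivial group. "Either $\mathbb Z$ or any of its quotients" means that the groups occurring are, up to isomorphism, exactly the quotients of $\mathbb Z$. *)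

theory Defs
  imports "HOL-Algebra.Algebra"
begin

definition characteristic :: "('k, 'm) ring_scheme \<Rightarrow> nat"
  where "characteristic K = group.ord (add_monoid K) \<one>\<^bsub>K\<^esub>"


section \<open>Algebras over a field\<close>

text \<open>
  \<^const>\<open>FactRing\<close> forgets the scalars. The multiplication by scalars of the quotient algebra
  is given in the style of \<^const>\<open>rcoset_mult\<close>; for an ideal \<open>I\<close> it sends the coset of \<open>a\<close> to
  the coset of \<open>c \<odot> a\<close>.
\<close>

definition quotient_algebra :: "('k, 'a, 'n) module_scheme \<Rightarrow> 'a set \<Rightarrow> ('k, 'a set) module"
  where "quotient_algebra A I =
    ring.extend (A Quot I)
      (module.fields (\<lambda>c S. \<Union>a\<in>S. I +>\<^bsub>A\<^esub> (c \<odot>\<^bsub>A\<^esub> a)))"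

lemma quotient_algebra_smult:
  assumes "algebra K A" "ideal I A" "c \<in> carrier K" "a \<in> carrier A"
  shows "c \<odot>\<^bsub>quotient_algebra A I\<^esub> (I +>\<^bsub>A\<^esub> a) = I +>\<^bsub>A\<^esub> (c \<odot>\<^bsub>A\<^esub> a)"
proof -
  interpret algebra K A by fact
  interpret I: ideal I A by fact
  have "I +>\<^bsub>A\<^esub> (c \<odot>\<^bsub>A\<^esub> b) = I +>\<^bsub>A\<^esub> (c \<odot>\<^bsub>A\<^esub> a)" if b: "b \<in> I +>\<^bsub>A\<^esub> a" for b
  proof -
    obtain i where i: "i \<in> I" "b = i \<oplus>\<^bsub>A\<^esub> a"
      using b by (auto simp: a_r_coset_def')
    have iA: "i \<in> carrier A" using i(1) by (rule I.a_Hcarr)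
    have "c \<odot>\<^bsub>A\<^esub> i = (c \<odot>\<^bsub>A\<^esub> \<one>\<^bsub>A\<^esub>) \<otimes>\<^bsub>A\<^esub> i"
      using smult_assoc2[of c "\<one>\<^bsub>A\<^esub>" i] iA assms(3) by simp
    hence "c \<odot>\<^bsub>A\<^esub> i \<in> I"
      using I.I_l_closed[OF i(1), of "c \<odot>\<^bsub>A\<^esub> \<one>\<^bsub>A\<^esub>"] assms(3) by simp
    moreover have "c \<odot>\<^bsub>A\<^esub> b = c \<odot>\<^bsub>A\<^esub> i \<oplus>\<^bsub>A\<^esub> c \<odot>\<^bsub>A\<^esub> a"
      unfolding i(2) using iA assms(3,4) by (rule_tac smult_r_distr)
    ultimately have "c \<odot>\<^bsub>A\<^esub> b \<in> I +>\<^bsub>A\<^esub> (c \<odot>\<^bsub>A\<^esub> a)"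
      unfolding a_r_coset_def' by blast
    from I.a_repr_independence'[OF this smult_closed[OF assms(3,4)]] show ?thesis
      by (rule sym)
  qed
  moreover have "a \<in> I +>\<^bsub>A\<^esub> a"
    using assms(4) by (rule I.a_rcos_self)
  moreover have "c \<odot>\<^bsub>quotient_algebra A I\<^esub> S = (\<Union>b\<in>S. I +>\<^bsub>A\<^esub> (c \<odot>\<^bsub>A\<^esub> b))" for S
    by (simp add: quotient_algebra_def ring.extend_def module.fields_def)
  ultimately show ?thesis
    by blast
qed

definition truncated_polynomial_algebra ::
    "('k, 'm) ring_scheme \<Rightarrow> nat \<Rightarrow> ('k, (nat \<Rightarrow> 'k) set) module"
  where "truncated_polynomial_algebra K n =
    quotient_algebra (UP K) (PIdl\<^bsub>UP K\<^esub> (up_ring.monom (UP K) \<one>\<^bsub>K\<^esub> n))"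

definition algebra_iso ::
    "('k, 'm) ring_scheme \<Rightarrow> ('k, 'a, 'n) module_scheme \<Rightarrow> ('k, 'b, 'o) module_scheme \<Rightarrow> ('a \<Rightarrow> 'b) set"
  where "algebra_iso K A B =
    {\<phi> \<in> ring_iso A B. \<forall>c\<in>carrier K. \<forall>a\<in>carrier A. \<phi> (c \<odot>\<^bsub>A\<^esub> a) = c \<odot>\<^bsub>B\<^esub> \<phi> a}"

text \<open>
  The elements of the group algebra are the finitely supported functions from the group to the
  field, extended by \<^const>\<open>undefined\<close> outside the carrier of the group, and the product is the
  convolution \<open>(u v)(g) = (\<Sum>a. u(a) v(a\<inverse> g))\<close>.
\<close>

definition group_algebra ::
    "('k, 'm) ring_scheme \<Rightarrow> ('g, 'n) monoid_scheme \<Rightarrow> ('k, 'g \<Rightarrow> 'k) module"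
  where "group_algebra K G = \<lparr>
    carrier = {u \<in> carrier G \<rightarrow>\<^sub>E carrier K. finite {g \<in> carrier G. u g \<noteq> \<zero>\<^bsub>K\<^esub>}},
    monoid.mult = (\<lambda>u v. \<lambda>g\<in>carrier G.
      \<Oplus>\<^bsub>K\<^esub>a\<in>{a \<in> carrier G. u a \<noteq> \<zero>\<^bsub>K\<^esub>}. u a \<otimes>\<^bsub>K\<^esub> v (inv\<^bsub>G\<^esub> a \<otimes>\<^bsub>G\<^esub> g)),
    one = (\<lambda>g\<in>carrier G. if g = \<one>\<^bsub>G\<^esub> then \<one>\<^bsub>K\<^esub> else \<zero>\<^bsub>K\<^esub>),
    ring.zero = (\<lambda>g\<in>carrier G. \<zero>\<^bsub>K\<^esub>),
    ring.add = (\<lambda>u v. \<lambda>g\<in>carrier G. u g \<oplus>\<^bsub>K\<^esub> v g),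
    module.smult = (\<lambda>c u. \<lambda>g\<in>carrier G. c \<otimes>\<^bsub>K\<^esub> u g)\<rparr>"

definition group_element ::
    "('k, 'm) ring_scheme \<Rightarrow> ('g, 'n) monoid_scheme \<Rightarrow> 'g \<Rightarrow> 'g \<Rightarrow> 'k"
  where "group_element K G g = (\<lambda>h\<in>carrier G. if h = g then \<one>\<^bsub>K\<^esub> else \<zero>\<^bsub>K\<^esub>)"


section \<open>Gradings\<close>

text \<open>
  \<open>finite_families A S U\<close> is the external direct sum of the \<open>U s\<close>, \<open>s \<in> S\<close>. In
  \<open>family_sum\<close> the index set is cut down to the support, since \<^const>\<open>finsum\<close> over an
  infinite set is zero.
\<close>

definition finite_families ::
    "('k, 'a, 'n) module_scheme \<Rightarrow> 's set \<Rightarrow> ('s \<Rightarrow> 'a set) \<Rightarrow> ('s \<Rightarrow> 'a) set"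
  where "finite_families A S U =
    {f \<in> (\<Pi>\<^sub>E s\<in>S. U s). finite {s \<in> S. f s \<noteq> \<zero>\<^bsub>A\<^esub>}}"

definition family_sum :: "('k, 'a, 'n) module_scheme \<Rightarrow> 's set \<Rightarrow> ('s \<Rightarrow> 'a) \<Rightarrow> 'a"
  where "family_sum A S f = (\<Oplus>\<^bsub>A\<^esub>s\<in>{s \<in> S. f s \<noteq> \<zero>\<^bsub>A\<^esub>}. f s)"

text \<open>A grading is a family \<open>U\<close> of subsets of \<open>A\<close>; only its values on the carrier of the
  group matter.\<close>

definition grading ::
    "('k, 'm) ring_scheme \<Rightarrow> ('k, 'a, 'n) module_scheme \<Rightarrow> ('g, 'o) monoid_scheme \<Rightarrow> ('g \<Rightarrow> 'a set) \<Rightarrow> bool"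
  where "grading K A G U \<longleftrightarrow>
    group G \<and>
    (\<forall>s\<in>carrier G. submodule (U s) K A) \<and>
    bij_betw (family_sum A (carrier G)) (finite_families A (carrier G) U) (carrier A) \<and>
    (\<forall>t\<in>carrier G. \<forall>s\<in>carrier G. \<forall>a\<in>U t. \<forall>b\<in>U s. a \<otimes>\<^bsub>A\<^esub> b \<in> U (t \<otimes>\<^bsub>G\<^esub> s))"

definition grading_support ::
    "('k, 'a, 'n) module_scheme \<Rightarrow> ('g, 'o) monoid_scheme \<Rightarrow> ('g \<Rightarrow> 'a set) \<Rightarrow> 'g set"
  where "grading_support A G U = {s \<in> carrier G. U s \<noteq> {\<zero>\<^bsub>A\<^esub>}}"

definition connected_grading ::
    "('k, 'm) ring_scheme \<Rightarrow> ('k, 'a, 'n) module_scheme \<Rightarrow> ('g, 'o) monoid_scheme \<Rightarrow> ('g \<Rightarrow> 'a set) \<Rightarrow> bool"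
  where "connected_grading K A G U \<longleftrightarrow>
    grading K A G U \<and> generate G (grading_support A G U) = carrier G"

definition same_grading ::
    "('g, 'o) monoid_scheme \<Rightarrow> ('g \<Rightarrow> 'a set) \<Rightarrow> ('h, 'p) monoid_scheme \<Rightarrow> ('h \<Rightarrow> 'a set) \<Rightarrow> bool"
  where "same_grading G U H V \<longleftrightarrow> (\<exists>\<theta>\<in>iso G H. \<forall>s\<in>carrier G. V (\<theta> s) = U s)"

definition quotient_grading ::
    "('k, 'a, 'n) module_scheme \<Rightarrow> ('g \<Rightarrow> 'a set) \<Rightarrow> 'g set \<Rightarrow> 'a set"
  where "quotient_grading A U \<alpha> = family_sum A \<alpha> ` finite_families A \<alpha> U"

definition is_quotient_grading ::
    "('k, 'a, 'n) module_scheme \<Rightarrow> ('g, 'o) monoid_scheme \<Rightarrow> ('g \<Rightarrow> 'a set) \<Rightarrow>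
     ('h, 'p) monoid_scheme \<Rightarrow> ('h \<Rightarrow> 'a set) \<Rightarrow> bool"
  where "is_quotient_grading A G U H V \<longleftrightarrow>
    (\<exists>N. N \<lhd> G \<and> same_grading (G Mod N) (quotient_grading A U) H V)"

definition common_quotient ::
    "('k, 'm) ring_scheme \<Rightarrow> ('k, 'a, 'n) module_scheme \<Rightarrow>
     ('g, 'o) monoid_scheme \<Rightarrow> ('g \<Rightarrow> 'a set) \<Rightarrow> ('h, 'p) monoid_scheme \<Rightarrow> ('h \<Rightarrow> 'a set) \<Rightarrow>
     ('l, 'q) monoid_scheme \<Rightarrow> ('l \<Rightarrow> 'a set) \<Rightarrow> bool"
  where "common_quotient K A G U H V L W \<longleftrightarrow>
    grading K A L W \<and> is_quotient_grading A G U L W \<and> is_quotient_grading A H V L W"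

definition trivial_grading ::
    "('k, 'm) ring_scheme \<Rightarrow> ('k, 'a, 'n) module_scheme \<Rightarrow> ('g, 'o) monoid_scheme \<Rightarrow> ('g \<Rightarrow> 'a set) \<Rightarrow> bool"
  where "trivial_grading K A G U \<longleftrightarrow> grading K A G U \<and> trivial_group G"

definition group_algebra_grading ::
    "('k, 'm) ring_scheme \<Rightarrow> ('g, 'o) monoid_scheme \<Rightarrow> 'g \<Rightarrow> ('g \<Rightarrow> 'k) set"
  where "group_algebra_grading K G g =
    {c \<odot>\<^bsub>group_algebra K G\<^esub> group_element K G g | c. c \<in> carrier K}"


section \<open>The two types of connected gradings of the truncated polynomial algebra\<close>

text \<open>Gradings are considered up to isomorphism of the grading groups, so \<open>G\<close> may be any
  group isomorphic to the standard cyclic group \<open>integer_mod_group p\<close>.\<close>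

definition first_type ::
    "('k, 'm) ring_scheme \<Rightarrow> nat \<Rightarrow> ('g, 'o) monoid_scheme \<Rightarrow> ('g \<Rightarrow> (nat \<Rightarrow> 'k) set set) \<Rightarrow> bool"
  where "first_type K p G U \<longleftrightarrow>
    (\<exists>\<phi>\<in>algebra_iso K (group_algebra K (integer_mod_group p)) (truncated_polynomial_algebra K p).
      same_grading (integer_mod_group p)
        (\<lambda>c. \<phi> ` group_algebra_grading K (integer_mod_group p) c) G U)"

definition second_type ::
    "('k, 'm) ring_scheme \<Rightarrow> nat \<Rightarrow> ('g, 'o) monoid_scheme \<Rightarrow> ('g \<Rightarrow> (nat \<Rightarrow> 'k) set set) \<Rightarrow> bool"
  where "second_type K p G U \<longleftrightarrow>
    connected_grading K (truncated_polynomial_algebra K p) G U \<and> \<not> first_type K p G U"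

end

theory Submission
  imports Defs
begin

text \<open>
  Let \<open>x\<close> be the class of the variable in \<open>A = K[x]/(x\<^sup>p)\<close>. The algebra is local with maximal ideal
  \<open>Ax\<close> and residue field \<open>K\<close>: every element is \<open>a = k + bx\<close> with a scalar \<open>k\<close>, and in characteristic
  \<open>p\<close> this gives \<open>a\<^sup>p = k\<^sup>p\<close> (\<open>power_p\<close>). Hence elements outside \<open>Ax\<close> are units whose \<open>p\<close>-th power is a
  nonzero scalar. A grading of \<open>A\<close> by \<open>G\<close> is then analysed through homogeneous elements whose powers
  form a basis.

  Suppose that some homogeneous element \<open>a\<close> of degree \<open>g \<noteq> 1\<close> lies outside \<open>Ax\<close>. Since \<open>a\<^sup>p\<close> is a nonzero
  scalar, \<open>g\<^sup>p = 1\<close>, so \<open>g\<close> has order \<open>p\<close> and \<open>1, a, \<dots>, a\<^sup>p\<^sup>-\<^sup>1\<close> have different degrees. They are a basis by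
  comparison of dimensions (\<open>homogeneous_group_element\<close>). After division by a scalar \<open>a\<^sup>p = 1\<close>, and if the
  grading is connected it is the one of the group algebra of \<open>G = \<langle>g\<rangle>\<close>.

  Suppose on the contrary that all components of degree different from \<open>1\<close> lie in \<open>Ax\<close>. Then all components
  of \<open>x\<close> lie in \<open>Ax\<close>, but not all in \<open>Ax\<^sup>2\<close>, so one of them is \<open>y = ax\<close> with a unit \<open>a\<close>
  (\<open>homogeneous_nilpotent_generator\<close>). The powers of \<open>y\<close> are a basis, and if the grading is connected, \<open>G\<close>
  is generated by the degree of \<open>y\<close>.

  Conversely, \<open>1 + x\<close> is a unit of multiplicative order \<open>p\<close> whose powers are a basis, which realises the
  group algebra; and for any cyclic group one may give \<open>x\<close> the degree of a generator. The two types are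
  told apart by nilpotent elements: components of the group algebra are spanned by units, whereas \<open>y\<close>
  is homogeneous and nilpotent. This also settles common quotients. A group of order \<open>p\<close> has no proper
  nontrivial subgroup, so the only nontrivial quotient of a grading of the first type is that grading itself,
  and it cannot be a quotient of the second grading because \<open>y\<close> would stay homogeneous
  (\<open>common_quotient_trivial\<close>).
\<close>

section \<open>Finite sums\<close>

lemma finsum_additive_map:
  assumes "abelian_group M" "abelian_group N" "h \<in> hom (add_monoid M) (add_monoid N)"
    and "finite I" "f \<in> I \<rightarrow> carrier M"
  shows "h (finsum M f I) = (\<Oplus>\<^bsub>N\<^esub>i\<in>I. h (f i))"
proof -
  interpret M: abelian_group M by fact
  interpret N: abelian_group N by fact
  interpret h: group_hom "add_monoid M" "add_monoid N" h
    using assms(3) by (simp add: group_hom_def group_hom_axioms_def M.a_group N.a_group)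
  have hc: "h a \<in> carrier N" if "a \<in> carrier M" for a
    using h.hom_closed that by simp
  from assms(4,5) show ?thesis
  proof (induction I rule: finite_induct)
    case empty
    then show ?case using h.hom_one by simp
  next
    case (insert i I)
    then have "h (finsum M f (insert i I)) = h (f i) \<oplus>\<^bsub>N\<^esub> h (finsum M f I)"
      using h.hom_mult[of "f i" "finsum M f I"] by (simp add: Pi_def)
    with insert show ?case by (simp add: hc Pi_def)
  qed
qed

lemma (in abelian_monoid) finsum_swap:
  assumes "finite I" "finite J" "\<And>i j. i \<in> I \<Longrightarrow> j \<in> J \<Longrightarrow> f i j \<in> carrier G"
  shows "(\<Oplus>i\<in>I. \<Oplus>j\<in>J. f i j) = (\<Oplus>j\<in>J. \<Oplus>i\<in>I. f i j)"
  using assms(1,3)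
proof (induction I rule: finite_induct)
  case empty
  then show ?case by simp
next
  case (insert i I)
  have "(\<Oplus>j\<in>J. \<Oplus>i\<in>insert i I. f i j) = (\<Oplus>j\<in>J. f i j \<oplus> (\<Oplus>i\<in>I. f i j))"
    using insert by (intro finsum_cong) (auto simp: Pi_def simp_implies_def)
  also have "\<dots> = (\<Oplus>j\<in>J. f i j) \<oplus> (\<Oplus>j\<in>J. \<Oplus>i\<in>I. f i j)"
    using insert by (intro finsum_addf) (auto simp: Pi_def)
  finally show ?case using insert by (simp add: Pi_def)
qed

lemma (in abelian_group) subgroup_finsum_closed:
  assumes "subgroup W (add_monoid G)" "finite I" "f \<in> I \<rightarrow> W"
  shows "finsum G f I \<in> W"
  using assms(2,3)
proof (induction I rule: finite_induct)
  case empty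
  then show ?case using subgroup.one_closed[OF assms(1)] by simp
next
  case (insert i I)
  moreover have "W \<subseteq> carrier G" using subgroup.subset[OF assms(1)] by simp
  ultimately show ?case using subgroup.m_closed[OF assms(1), of "f i" "finsum G f I"]
    by (simp add: Pi_def subset_iff)
qed

section \<open>Freshman's dream\<close>

lemma (in cring) one_plus_power:
  assumes a: "a \<in> carrier R"
  shows "(\<one> \<oplus> a) [^] n = (\<Oplus>k\<in>{..n}. [(n choose k)] \<cdot>\<^bsub>R\<^esub> (a [^] k))"
proof (induction n)
  case 0
  show ?case using a by simp
next
  case (Suc n)
  let ?b = "\<lambda>m k. [(m choose k)] \<cdot>\<^bsub>R\<^esub> (a [^] k)"
  have shift: "?b n k \<otimes> a = [(n choose k)] \<cdot>\<^bsub>R\<^esub> (a [^] Suc k)" for k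
    using a by (simp add: add_pow_ldistr)
  have "(\<one> \<oplus> a) [^] Suc n = (\<Oplus>k\<in>{..n}. ?b n k) \<oplus> (\<Oplus>k\<in>{..n}. ?b n k) \<otimes> a"
    using a Suc by (simp add: r_distr)
  also have "(\<Oplus>k\<in>{..n}. ?b n k) \<otimes> a = (\<Oplus>k\<in>{..n}. [(n choose k)] \<cdot>\<^bsub>R\<^esub> (a [^] Suc k))"
    using a by (subst finsum_ldistr) (auto simp: shift simp del: nat_pow_Suc)
  also have "(\<Oplus>k\<in>{..n}. ?b n k) = (\<Oplus>k\<in>{..Suc n}. ?b n k)"
    using a by (subst finsum_Suc) (auto simp: binomial_eq_0)
  also have "\<dots> = (\<Oplus>k\<in>{..n}. ?b n (Suc k)) \<oplus> ?b n 0"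
    using a by (subst finsum_Suc2) auto
  also have "\<dots> \<oplus> (\<Oplus>k\<in>{..n}. [(n choose k)] \<cdot>\<^bsub>R\<^esub> (a [^] Suc k)) =
      ((\<Oplus>k\<in>{..n}. ?b n (Suc k)) \<oplus> (\<Oplus>k\<in>{..n}. [(n choose k)] \<cdot>\<^bsub>R\<^esub> (a [^] Suc k))) \<oplus> ?b n 0"
    using a by (simp add: a_ac del: nat_pow_Suc)
  also have "(\<Oplus>k\<in>{..n}. ?b n (Suc k)) \<oplus> (\<Oplus>k\<in>{..n}. [(n choose k)] \<cdot>\<^bsub>R\<^esub> (a [^] Suc k)) =
      (\<Oplus>k\<in>{..n}. ?b (Suc n) (Suc k))"
    using a by (subst finsum_addf[symmetric])
      (auto simp: add.nat_pow_mult add.commute simp del: nat_pow_Suc intro!: finsum_cong)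
  also have "\<dots> \<oplus> ?b n 0 = (\<Oplus>k\<in>{..Suc n}. ?b (Suc n) k)"
    using a by (subst finsum_Suc2) auto
  finally show ?case .
qed

text \<open>The inner binomial coefficients are divisible by \<open>p\<close>.\<close>

lemma (in cring) one_plus_power_prime:
  fixes p :: nat
  assumes p: "Factorial_Ring.prime p" and char: "[p] \<cdot>\<^bsub>R\<^esub> \<one> = \<zero>" and a: "a \<in> carrier R"
  shows "(\<one> \<oplus> a) [^] p = \<one> \<oplus> a [^] p"
proof -
  obtain q where q: "p = Suc q" "q > 0" using prime_gt_1_nat[OF p] by (cases p) auto
  have p0: "[p] \<cdot>\<^bsub>R\<^esub> b = \<zero>" if "b \<in> carrier R" for b
    using add_pow_ldistr[of \<one> b p] that char by simp
  have vanish: "[(p choose k)] \<cdot>\<^bsub>R\<^esub> (a [^] k) = \<zero>" if "k \<noteq> 0" "k < p" for k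
  proof -
    have "p dvd p choose k"
      using dvd_choose_prime[OF that(2,1) _ p] q(1) by simp
    then obtain m where "p choose k = p * m" by (auto elim: dvdE)
    then show ?thesis
      using a p0[of "a [^] k"] add.nat_pow_pow[of "a [^] k" m p] by (simp add: mult.commute)
  qed
  have "(\<one> \<oplus> a) [^] p = (\<Oplus>k\<in>{..q}. [(p choose k)] \<cdot>\<^bsub>R\<^esub> (a [^] k)) \<oplus> a [^] p"
    unfolding one_plus_power[OF a] unfolding q(1) using a by (subst finsum_Suc) (auto simp: a_comm)
  also have "(\<Oplus>k\<in>{..q}. [(p choose k)] \<cdot>\<^bsub>R\<^esub> (a [^] k)) = (\<Oplus>k\<in>{..q}. if 0 = k then \<one> else \<zero>)"
    using vanish a q by (intro finsum_cong) (auto simp: simp_implies_def)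
  also have "\<dots> = \<one>"
    using finsum_singleton[of 0 "{..q}" "\<lambda>_. \<one>"] by simp
  finally show ?thesis .
qed

section \<open>Bases\<close>

text \<open>As \<open>\<one> \<noteq> \<zero>\<close>, the multiples of \<open>\<one>\<close> are a copy of the field \<open>K\<close> inside \<open>A\<close>.\<close>

locale field_algebra = K: field K + A: cring A + algebra K A
  for K :: "('k, 'm) ring_scheme" and A :: "('k, 'a, 'n) module_scheme" (structure) +
  assumes one_not_zero: "\<one> \<noteq> \<zero>"
begin

definition spanning :: "'i set \<Rightarrow> ('i \<Rightarrow> 'a) \<Rightarrow> bool"
  where "spanning I e \<longleftrightarrow> (\<forall>a\<in>carrier A. \<exists>c\<in>I \<rightarrow> carrier K. a = (\<Oplus>i\<in>I. c i \<odot> e i))"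

definition lin_independent :: "'i set \<Rightarrow> ('i \<Rightarrow> 'a) \<Rightarrow> bool"
  where "lin_independent I e \<longleftrightarrow>
    (\<forall>c\<in>I \<rightarrow> carrier K. (\<Oplus>i\<in>I. c i \<odot> e i) = \<zero> \<longrightarrow> (\<forall>i\<in>I. c i = \<zero>\<^bsub>K\<^esub>))"

definition basis :: "'i set \<Rightarrow> ('i \<Rightarrow> 'a) \<Rightarrow> bool"
  where "basis I e \<longleftrightarrow> finite I \<and> e \<in> I \<rightarrow> carrier A \<and> spanning I e \<and> lin_independent I e"

text \<open>Dimension over a subfield of a ring is a notion about lists of vectors; it applies to this
  copy of \<open>K\<close>, and the lemmas below translate between lists and indexed families.\<close>

definition scalars :: "'a set"
  where "scalars = (\<lambda>c. c \<odot> \<one>) ` carrier K"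

lemma smult_eq_mult: "c \<in> carrier K \<Longrightarrow> a \<in> carrier A \<Longrightarrow> c \<odot> a = (c \<odot> \<one>) \<otimes> a"
  using smult_assoc2[of c \<one> a] by simp

lemma mult_smult: "c \<in> carrier K \<Longrightarrow> a \<in> carrier A \<Longrightarrow> b \<in> carrier A \<Longrightarrow> a \<otimes> (c \<odot> b) = c \<odot> (a \<otimes> b)"
  using smult_assoc2[of c b a] A.m_comm[of a] by simp

lemma smult_mult_smult:
  "c \<in> carrier K \<Longrightarrow> d \<in> carrier K \<Longrightarrow> a \<in> carrier A \<Longrightarrow> b \<in> carrier A \<Longrightarrow>
    (c \<odot> a) \<otimes> (d \<odot> b) = (c \<otimes>\<^bsub>K\<^esub> d) \<odot> (a \<otimes> b)"
  using smult_assoc1[of c d "a \<otimes> b"] smult_assoc2[of c a "d \<odot> b"] mult_smult[of d a b] by simp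

lemma smult_pow:
  "c \<in> carrier K \<Longrightarrow> a \<in> carrier A \<Longrightarrow> (c \<odot> a) [^] (n::nat) = (c [^]\<^bsub>K\<^esub> n) \<odot> (a [^] n)"
  by (induction n) (simp_all add: smult_mult_smult)

lemma smult_cancel:
  assumes "c \<in> carrier K" "c \<noteq> \<zero>\<^bsub>K\<^esub>" "a \<in> carrier A"
  shows "inv\<^bsub>K\<^esub> c \<odot> (c \<odot> a) = a"
proof -
  have "c \<in> Units K" using assms by (simp add: K.field_Units)
  then show ?thesis using smult_assoc1[of "inv\<^bsub>K\<^esub> c" c a] assms by simp
qed

lemma smult_eq_zero_iff:
  assumes "c \<in> carrier K" "a \<in> carrier A"
  shows "c \<odot> a = \<zero> \<longleftrightarrow> c = \<zero>\<^bsub>K\<^esub> \<or> a = \<zero>"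
proof
  assume z: "c \<odot> a = \<zero>"
  show "c = \<zero>\<^bsub>K\<^esub> \<or> a = \<zero>"
  proof (cases "c = \<zero>\<^bsub>K\<^esub>")
    case False
    then have "inv\<^bsub>K\<^esub> c \<in> carrier K" using assms(1) by (simp add: K.field_Units)
    with smult_cancel[OF assms(1) False assms(2)] show ?thesis unfolding z by simp
  qed simp
qed (use assms in auto)

lemma smult_add_pow:
  assumes "k \<in> carrier K" "a \<in> carrier A"
  shows "([n] \<cdot>\<^bsub>K\<^esub> k) \<odot> a = [(n::nat)] \<cdot>\<^bsub>A\<^esub> (k \<odot> a)"
  using assms by (induction n) (simp_all add: smult_l_distr)

lemma scalar_pow_nonzero:
  "k \<in> carrier K \<Longrightarrow> k \<noteq> \<zero>\<^bsub>K\<^esub> \<Longrightarrow> k [^]\<^bsub>K\<^esub> (n::nat) \<noteq> \<zero>\<^bsub>K\<^esub>"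
  by (induction n) (auto simp: K.integral_iff)

lemma smult_hom: "c \<in> carrier K \<Longrightarrow> (\<lambda>a. c \<odot> a) \<in> hom (add_monoid A) (add_monoid A)"
  by (auto simp: hom_def smult_r_distr)

lemma scalar_hom: "ring_hom_ring K A (\<lambda>c. c \<odot> \<one>)"
proof (rule ring_hom_ringI2)
  show "(\<lambda>c. c \<odot> \<one>) \<in> ring_hom K A"
    by (rule ring_hom_memI) (auto simp: smult_l_distr smult_mult_smult)
qed (unfold_locales)

lemma subfield_scalars: "subfield scalars A"
proof -
  interpret h: ring_hom_ring K A "\<lambda>c. c \<odot> \<one>" by (rule scalar_hom)
  show ?thesis
    unfolding scalars_def
    using h.img_is_subfield(2)[OF K.carrier_is_subfield one_not_zero] .
qed

lemma lincomb_closed: "e \<in> I \<rightarrow> carrier A \<Longrightarrow> c \<in> I \<rightarrow> carrier K \<Longrightarrow> (\<Oplus>i\<in>I. c i \<odot> e i) \<in> carrier A"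
  by (rule A.finsum_closed) auto

lemma lincomb_add:
  assumes "e \<in> I \<rightarrow> carrier A" "b \<in> I \<rightarrow> carrier K" "c \<in> I \<rightarrow> carrier K"
  shows "(\<Oplus>i\<in>I. b i \<odot> e i) \<oplus> (\<Oplus>i\<in>I. c i \<odot> e i) = (\<Oplus>i\<in>I. (b i \<oplus>\<^bsub>K\<^esub> c i) \<odot> e i)"
proof -
  have "(\<Oplus>i\<in>I. (b i \<oplus>\<^bsub>K\<^esub> c i) \<odot> e i) = (\<Oplus>i\<in>I. b i \<odot> e i \<oplus> c i \<odot> e i)"
    using assms by (intro A.finsum_cong) (auto simp: Pi_iff smult_l_distr simp_implies_def)
  also have "\<dots> = (\<Oplus>i\<in>I. b i \<odot> e i) \<oplus> (\<Oplus>i\<in>I. c i \<odot> e i)"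
    using assms by (intro A.finsum_addf) auto
  finally show ?thesis by simp
qed

lemma lincomb_smult:
  assumes "finite I" "e \<in> I \<rightarrow> carrier A" "c \<in> I \<rightarrow> carrier K" "k \<in> carrier K"
  shows "k \<odot> (\<Oplus>i\<in>I. c i \<odot> e i) = (\<Oplus>i\<in>I. (k \<otimes>\<^bsub>K\<^esub> c i) \<odot> e i)"
proof -
  have "k \<odot> (\<Oplus>i\<in>I. c i \<odot> e i) = (\<Oplus>i\<in>I. k \<odot> (c i \<odot> e i))"
    using assms by (intro finsum_smult_ldistr) auto
  also have "\<dots> = (\<Oplus>i\<in>I. (k \<otimes>\<^bsub>K\<^esub> c i) \<odot> e i)"
    using assms by (intro A.finsum_cong) (auto simp: Pi_iff smult_assoc1 simp_implies_def)
  finally show ?thesis .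
qed

lemma lincomb_delta:
  assumes "finite I" "j \<in> I" "e \<in> I \<rightarrow> carrier A" "k \<in> carrier K"
  shows "(\<Oplus>i\<in>I. (if j = i then k else \<zero>\<^bsub>K\<^esub>) \<odot> e i) = k \<odot> e j"
proof -
  have "(\<Oplus>i\<in>I. (if j = i then k else \<zero>\<^bsub>K\<^esub>) \<odot> e i) = (\<Oplus>i\<in>I. if j = i then k \<odot> e i else \<zero>)"
    using assms by (intro A.finsum_cong) (auto simp: Pi_iff simp_implies_def)
  also have "\<dots> = k \<odot> e j" by (rule A.finsum_singleton) (use assms in auto)
  finally show ?thesis .
qed

lemma combine_eq_lincomb:
  assumes "distinct xs" "e \<in> set xs \<rightarrow> carrier A" "c \<in> set xs \<rightarrow> carrier K"
  shows "A.combine (map (\<lambda>i. c i \<odot> \<one>) xs) (map e xs) = (\<Oplus>i\<in>set xs. c i \<odot> e i)"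
  using assms
proof (induction xs)
  case Nil
  then show ?case by simp
next
  case (Cons x xs)
  then have "(\<Oplus>i\<in>set (x # xs). c i \<odot> e i) = c x \<odot> e x \<oplus> (\<Oplus>i\<in>set xs. c i \<odot> e i)"
    by (simp add: Pi_def)
  with Cons smult_eq_mult[of "c x" "e x"] show ?case by auto
qed

lemma scalar_list:
  assumes "distinct xs" "length Ks = length xs" "set Ks \<subseteq> scalars"
  obtains c where "c \<in> set xs \<rightarrow> carrier K" "Ks = map (\<lambda>i. c i \<odot> \<one>) xs"
proof -
  have "\<exists>c. \<forall>i<length xs. c (xs ! i) \<in> carrier K \<and> Ks ! i = c (xs ! i) \<odot> \<one>"
  proof -
    have "\<forall>i<length xs. \<exists>d. d \<in> carrier K \<and> Ks ! i = d \<odot> \<one>"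
      using assms(2,3) by (auto simp: scalars_def subset_iff image_iff) (metis nth_mem)
    then obtain d where d: "\<And>i. i < length xs \<Longrightarrow> d i \<in> carrier K \<and> Ks ! i = d i \<odot> \<one>"
      by metis
    \<comment> \<open>an element of a list without repetitions has a unique position\<close>
    let ?c = "\<lambda>x. d (THE i. i < length xs \<and> xs ! i = x)"
    have "(THE j. j < length xs \<and> xs ! j = xs ! i) = i" if "i < length xs" for i
      using assms(1) that by (intro the_equality) (auto simp: nth_eq_iff_index_eq)
    then show ?thesis using d by (intro exI[of _ ?c]) simp
  qed
  then obtain c where c: "\<forall>i<length xs. c (xs ! i) \<in> carrier K \<and> Ks ! i = c (xs ! i) \<odot> \<one>" ..
  show thesis
  proof (rule that)
    show "c \<in> set xs \<rightarrow> carrier K" using c by (auto simp: in_set_conv_nth)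
    show "Ks = map (\<lambda>i. c i \<odot> \<one>) xs" using c assms(2) by (intro nth_equalityI) auto
  qed
qed

lemma spanning_iff_Span:
  assumes "distinct xs" "e \<in> set xs \<rightarrow> carrier A"
  shows "spanning (set xs) e \<longleftrightarrow> A.Span scalars (map e xs) = carrier A"
proof -
  have e: "set (map e xs) \<subseteq> carrier A" using assms(2) by auto
  have "A.Span scalars (map e xs) = {\<Oplus>i\<in>set xs. c i \<odot> e i | c. c \<in> set xs \<rightarrow> carrier K}" (is "_ = ?S")
  proof -
    have "A.combine Ks (map e xs) \<in> ?S"
      if Ks: "length Ks = length (map e xs)" "set Ks \<subseteq> scalars" for Ks
    proof -
      obtain c where "c \<in> set xs \<rightarrow> carrier K" "Ks = map (\<lambda>i. c i \<odot> \<one>) xs"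
        using scalar_list[OF assms(1)] Ks by auto
      then show ?thesis using combine_eq_lincomb[OF assms] by blast
    qed
    moreover have "\<exists>Ks. (\<Oplus>i\<in>set xs. c i \<odot> e i) = A.combine Ks (map e xs) \<and>
        length Ks = length (map e xs) \<and> set Ks \<subseteq> scalars"
      if "c \<in> set xs \<rightarrow> carrier K" for c
      using combine_eq_lincomb[OF assms that] that
      by (intro exI[of _ "map (\<lambda>i. c i \<odot> \<one>) xs"]) (auto simp: scalars_def)
    ultimately show ?thesis
      unfolding A.Span_eq_combine_set_length_version[OF subfield_scalars e] by blast
  qed
  then show ?thesis
    using lincomb_closed[OF assms(2)] by (auto simp: spanning_def)
qed

lemma lin_independent_iff_independent:
  assumes "distinct xs" "e \<in> set xs \<rightarrow> carrier A"
  shows "lin_independent (set xs) e \<longleftrightarrow> A.independent scalars (map e xs)"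
proof
  have e: "set (map e xs) \<subseteq> carrier A" using assms(2) by auto
  {
    assume indep: "lin_independent (set xs) e"
    show "A.independent scalars (map e xs)"
    proof (rule A.trivial_combine_imp_independent[OF subfield_scalars e])
      fix Ks assume Ks: "set Ks \<subseteq> scalars" "A.combine Ks (map e xs) = \<zero>"
      have sub: "scalars \<subseteq> carrier A" by (auto simp: scalars_def)
      obtain Ls where Ls: "length Ls = length (map e xs)" "set Ls \<subseteq> set (take (length (map e xs)) Ks) \<union> {\<zero>}"
        "A.combine Ls (map e xs) = \<zero>" "set (take (length (map e xs)) Ks) \<subseteq> set Ls"
        using A.combine_normalize[OF subset_trans[OF Ks(1) sub] e Ks(2)] by metis
      have "\<zero> \<in> scalars" unfolding scalars_def by (rule image_eqI[of _ _ "\<zero>\<^bsub>K\<^esub>"]) auto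
      then have "set Ls \<subseteq> scalars" using Ls(2) Ks(1) set_take_subset[of "length (map e xs)" Ks] by blast
      from scalar_list[OF assms(1) _ this] Ls(1)
      obtain c where c: "c \<in> set xs \<rightarrow> carrier K" "Ls = map (\<lambda>i. c i \<odot> \<one>) xs"
        by auto
      have "\<forall>i\<in>set xs. c i = \<zero>\<^bsub>K\<^esub>"
        using indep c(1) Ls(3) combine_eq_lincomb[OF assms c(1)] unfolding lin_independent_def c(2) by auto
      then show "set (take (length (map e xs)) Ks) \<subseteq> {\<zero>}" using Ls(4) c(2) by auto
    qed
  next
    assume indep: "A.independent scalars (map e xs)"
    show "lin_independent (set xs) e"
      unfolding lin_independent_def
    proof (intro ballI impI)
      fix c i assume c: "c \<in> set xs \<rightarrow> carrier K" "(\<Oplus>i\<in>set xs. c i \<odot> e i) = \<zero>" and i: "i \<in> set xs"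
      have "set (map (\<lambda>i. c i \<odot> \<one>) xs) \<subseteq> {\<zero>}"
        using A.independent_imp_trivial_combine[OF subfield_scalars indep, of "map (\<lambda>i. c i \<odot> \<one>) xs"]
          combine_eq_lincomb[OF assms c(1)] c by (auto simp: scalars_def)
      then have "c i \<odot> \<one> = \<zero>" using i by auto
      then show "c i = \<zero>\<^bsub>K\<^esub>" using smult_eq_zero_iff[of "c i" \<one>] one_not_zero c(1) i by auto
    qed
  }
qed

lemma basis_iff_list:
  assumes "distinct xs" "e \<in> set xs \<rightarrow> carrier A"
  shows "basis (set xs) e \<longleftrightarrow> A.Span scalars (map e xs) = carrier A \<and> A.independent scalars (map e xs)"
  unfolding basis_def spanning_iff_Span[OF assms] lin_independent_iff_independent[OF assms]
  using assms(2) by blast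

lemma basis_dimension:
  assumes "basis I e"
  shows "A.dimension (card I) scalars (carrier A)"
proof -
  from assms have "finite I" by (simp add: basis_def)
  then obtain xs where xs: "set xs = I" "distinct xs" using finite_distinct_list by blast
  moreover have "e \<in> I \<rightarrow> carrier A" using assms by (simp add: basis_def)
  ultimately show ?thesis
    using assms A.dimensionI[OF subfield_scalars, of "map e xs" "carrier A"] basis_iff_list[of xs e]
      distinct_card[of xs] by auto
qed

lemma independent_imp_basis:
  assumes "basis I e" "finite J" "card J = card I" "f \<in> J \<rightarrow> carrier A" "lin_independent J f"
  shows "basis J f"
proof -
  obtain xs where xs: "set xs = J" "distinct xs" using assms(2) finite_distinct_list by blast
  have f: "f \<in> set xs \<rightarrow> carrier A" using assms(4) xs(1) by simp
  have ind: "A.independent scalars (map f xs)"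
    using lin_independent_iff_independent[OF xs(2) f] assms(5) xs(1) by simp
  have "set (map f xs) \<subseteq> carrier A" using f by auto
  then have "A.Span scalars (map f xs) = carrier A"
    using A.independent_length_eq_dimension[OF subfield_scalars basis_dimension[OF assms(1)] ind]
      distinct_card[OF xs(2)] assms(3) xs(1) by simp
  then show ?thesis using basis_iff_list[OF xs(2) f] ind xs(1) by simp
qed

text \<open>Leave out every vector that lies in the span of the later ones: the span stays the same, and
  the length drops unless the list was independent from the start.\<close>

lemma independent_sublist_spanning:
  assumes "set Us \<subseteq> carrier A"
  shows "\<exists>Vs. A.independent scalars Vs \<and> A.Span scalars Vs = A.Span scalars Us \<and>
    (A.independent scalars Us \<or> length Vs < length Us) \<and> length Vs \<le> length Us"
  using assms
proof (induction Us)
  case Nil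
  then show ?case by auto
next
  case (Cons u Us)
  then obtain Vs where Vs: "A.independent scalars Vs" "A.Span scalars Vs = A.Span scalars Us"
    "A.independent scalars Us \<or> length Vs < length Us" "length Vs \<le> length Us" by auto
  show ?case
  proof (cases "u \<in> A.Span scalars Us")
    case True
    have us: "set Us \<subseteq> A.Span scalars Us"
      using A.Span_base_incl[OF subfield_scalars] Cons.prems by simp
    have "A.Span scalars (u # Us) = A.Span scalars Us"
      using A.mono_Span_subset[OF subfield_scalars, of "u # Us" Us]
        A.mono_Span_subset[OF subfield_scalars, of Us "u # Us"] us True Cons.prems
        A.Span_base_incl[OF subfield_scalars, of "u # Us"] by auto
    then show ?thesis using Vs by (intro exI[of _ Vs]) auto
  next
    case False
    then have "A.independent scalars (u # Vs)" using A.li_Cons[of u scalars Vs] Vs Cons.prems by auto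
    moreover have "A.Span scalars (u # Vs) = A.Span scalars (u # Us)" using Vs(2) by simp
    moreover have "A.independent scalars Us \<Longrightarrow> A.independent scalars (u # Us)"
      using False A.li_Cons[of u scalars Us] Cons.prems by simp
    ultimately show ?thesis using Vs by (intro exI[of _ "u # Vs"]) auto
  qed
qed

text \<open>If the family were dependent, the algebra would be spanned by fewer vectors than its
  dimension.\<close>

lemma spanning_imp_basis:
  assumes "basis I e" "finite J" "card J = card I" "f \<in> J \<rightarrow> carrier A" "spanning J f"
  shows "basis J f"
proof -
  obtain xs where xs: "set xs = J" "distinct xs" using assms(2) finite_distinct_list by blast
  have f: "f \<in> set xs \<rightarrow> carrier A" using assms(4) xs(1) by simp
  have fs: "set (map f xs) \<subseteq> carrier A" using f by auto
  have span: "A.Span scalars (map f xs) = carrier A"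
    using spanning_iff_Span[OF xs(2) f] assms(5) xs(1) by simp
  have len: "length (map f xs) = card I" using distinct_card[OF xs(2)] assms(3) xs(1) by simp
  obtain Vs where Vs: "A.independent scalars Vs" "A.Span scalars Vs = carrier A"
    "A.independent scalars (map f xs) \<or> length Vs < card I"
    using independent_sublist_spanning[OF fs] span len by metis
  have "length Vs = card I"
    using A.dimension_is_inj[OF subfield_scalars basis_dimension[OF assms(1)] A.dimensionI[OF subfield_scalars Vs(1,2)]]
    by simp
  then have "A.independent scalars (map f xs)" using Vs(3) by simp
  then show ?thesis using basis_iff_list[OF xs(2) f] span xs(1) by simp
qed

lemma lin_independentD:
  "lin_independent I e \<Longrightarrow> c \<in> I \<rightarrow> carrier K \<Longrightarrow> (\<Oplus>i\<in>I. c i \<odot> e i) = \<zero> \<Longrightarrow> i \<in> I \<Longrightarrow> c i = \<zero>\<^bsub>K\<^esub>"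
  unfolding lin_independent_def by blast

lemma basis_unique:
  assumes "basis I e" "c \<in> I \<rightarrow> carrier K" "d \<in> I \<rightarrow> carrier K"
    and "(\<Oplus>i\<in>I. c i \<odot> e i) = (\<Oplus>i\<in>I. d i \<odot> e i)" and "i \<in> I"
  shows "c i = d i"
proof -
  have e: "e \<in> I \<rightarrow> carrier A" "lin_independent I e" using assms(1) by (auto simp: basis_def)
  have cd: "c j \<in> carrier K" "d j \<in> carrier K" "e j \<in> carrier A" if "j \<in> I" for j
    using assms(2,3) e(1) that by auto
  let ?m = "\<ominus>\<^bsub>K\<^esub> \<one>\<^bsub>K\<^esub>"
  have neg: "?m \<otimes>\<^bsub>K\<^esub> k = \<ominus>\<^bsub>K\<^esub> k" if "k \<in> carrier K" for k using that by (simp add: K.l_minus)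
  have "(\<Oplus>j\<in>I. (c j \<oplus>\<^bsub>K\<^esub> ?m \<otimes>\<^bsub>K\<^esub> d j) \<odot> e j) = (\<Oplus>j\<in>I. c j \<odot> e j \<oplus> ?m \<odot> (d j \<odot> e j))"
    using cd by (intro A.finsum_cong) (auto simp: smult_l_distr smult_assoc1 simp_implies_def)
  also have "\<dots> = (\<Oplus>j\<in>I. c j \<odot> e j) \<oplus> (\<Oplus>j\<in>I. ?m \<odot> (d j \<odot> e j))"
    using cd by (intro A.finsum_addf) auto
  also have "(\<Oplus>j\<in>I. ?m \<odot> (d j \<odot> e j)) = ?m \<odot> (\<Oplus>j\<in>I. d j \<odot> e j)"
    using cd assms(1) by (intro finsum_smult_ldistr[symmetric]) (auto simp: basis_def)
  also have "\<dots> = \<ominus> (\<Oplus>j\<in>I. d j \<odot> e j)"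
    using lincomb_closed[OF e(1) assms(3)] by (simp add: smult_l_minus)
  also have "(\<Oplus>j\<in>I. c j \<odot> e j) \<oplus> \<ominus> (\<Oplus>j\<in>I. d j \<odot> e j) = \<zero>"
    using lincomb_closed[OF e(1) assms(3)] assms(4) by (simp add: A.r_neg)
  finally have "c i \<oplus>\<^bsub>K\<^esub> ?m \<otimes>\<^bsub>K\<^esub> d i = \<zero>\<^bsub>K\<^esub>"
    using e(2) cd assms(5) unfolding lin_independent_def
    by (elim ballE[of _ _ "\<lambda>j. c j \<oplus>\<^bsub>K\<^esub> ?m \<otimes>\<^bsub>K\<^esub> d j"]) auto
  then show ?thesis
    using cd[OF assms(5)] neg K.minus_equality[of "c i" "\<ominus>\<^bsub>K\<^esub> d i"] by simp
qed

lemma basis_reindex: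
  assumes "basis I e" "bij_betw h J I"
  shows "basis J (\<lambda>j. e (h j))"
proof (rule independent_imp_basis[OF assms(1)])
  have fin: "finite I" and e: "e \<in> I \<rightarrow> carrier A" and ind: "lin_independent I e"
    using assms(1) by (auto simp: basis_def)
  have hJ: "h ` J = I" and inj: "inj_on h J" using assms(2) by (auto simp: bij_betw_def)
  show "finite J" using assms(2) fin bij_betw_finite by blast
  show "card J = card I" using assms(2) by (rule bij_betw_same_card)
  show "(\<lambda>j. e (h j)) \<in> J \<rightarrow> carrier A" using e hJ by auto
  show "lin_independent J (\<lambda>j. e (h j))"
    unfolding lin_independent_def
  proof (intro ballI impI)
    fix c j
    assume c: "c \<in> J \<rightarrow> carrier K" and sum: "(\<Oplus>j\<in>J. c j \<odot> e (h j)) = \<zero>" and j: "j \<in> J"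
    let ?c = "\<lambda>i. c (inv_into J h i)"
    have cI: "?c \<in> I \<rightarrow> carrier K" using c hJ inv_into_into[of _ h J] by auto
    have "(\<Oplus>i\<in>I. ?c i \<odot> e i) = (\<Oplus>j\<in>J. ?c (h j) \<odot> e (h j))"
      unfolding hJ[symmetric] using inj e cI hJ by (intro A.finsum_reindex) auto
    also have "\<dots> = (\<Oplus>j\<in>J. c j \<odot> e (h j))"
      using inj c e hJ by (intro A.finsum_cong) (auto simp: simp_implies_def Pi_iff)
    also note sum
    finally have "\<forall>i\<in>I. ?c i = \<zero>\<^bsub>K\<^esub>" using ind cI by (simp add: lin_independent_def)
    then show "c j = \<zero>\<^bsub>K\<^esub>" using j hJ inj by auto
  qed
qed

lemma basis_nonzero:
  assumes "basis I e" "i \<in> I"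
  shows "e i \<noteq> \<zero>"
proof
  assume z: "e i = \<zero>"
  let ?c = "\<lambda>j. if i = j then \<one>\<^bsub>K\<^esub> else \<zero>\<^bsub>K\<^esub>"
  have b: "finite I" "e \<in> I \<rightarrow> carrier A" "lin_independent I e" using assms(1) by (auto simp: basis_def)
  have "(\<Oplus>j\<in>I. ?c j \<odot> e j) = \<zero>" using lincomb_delta[OF b(1) assms(2) b(2), of "\<one>\<^bsub>K\<^esub>"] z by simp
  moreover have "?c \<in> I \<rightarrow> carrier K" by auto
  ultimately have "?c i = \<zero>\<^bsub>K\<^esub>" using lin_independentD[OF b(3), of ?c i] assms(2) by blast
  then show False by simp
qed

text \<open>Let \<open>c j\<close> be the first nonzero coefficient of a relation. Multiplication by \<open>y [^] (m - j)\<close>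
  kills the later terms and leaves \<open>c j \<odot> y [^] m = \<zero>\<close>.\<close>

lemma powers_independent:
  assumes y: "y \<in> carrier A" and nil: "y [^] Suc m = \<zero>" and nz: "y [^] m \<noteq> \<zero>"
  shows "lin_independent {..m} (\<lambda>i. y [^] i)"
  unfolding lin_independent_def
proof (intro ballI impI)
  fix c i
  assume c: "c \<in> {..m} \<rightarrow> carrier K" and sum: "(\<Oplus>i\<in>{..m}. c i \<odot> y [^] i) = \<zero>" and i: "i \<in> {..m}"
  have cK: "c i \<in> carrier K" if "i \<le> m" for i using c that by auto
  have "c j = \<zero>\<^bsub>K\<^esub>" if "j \<le> m" for j
    using that
  proof (induction j rule: less_induct)
    case (less j)
    have summand: "y [^] (m - j) \<otimes> (c i \<odot> y [^] i) = (if j = i then c i \<odot> y [^] m else \<zero>)"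
      if "i \<in> {..m}" for i
    proof -
      have eq: "y [^] (m - j) \<otimes> (c i \<odot> y [^] i) = c i \<odot> y [^] (m - j + i)"
        using y cK that by (simp add: mult_smult A.nat_pow_mult)
      consider "i < j" | "i = j" | "i > j" by linarith
      then show ?thesis
      proof cases
        case 1
        then show ?thesis unfolding eq using less y by simp
      next
        case 2
        then show ?thesis unfolding eq using less by simp
      next
        case 3
        then have "m - j + i = Suc m + (i - j - 1)" using less.prems by simp
        then have "y [^] (m - j + i) = y [^] Suc m \<otimes> y [^] (i - j - 1)"
          using y by (simp only: A.nat_pow_mult)
        then show ?thesis unfolding eq nil using 3 cK that y by simp
      qed
    qed
    have "\<zero> = y [^] (m - j) \<otimes> (\<Oplus>i\<in>{..m}. c i \<odot> y [^] i)"
      unfolding sum using y by simp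
    also have "\<dots> = (\<Oplus>i\<in>{..m}. y [^] (m - j) \<otimes> (c i \<odot> y [^] i))"
      using y cK by (intro A.finsum_rdistr) auto
    also have "\<dots> = (\<Oplus>i\<in>{..m}. if j = i then c i \<odot> y [^] m else \<zero>)"
      using y cK summand by (intro A.finsum_cong) (auto simp: simp_implies_def)
    also have "\<dots> = c j \<odot> y [^] m"
      using less.prems y cK by (intro A.finsum_singleton) auto
    finally have "c j \<odot> y [^] m = \<zero>" by (rule sym)
    then show ?case using smult_eq_zero_iff[of "c j" "y [^] m"] less.prems cK y nz by auto
  qed
  then show "c i = \<zero>\<^bsub>K\<^esub>" using i by simp
qed

end

section \<open>Gradings and homogeneous bases\<close>

context field_algebra
begin

lemma submodule_subset: "submodule W K A \<Longrightarrow> W \<subseteq> carrier A"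
  using submoduleE(1) by blast

lemma submodule_subgroup: "submodule W K A \<Longrightarrow> subgroup W (add_monoid A)"
  by (rule submodule.axioms(1))

lemma submodule_zero: "submodule W K A \<Longrightarrow> \<zero> \<in> W"
  using subgroup.one_closed[OF submodule_subgroup] by simp

lemma family_sum_eq_finsum:
  assumes "f \<in> S \<rightarrow> carrier A" "finite T" "T \<subseteq> S" "\<And>s. s \<in> S - T \<Longrightarrow> f s = \<zero>"
  shows "family_sum A S f = finsum A f T"
  unfolding family_sum_def
  by (rule A.add.finprod_mono_neutral_cong_left) (use assms in auto)

lemma family_in_carrier:
  assumes "\<forall>s\<in>S. submodule (U s) K A" "f \<in> finite_families A S U"
  shows "f \<in> S \<rightarrow> carrier A"
  using assms submodule_subset by (fastforce simp: finite_families_def)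

lemma finite_families_mem: "f \<in> finite_families A S U \<Longrightarrow> s \<in> S \<Longrightarrow> f s \<in> U s"
  unfolding finite_families_def by blast

lemma single_family:
  assumes "\<forall>s\<in>S. submodule (U s) K A" "t \<in> S" "u \<in> U t"
  shows "(\<lambda>s\<in>S. if s = t then u else \<zero>) \<in> finite_families A S U" (is "?f \<in> _")
    and "family_sum A S (\<lambda>s\<in>S. if s = t then u else \<zero>) = u"
proof -
  have sub: "{s \<in> S. ?f s \<noteq> \<zero>} \<subseteq> {t}" by auto
  show "?f \<in> finite_families A S U"
    using assms submodule_zero finite_subset[OF sub] by (auto simp: finite_families_def)
  have u: "u \<in> carrier A" using assms submodule_subset by blast
  have "family_sum A S ?f = finsum A ?f {t}"
    by (rule family_sum_eq_finsum) (use assms u in auto)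
  then show "family_sum A S ?f = u" using u assms(2) by simp
qed

lemma add_families:
  assumes "\<forall>s\<in>S. submodule (U s) K A" "f \<in> finite_families A S U" "g \<in> finite_families A S U"
  shows "(\<lambda>s\<in>S. f s \<oplus> g s) \<in> finite_families A S U"
    and "family_sum A S (\<lambda>s\<in>S. f s \<oplus> g s) = family_sum A S f \<oplus> family_sum A S g"
proof -
  let ?T = "{s \<in> S. f s \<noteq> \<zero>} \<union> {s \<in> S. g s \<noteq> \<zero>}" and ?h = "\<lambda>s\<in>S. f s \<oplus> g s"
  note fA = family_in_carrier[OF assms(1,2)] family_in_carrier[OF assms(1,3)]
  have T: "finite ?T" "?T \<subseteq> S" using assms(2,3) by (auto simp: finite_families_def)
  have "{s \<in> S. ?h s \<noteq> \<zero>} \<subseteq> ?T" by auto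
  then have "finite {s \<in> S. ?h s \<noteq> \<zero>}" using T(1) finite_subset by blast
  moreover have "f s \<oplus> g s \<in> U s" if "s \<in> S" for s
    using assms that submoduleE(5)[of "U s" "f s" "g s"] by (auto simp: finite_families_def)
  ultimately show "?h \<in> finite_families A S U" by (auto simp: finite_families_def)
  have "family_sum A S ?h = finsum A ?h ?T"
    by (rule family_sum_eq_finsum) (use fA T in \<open>auto simp: Pi_iff\<close>)
  also have "\<dots> = (\<Oplus>s\<in>?T. f s \<oplus> g s)"
    using fA by (intro A.finsum_cong) (auto simp: Pi_iff simp_implies_def)
  also have "\<dots> = finsum A f ?T \<oplus> finsum A g ?T"
    by (rule A.finsum_addf) (use fA in auto)
  also have "finsum A f ?T = family_sum A S f"
    by (rule family_sum_eq_finsum[symmetric]) (use fA T in auto)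
  also have "finsum A g ?T = family_sum A S g"
    by (rule family_sum_eq_finsum[symmetric]) (use fA T in auto)
  finally show "family_sum A S ?h = family_sum A S f \<oplus> family_sum A S g" .
qed

lemma map_family:
  assumes "\<forall>s\<in>S. submodule (U s) K A" "f \<in> finite_families A S U"
    and h: "h \<in> hom (add_monoid A) (add_monoid A)" "\<And>s u. s \<in> S \<Longrightarrow> u \<in> U s \<Longrightarrow> h u \<in> U s"
  shows "(\<lambda>s\<in>S. h (f s)) \<in> finite_families A S U"
    and "family_sum A S (\<lambda>s\<in>S. h (f s)) = h (family_sum A S f)"
proof -
  interpret h: group_hom "add_monoid A" "add_monoid A" h
    using h(1) by (simp add: group_hom_def group_hom_axioms_def A.a_group)
  have h0: "h \<zero> = \<zero>" using h.hom_one by simp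
  have hc: "h a \<in> carrier A" if "a \<in> carrier A" for a using h.hom_closed that by simp
  let ?T = "{s \<in> S. f s \<noteq> \<zero>}" and ?h = "\<lambda>s\<in>S. h (f s)"
  note fA = family_in_carrier[OF assms(1,2)]
  have T: "finite ?T" "?T \<subseteq> S" using assms(2) by (auto simp: finite_families_def)
  have "{s \<in> S. ?h s \<noteq> \<zero>} \<subseteq> ?T" using h0 by auto
  then have "finite {s \<in> S. ?h s \<noteq> \<zero>}" using T(1) finite_subset by blast
  then show "?h \<in> finite_families A S U" using assms(2) h(2) by (auto simp: finite_families_def)
  have "family_sum A S ?h = finsum A ?h ?T"
    by (rule family_sum_eq_finsum) (use fA T h0 hc in \<open>auto simp: Pi_iff\<close>)
  also have "\<dots> = (\<Oplus>s\<in>?T. h (f s))"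
    using fA hc by (intro A.finsum_cong) (auto simp: Pi_iff simp_implies_def)
  also have "\<dots> = h (finsum A f ?T)"
    by (rule finsum_additive_map[symmetric, OF A.is_abelian_group A.is_abelian_group h(1)])
      (use fA T in auto)
  also have "finsum A f ?T = family_sum A S f" by (simp add: family_sum_def)
  finally show "family_sum A S ?h = h (family_sum A S f)" .
qed

lemma subgroup_family_sums:
  assumes "\<forall>s\<in>S. submodule (U s) K A"
  shows "subgroup (family_sum A S ` finite_families A S U) (add_monoid A)" (is "subgroup ?W _")
proof (rule A.add.subgroupI)
  have sumA: "family_sum A S f \<in> carrier A" if "f \<in> finite_families A S U" for f
    unfolding family_sum_def using family_in_carrier[OF assms that] by (intro A.finsum_closed) auto
  then show "?W \<subseteq> carrier A" by auto
  have "(\<lambda>s\<in>S. \<zero>) \<in> finite_families A S U"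
    using assms submodule_zero by (auto simp: finite_families_def)
  then show "?W \<noteq> {}" by auto
  fix a assume a: "a \<in> ?W"
  then obtain f where f: "f \<in> finite_families A S U" "a = family_sum A S f" by auto
  have "(\<lambda>s\<in>S. (\<ominus>\<^bsub>K\<^esub> \<one>\<^bsub>K\<^esub>) \<odot> f s) \<in> finite_families A S U"
    "family_sum A S (\<lambda>s\<in>S. (\<ominus>\<^bsub>K\<^esub> \<one>\<^bsub>K\<^esub>) \<odot> f s) = (\<ominus>\<^bsub>K\<^esub> \<one>\<^bsub>K\<^esub>) \<odot> family_sum A S f"
    using assms submoduleE(4) by (intro map_family[OF assms f(1) smult_hom]; force)+
  moreover have "(\<ominus>\<^bsub>K\<^esub> \<one>\<^bsub>K\<^esub>) \<odot> family_sum A S f = \<ominus> a"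
    using sumA[OF f(1)] f(2) by (simp add: smult_l_minus)
  ultimately show "\<ominus> a \<in> ?W"
    by (intro image_eqI[of _ _ "\<lambda>s\<in>S. (\<ominus>\<^bsub>K\<^esub> \<one>\<^bsub>K\<^esub>) \<odot> f s"]) simp_all
  fix b assume "b \<in> ?W"
  then obtain g where g: "g \<in> finite_families A S U" "b = family_sum A S g" by auto
  show "a \<oplus> b \<in> ?W"
    unfolding f(2) g(2) using add_families[OF assms f(1) g(1)]
    by (intro image_eqI[of _ _ "\<lambda>s\<in>S. f s \<oplus> g s"]) simp_all
qed

text \<open>The maps \<open>P s\<close> recover the members of a family from its sum, which gives injectivity.
  Surjectivity is stated as the absence of a proper subgroup containing all components, because the
  sums of families form such a subgroup; an application then has no family to write down.\<close>

lemma gradingI: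
  assumes group: "group G" and sub: "\<forall>s\<in>carrier G. submodule (U s) K A"
    and mult: "\<And>t s a b. t \<in> carrier G \<Longrightarrow> s \<in> carrier G \<Longrightarrow> a \<in> U t \<Longrightarrow> b \<in> U s \<Longrightarrow> a \<otimes> b \<in> U (t \<otimes>\<^bsub>G\<^esub> s)"
    and hom: "\<And>s. s \<in> carrier G \<Longrightarrow> P s \<in> hom (add_monoid A) (add_monoid A)"
    and proj: "\<And>s t u. s \<in> carrier G \<Longrightarrow> t \<in> carrier G \<Longrightarrow> u \<in> U t \<Longrightarrow> P s u = (if s = t then u else \<zero>)"
    and gen: "\<And>W. subgroup W (add_monoid A) \<Longrightarrow> (\<And>s. s \<in> carrier G \<Longrightarrow> U s \<subseteq> W) \<Longrightarrow> carrier A \<subseteq> W"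
  shows "grading K A G U"
proof -
  let ?F = "finite_families A (carrier G) U" and ?\<sigma> = "family_sum A (carrier G)"
  have component: "P s (?\<sigma> f) = f s" if f: "f \<in> ?F" and s: "s \<in> carrier G" for f s
  proof -
    note fA = family_in_carrier[OF sub f]
    let ?T = "insert s {t \<in> carrier G. f t \<noteq> \<zero>}"
    have T: "finite ?T" "?T \<subseteq> carrier G" using f s by (auto simp: finite_families_def)
    have Pf: "P s (f t) = (if s = t then f t else \<zero>)" if "t \<in> carrier G" for t
      using proj[OF s that finite_families_mem[OF f that]] .
    have "P s (?\<sigma> f) = P s (finsum A f ?T)"
      using family_sum_eq_finsum[OF fA T] by auto
    also have "\<dots> = (\<Oplus>t\<in>?T. P s (f t))"
      by (rule finsum_additive_map[OF A.is_abelian_group A.is_abelian_group hom[OF s]])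
        (use fA T in auto)
    also have "\<dots> = (\<Oplus>t\<in>?T. if s = t then f t else \<zero>)"
      by (rule A.finsum_cong) (use fA T Pf in \<open>auto simp: simp_implies_def\<close>)
    also have "\<dots> = f s"
      by (rule A.finsum_singleton) (use T fA s in auto)
    finally show ?thesis .
  qed
  have "inj_on ?\<sigma> ?F"
  proof (rule inj_onI)
    fix f g assume fg: "f \<in> ?F" "g \<in> ?F" "?\<sigma> f = ?\<sigma> g"
    then have "f s = g s" if "s \<in> carrier G" for s using component that by metis
    moreover have "f \<in> extensional (carrier G)" "g \<in> extensional (carrier G)"
      using fg by (auto simp: finite_families_def PiE_def)
    ultimately show "f = g" by (rule extensionalityI[rotated 2])
  qed
  moreover have "?\<sigma> ` ?F = carrier A"
  proof
    show "?\<sigma> ` ?F \<subseteq> carrier A" using subgroup.subset[OF subgroup_family_sums[OF sub]] by simp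
    show "carrier A \<subseteq> ?\<sigma> ` ?F"
    proof (rule gen[OF subgroup_family_sums[OF sub]])
      fix s assume "s \<in> carrier G"
      then show "U s \<subseteq> ?\<sigma> ` ?F"
        using single_family[OF sub] by (intro subsetI image_eqI[OF sym]) auto
    qed
  qed
  ultimately show ?thesis
    unfolding grading_def bij_betw_def using group sub mult by blast
qed

text \<open>The projections onto the homogeneous components. The sum in the last clause runs over
  the support, since \<^const>\<open>finsum\<close> over an infinite set is zero.\<close>

definition homogeneous_projections :: "('g, 'o) monoid_scheme \<Rightarrow> ('g \<Rightarrow> 'a set) \<Rightarrow> ('g \<Rightarrow> 'a \<Rightarrow> 'a) \<Rightarrow> bool"
  where "homogeneous_projections G U P \<longleftrightarrow>
    (\<forall>s\<in>carrier G. P s \<in> hom (add_monoid A) (add_monoid A) \<and> (\<forall>a\<in>carrier A. P s a \<in> U s)) \<and>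
    (\<forall>s\<in>carrier G. \<forall>t\<in>carrier G. \<forall>u\<in>U t. P s u = (if s = t then u else \<zero>)) \<and>
    (\<forall>a\<in>carrier A. finite {s \<in> carrier G. P s a \<noteq> \<zero>} \<and>
      a = (\<Oplus>s\<in>{s \<in> carrier G. P s a \<noteq> \<zero>}. P s a))"

text \<open>Uniqueness of the decomposition into homogeneous components makes the projections additive.\<close>

lemma grading_projections:
  assumes "grading K A G U"
  shows "\<exists>P. homogeneous_projections G U P"
proof -
  let ?F = "finite_families A (carrier G) U" and ?\<sigma> = "family_sum A (carrier G)"
  from assms have sub: "\<forall>s\<in>carrier G. submodule (U s) K A" and bij: "bij_betw ?\<sigma> ?F (carrier A)"
    by (auto simp: grading_def)
  define f where "f = inv_into ?F ?\<sigma>"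
  have f: "f a \<in> ?F" "?\<sigma> (f a) = a" if "a \<in> carrier A" for a
    using that bij unfolding f_def by (auto simp: bij_betw_def inv_into_into f_inv_into_f)
  have f_unique: "f (?\<sigma> g) = g" if "g \<in> ?F" for g
    using that bij unfolding f_def by (auto simp: bij_betw_def)
  show ?thesis
    unfolding homogeneous_projections_def
  proof (intro exI[of _ "\<lambda>s a. f a s"] conjI ballI)
    fix s assume s: "s \<in> carrier G"
    show "(\<lambda>a. f a s) \<in> hom (add_monoid A) (add_monoid A)"
    proof (rule homI)
      fix a assume "a \<in> carrier (add_monoid A)"
      then show "f a s \<in> carrier (add_monoid A)" using family_in_carrier[OF sub f(1)] s by auto
    next
      fix a b assume "a \<in> carrier (add_monoid A)" "b \<in> carrier (add_monoid A)"
      then have ab: "a \<in> carrier A" "b \<in> carrier A" by auto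
      have "f (a \<oplus> b) = (\<lambda>s\<in>carrier G. f a s \<oplus> f b s)"
        using f_unique add_families[OF sub f(1)[OF ab(1)] f(1)[OF ab(2)]] f(2) ab by metis
      then show "f (a \<otimes>\<^bsub>add_monoid A\<^esub> b) s = f a s \<otimes>\<^bsub>add_monoid A\<^esub> f b s" using s by simp
    qed
    fix a assume a: "a \<in> carrier A"
    show "f a s \<in> U s" using finite_families_mem[OF f(1)[OF a] s] .
  next
    fix s t u assume s: "s \<in> carrier G" and tu: "t \<in> carrier G" "u \<in> U t"
    show "f u s = (if s = t then u else \<zero>)"
      using f_unique[OF single_family(1)[OF sub tu]] single_family(2)[OF sub tu] s by simp
  next
    fix a assume a: "a \<in> carrier A"
    show "finite {s \<in> carrier G. f a s \<noteq> \<zero>}" using f(1)[OF a] by (simp add: finite_families_def)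
    show "a = (\<Oplus>s\<in>{s \<in> carrier G. f a s \<noteq> \<zero>}. f a s)"
      using f(2)[OF a] by (simp add: family_sum_def)
  qed
qed

lemma
  assumes "homogeneous_projections G U P"
  shows projection_hom: "s \<in> carrier G \<Longrightarrow> P s \<in> hom (add_monoid A) (add_monoid A)"
    and projection_mem: "s \<in> carrier G \<Longrightarrow> a \<in> carrier A \<Longrightarrow> P s a \<in> U s"
    and projection_component:
      "s \<in> carrier G \<Longrightarrow> t \<in> carrier G \<Longrightarrow> u \<in> U t \<Longrightarrow> P s u = (if s = t then u else \<zero>)"
    and projection_finite: "a \<in> carrier A \<Longrightarrow> finite {s \<in> carrier G. P s a \<noteq> \<zero>}"
    and projection_sum: "a \<in> carrier A \<Longrightarrow> (\<Oplus>s\<in>{s \<in> carrier G. P s a \<noteq> \<zero>}. P s a) = a"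
  using assms unfolding homogeneous_projections_def by (blast, blast, blast, blast, metis)

lemma grading_cong:
  assumes "grading K A G U" "\<And>s. s \<in> carrier G \<Longrightarrow> U s = V s"
  shows "grading K A G V"
proof -
  have "finite_families A (carrier G) U = finite_families A (carrier G) V"
    unfolding finite_families_def using assms(2) by (simp cong: PiE_cong)
  moreover have "t \<otimes>\<^bsub>G\<^esub> s \<in> carrier G" if "t \<in> carrier G" "s \<in> carrier G" for t s
    using assms(1) that by (auto simp: grading_def group_def monoid.m_closed)
  ultimately show ?thesis using assms unfolding grading_def by simp
qed

text \<open>The span of the basis vectors of degree \<open>s\<close>, if \<open>e i\<close> is given the degree \<open>d i\<close>.\<close>

definition basis_component :: "'i set \<Rightarrow> ('i \<Rightarrow> 'a) \<Rightarrow> ('i \<Rightarrow> 'g) \<Rightarrow> 'g \<Rightarrow> 'a set"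
  where "basis_component I e d s =
    {\<Oplus>i\<in>I. c i \<odot> e i | c. c \<in> I \<rightarrow> carrier K \<and> (\<forall>i\<in>I. d i \<noteq> s \<longrightarrow> c i = \<zero>\<^bsub>K\<^esub>)}"

lemma basis_componentI:
  "c \<in> I \<rightarrow> carrier K \<Longrightarrow> (\<And>i. i \<in> I \<Longrightarrow> d i \<noteq> s \<Longrightarrow> c i = \<zero>\<^bsub>K\<^esub>) \<Longrightarrow>
    a = (\<Oplus>i\<in>I. c i \<odot> e i) \<Longrightarrow> a \<in> basis_component I e d s"
  unfolding basis_component_def by blast

lemma submodule_basis_component:
  assumes "finite I" "e \<in> I \<rightarrow> carrier A"
  shows "submodule (basis_component I e d s) K A" (is "submodule ?W K A")
proof -
  have subset: "?W \<subseteq> carrier A" using lincomb_closed[OF assms(2)] by (auto simp: basis_component_def)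
  have smult: "k \<odot> a \<in> ?W" if "k \<in> carrier K" "a \<in> ?W" for k a
  proof -
    from that(2) obtain c where c: "c \<in> I \<rightarrow> carrier K" "\<forall>i\<in>I. d i \<noteq> s \<longrightarrow> c i = \<zero>\<^bsub>K\<^esub>"
      "a = (\<Oplus>i\<in>I. c i \<odot> e i)" by (auto simp: basis_component_def)
    show ?thesis
      by (rule basis_componentI[of "\<lambda>i. k \<otimes>\<^bsub>K\<^esub> c i"])
        (use c that(1) lincomb_smult[OF assms c(1) that(1)] in auto)
  qed
  show ?thesis
  proof (rule submoduleI)
    show "?W \<subseteq> carrier A" by fact
    show "\<zero> \<in> ?W"
      by (rule basis_componentI[of "\<lambda>_. \<zero>\<^bsub>K\<^esub>"])
        (use assms(2) in \<open>auto intro!: A.add.finprod_one_eqI[symmetric] simp: Pi_iff\<close>)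
    show "\<ominus> a \<in> ?W" if "a \<in> ?W" for a
      using smult[of "\<ominus>\<^bsub>K\<^esub> \<one>\<^bsub>K\<^esub>" a] that subset by (auto simp: smult_l_minus)
    show "a \<oplus> b \<in> ?W" if ab: "a \<in> ?W" "b \<in> ?W" for a b
    proof -
      obtain c where c: "c \<in> I \<rightarrow> carrier K" "\<forall>i\<in>I. d i \<noteq> s \<longrightarrow> c i = \<zero>\<^bsub>K\<^esub>"
        "a = (\<Oplus>i\<in>I. c i \<odot> e i)" using ab(1) by (auto simp: basis_component_def)
      obtain c' where c': "c' \<in> I \<rightarrow> carrier K" "\<forall>i\<in>I. d i \<noteq> s \<longrightarrow> c' i = \<zero>\<^bsub>K\<^esub>"
        "b = (\<Oplus>i\<in>I. c' i \<odot> e i)" using ab(2) by (auto simp: basis_component_def)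
      show ?thesis
        by (rule basis_componentI[of "\<lambda>i. c i \<oplus>\<^bsub>K\<^esub> c' i"])
          (use c c' lincomb_add[OF assms(2) c(1) c'(1)] in auto)
    qed
    show "k \<odot> a \<in> ?W" if "k \<in> carrier K" "a \<in> ?W" for k a using smult that .
  qed
qed

lemma basis_in_component:
  assumes "finite I" "e \<in> I \<rightarrow> carrier A" "i \<in> I"
  shows "e i \<in> basis_component I e d (d i)"
  by (rule basis_componentI[of "\<lambda>j. if i = j then \<one>\<^bsub>K\<^esub> else \<zero>\<^bsub>K\<^esub>"])
    (use assms lincomb_delta[OF assms(1,3,2), of "\<one>\<^bsub>K\<^esub>"] in \<open>auto simp: Pi_iff\<close>)

lemma basis_component_inj:
  assumes "finite I" "e \<in> I \<rightarrow> carrier A" "inj_on d I" "i \<in> I"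
  shows "basis_component I e d (d i) = {k \<odot> e i | k. k \<in> carrier K}"
proof (intro equalityI subsetI)
  fix a assume "a \<in> basis_component I e d (d i)"
  then obtain c where c: "c \<in> I \<rightarrow> carrier K" "\<forall>j\<in>I. d j \<noteq> d i \<longrightarrow> c j = \<zero>\<^bsub>K\<^esub>"
    "a = (\<Oplus>j\<in>I. c j \<odot> e j)" by (auto simp: basis_component_def)
  have "a = (\<Oplus>j\<in>I. (if i = j then c i else \<zero>\<^bsub>K\<^esub>) \<odot> e j)"
    unfolding c(3) using c(1,2) assms by (intro A.finsum_cong) (auto simp: inj_on_def Pi_iff simp_implies_def)
  then show "a \<in> {k \<odot> e i | k. k \<in> carrier K}"
    using lincomb_delta[OF assms(1,4,2), of "c i"] c(1) assms(4) by auto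
next
  fix a assume "a \<in> {k \<odot> e i | k. k \<in> carrier K}"
  then show "a \<in> basis_component I e d (d i)"
    using submoduleE(4)[OF submodule_basis_component[OF assms(1,2)] _ basis_in_component[OF assms(1,2,4)]]
    by blast
qed

lemma basis_component_empty:
  assumes "e \<in> I \<rightarrow> carrier A" "s \<notin> d ` I"
  shows "basis_component I e d s \<subseteq> {\<zero>}"
proof
  fix a assume "a \<in> basis_component I e d s"
  then obtain c where c: "\<forall>j\<in>I. c j = \<zero>\<^bsub>K\<^esub>" "a = (\<Oplus>j\<in>I. c j \<odot> e j)"
    using assms(2) by (force simp: basis_component_def)
  then show "a \<in> {\<zero>}" using assms(1) by (auto intro!: A.add.finprod_one_eqI simp: Pi_iff)
qed

text \<open>The projection onto degree \<open>s\<close> erases the coordinates of all other degrees. By bilinearity,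
  compatibility with products can be tested on basis vectors.\<close>

lemma basis_grading:
  assumes basis: "basis I e" and group: "group G" and d: "d \<in> I \<rightarrow> carrier G"
    and mult: "\<And>i j. i \<in> I \<Longrightarrow> j \<in> I \<Longrightarrow> e i \<otimes> e j \<in> basis_component I e d (d i \<otimes>\<^bsub>G\<^esub> d j)"
  shows "grading K A G (basis_component I e d)"
proof -
  from basis have fin: "finite I" and e: "e \<in> I \<rightarrow> carrier A" and span: "spanning I e"
    by (auto simp: basis_def)
  note sub = submodule_basis_component[OF fin e, where d = d]
  obtain co where co: "\<And>a. a \<in> carrier A \<Longrightarrow> co a \<in> I \<rightarrow> carrier K"
    "\<And>a. a \<in> carrier A \<Longrightarrow> a = (\<Oplus>i\<in>I. co a i \<odot> e i)"
    using span unfolding spanning_def by metis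
  define P where "P s a = (\<Oplus>i\<in>I. (if d i = s then co a i else \<zero>\<^bsub>K\<^esub>) \<odot> e i)" for s a
  have co_unique: "co a i = c i" if "c \<in> I \<rightarrow> carrier K" "a = (\<Oplus>i\<in>I. c i \<odot> e i)" "i \<in> I" for a c i
    using basis_unique[OF basis, of "co a" c i] co[of a] that lincomb_closed[OF e that(1)] by auto
  have co_add: "co (a \<oplus> b) i = co a i \<oplus>\<^bsub>K\<^esub> co b i" if "a \<in> carrier A" "b \<in> carrier A" "i \<in> I" for a b i
    using that co lincomb_add[OF e co(1) co(1)]
    by (intro co_unique[of "\<lambda>i. co a i \<oplus>\<^bsub>K\<^esub> co b i"]) (auto simp: Pi_iff)
  have eA: "e i \<in> carrier A" if "i \<in> I" for i using e that by auto
  show ?thesis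
  proof (rule gradingI[OF group])
    show "\<forall>s\<in>carrier G. submodule (basis_component I e d s) K A" using sub by blast
    show "a \<otimes> b \<in> basis_component I e d (t \<otimes>\<^bsub>G\<^esub> s)"
      if ts: "t \<in> carrier G" "s \<in> carrier G" and ab: "a \<in> basis_component I e d t" "b \<in> basis_component I e d s"
      for t s a b
    proof -
      let ?W = "basis_component I e d (t \<otimes>\<^bsub>G\<^esub> s)"
      obtain c where c: "c \<in> I \<rightarrow> carrier K" "\<forall>i\<in>I. d i \<noteq> t \<longrightarrow> c i = \<zero>\<^bsub>K\<^esub>"
        "a = (\<Oplus>i\<in>I. c i \<odot> e i)" using ab(1) by (auto simp: basis_component_def)
      obtain c' where c': "c' \<in> I \<rightarrow> carrier K" "\<forall>i\<in>I. d i \<noteq> s \<longrightarrow> c' i = \<zero>\<^bsub>K\<^esub>"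
        "b = (\<Oplus>i\<in>I. c' i \<odot> e i)" using ab(2) by (auto simp: basis_component_def)
      have cc: "c i \<in> carrier K" "c' i \<in> carrier K" if "i \<in> I" for i using c c' that by auto
      have bA: "b \<in> carrier A" unfolding c'(3) by (rule lincomb_closed[OF e c'(1)])
      have summand: "(c i \<odot> e i) \<otimes> (c' j \<odot> e j) \<in> ?W" if ij: "i \<in> I" "j \<in> I" for i j
      proof -
        have eq: "(c i \<odot> e i) \<otimes> (c' j \<odot> e j) = (c i \<otimes>\<^bsub>K\<^esub> c' j) \<odot> (e i \<otimes> e j)"
          using ij cc eA by (intro smult_mult_smult) auto
        show ?thesis
        proof (cases "d i = t \<and> d j = s")
          case True
          then show ?thesis
            unfolding eq using mult[OF ij] ij cc by (intro submoduleE(4)[OF sub]) auto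
        next
          case False
          then have "c i = \<zero>\<^bsub>K\<^esub> \<or> c' j = \<zero>\<^bsub>K\<^esub>" using c(2) c'(2) ij by blast
          then have "c i \<otimes>\<^bsub>K\<^esub> c' j = \<zero>\<^bsub>K\<^esub>" using cc ij by auto
          then show ?thesis unfolding eq using submodule_zero[OF sub] eA ij by auto
        qed
      qed
      have "a \<otimes> b = (\<Oplus>i\<in>I. (c i \<odot> e i) \<otimes> b)"
        unfolding c(3) by (rule A.finsum_ldistr) (use fin bA eA cc in auto)
      moreover have "(c i \<odot> e i) \<otimes> b = (\<Oplus>j\<in>I. (c i \<odot> e i) \<otimes> (c' j \<odot> e j))" if "i \<in> I" for i
        unfolding c'(3) by (rule A.finsum_rdistr) (use fin eA cc that in auto)
      ultimately show ?thesis
        using A.subgroup_finsum_closed[OF submodule_subgroup[OF sub] fin] summand by (simp add: Pi_iff)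
    qed
    show "P s \<in> hom (add_monoid A) (add_monoid A)" for s
    proof (rule homI)
      fix a assume "a \<in> carrier (add_monoid A)"
      then show "P s a \<in> carrier (add_monoid A)"
        unfolding P_def using co(1)[of a] by (auto intro!: lincomb_closed[OF e] simp: Pi_iff)
    next
      fix a b assume "a \<in> carrier (add_monoid A)" "b \<in> carrier (add_monoid A)"
      then have ab: "a \<in> carrier A" "b \<in> carrier A" by auto
      have cK: "co a i \<in> carrier K" "co b i \<in> carrier K" if "i \<in> I" for i using co(1) ab that by auto
      have "P s a \<oplus> P s b = (\<Oplus>i\<in>I. ((if d i = s then co a i else \<zero>\<^bsub>K\<^esub>) \<oplus>\<^bsub>K\<^esub>
          (if d i = s then co b i else \<zero>\<^bsub>K\<^esub>)) \<odot> e i)"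
        unfolding P_def using cK by (intro lincomb_add[OF e]) auto
      also have "\<dots> = P s (a \<oplus> b)"
        unfolding P_def using cK ab eA by (intro A.finsum_cong) (auto simp: co_add simp_implies_def)
      finally show "P s (a \<otimes>\<^bsub>add_monoid A\<^esub> b) = P s a \<otimes>\<^bsub>add_monoid A\<^esub> P s b" by simp
    qed
    show "P s u = (if s = t then u else \<zero>)" if u: "u \<in> basis_component I e d t" for s t u
    proof -
      obtain c where c: "c \<in> I \<rightarrow> carrier K" "\<forall>i\<in>I. d i \<noteq> t \<longrightarrow> c i = \<zero>\<^bsub>K\<^esub>"
        "u = (\<Oplus>i\<in>I. c i \<odot> e i)" using u by (auto simp: basis_component_def)
      have "P s u = (\<Oplus>i\<in>I. (if d i = s then c i else \<zero>\<^bsub>K\<^esub>) \<odot> e i)"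
        unfolding P_def using co_unique[OF c(1,3)] c(1) eA
        by (intro A.finsum_cong) (auto simp: simp_implies_def Pi_iff)
      also have "\<dots> = (\<Oplus>i\<in>I. if s = t then c i \<odot> e i else \<zero>)"
        using c(1,2) eA by (intro A.finsum_cong) (auto simp: simp_implies_def Pi_iff)
      finally show ?thesis using c(3) by simp
    qed
    show "carrier A \<subseteq> W" if W: "subgroup W (add_monoid A)" and
      U: "\<And>s. s \<in> carrier G \<Longrightarrow> basis_component I e d s \<subseteq> W" for W
    proof
      fix a assume a: "a \<in> carrier A"
      have "co a i \<odot> e i \<in> W" if i: "i \<in> I" for i
      proof -
        have "co a i \<odot> e i \<in> basis_component I e d (d i)"
          using co(1)[OF a] i basis_in_component[OF fin e i] by (intro submoduleE(4)[OF sub]) auto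
        then show ?thesis using U[of "d i"] d i by auto
      qed
      then have "(\<Oplus>i\<in>I. co a i \<odot> e i) \<in> W"
        by (intro A.subgroup_finsum_closed[OF W fin]) auto
      then show "a \<in> W" using co(2)[OF a] by simp
    qed
  qed
qed

text \<open>A homogeneous basis determines the grading: the projection onto degree \<open>s\<close> fixes an element
  of \<open>U s\<close> and erases its coordinates of all other degrees.\<close>

lemma homogeneous_basis_component:
  assumes grading: "grading K A G U" and basis: "basis I e" and d: "d \<in> I \<rightarrow> carrier G"
    and homogeneous: "\<And>i. i \<in> I \<Longrightarrow> e i \<in> U (d i)" and s: "s \<in> carrier G"
  shows "U s = basis_component I e d s"
proof -
  from basis have fin: "finite I" and e: "e \<in> I \<rightarrow> carrier A" and span: "spanning I e"
    by (auto simp: basis_def)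
  have eA: "e i \<in> carrier A" if "i \<in> I" for i using e that by auto
  from grading have sub: "\<And>s. s \<in> carrier G \<Longrightarrow> submodule (U s) K A" by (auto simp: grading_def)
  obtain P where P: "homogeneous_projections G U P" using grading_projections[OF grading] ..
  note hom = projection_hom[OF P] and proj = projection_component[OF P]
  have summand: "k \<odot> e i \<in> U (d i)" if "k \<in> carrier K" "i \<in> I" for k i
    using submoduleE(4)[OF sub _ homogeneous] d that by blast
  show ?thesis
  proof (intro equalityI subsetI)
    fix u assume u: "u \<in> U s"
    then have "u \<in> carrier A" using sub[OF s] submodule_subset by blast
    then obtain c where c: "c \<in> I \<rightarrow> carrier K" "u = (\<Oplus>i\<in>I. c i \<odot> e i)"
      using span by (auto simp: spanning_def)
    have "u = P s u" using proj[OF s s u] by simp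
    also have "\<dots> = (\<Oplus>i\<in>I. P s (c i \<odot> e i))"
      unfolding c(2) using c(1) eA fin
      by (intro finsum_additive_map[OF A.is_abelian_group A.is_abelian_group hom[OF s]]) auto
    also have "\<dots> = (\<Oplus>i\<in>I. (if d i = s then c i else \<zero>\<^bsub>K\<^esub>) \<odot> e i)"
    proof (rule A.finsum_cong)
      have "P s (c i \<odot> e i) = (if s = d i then c i \<odot> e i else \<zero>)" if "i \<in> I" for i
        by (rule proj[OF s _ summand]) (use that d c(1) in auto)
      then show "i \<in> I =simp=> P s (c i \<odot> e i) = (if d i = s then c i else \<zero>\<^bsub>K\<^esub>) \<odot> e i" for i
        using eA by (auto simp: simp_implies_def)
    qed (use c(1) eA hom[OF s] in \<open>auto simp: hom_def Pi_iff\<close>)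
    finally show "u \<in> basis_component I e d s"
      using c(1) by (intro basis_componentI[of "\<lambda>i. if d i = s then c i else \<zero>\<^bsub>K\<^esub>"]) auto
  next
    fix u assume "u \<in> basis_component I e d s"
    then obtain c where c: "c \<in> I \<rightarrow> carrier K" "\<forall>i\<in>I. d i \<noteq> s \<longrightarrow> c i = \<zero>\<^bsub>K\<^esub>"
      "u = (\<Oplus>i\<in>I. c i \<odot> e i)" by (auto simp: basis_component_def)
    have "c i \<odot> e i \<in> U s" if i: "i \<in> I" for i
    proof (cases "d i = s")
      case True
      then show ?thesis using summand[of "c i" i] c(1) i by auto
    next
      case False
      then show ?thesis using c(2) i submodule_zero[OF sub[OF s]] eA by auto
    qed
    then show "u \<in> U s"
      unfolding c(3) by (intro A.subgroup_finsum_closed[OF submodule_subgroup[OF sub[OF s]] fin]) auto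
  qed
qed

lemma homogeneous_components_disjoint:
  assumes "grading K A G U" "s \<in> carrier G" "t \<in> carrier G" "u \<in> U s" "u \<in> U t" "u \<noteq> \<zero>"
  shows "s = t"
proof (rule ccontr)
  assume ne: "s \<noteq> t"
  obtain P where P: "homogeneous_projections G U P" using grading_projections[OF assms(1)] ..
  show False
    using projection_component[OF P assms(2,2,4)] projection_component[OF P assms(2,3,5)] ne assms(6)
    by simp
qed

text \<open>The zeroth power is left out: that \<open>\<one>\<close> has trivial degree is shown below, for truncated lines.\<close>

lemma homogeneous_power:
  assumes "grading K A G U" "g \<in> carrier G" "a \<in> U g"
  shows "a [^] Suc n \<in> U (g [^]\<^bsub>G\<^esub> Suc n)"
proof -
  interpret G: group G using assms(1) by (simp add: grading_def)
  have a: "a \<in> carrier A" using assms submodule_subset by (fastforce simp: grading_def)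
  show ?thesis
  proof (induction n)
    case 0
    then show ?case using assms a by simp
  next
    case (Suc n)
    have "a [^] Suc (Suc n) = a [^] Suc n \<otimes> a" by (rule A.nat_pow_Suc)
    moreover have "g [^]\<^bsub>G\<^esub> Suc (Suc n) = g [^]\<^bsub>G\<^esub> Suc n \<otimes>\<^bsub>G\<^esub> g" by (rule G.nat_pow_Suc)
    ultimately show ?case
      using assms Suc G.nat_pow_closed[OF assms(2), of "Suc n"] unfolding grading_def by metis
  qed
qed

end

section \<open>Truncated lines\<close>

text \<open>These are the properties of \<open>K[x]/(x\<^sup>p)\<close> that determine its gradings. The decomposition says
  that \<open>A = K + Ax\<close>, so that \<open>A\<close> is local with maximal ideal \<open>Ax\<close> and residue field \<open>K\<close>; together
  with the conditions on powers of \<open>x\<close> it makes \<open>\<one>, x, \<dots>, x [^] (p - 1)\<close> a basis.\<close>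

locale truncated_line = field_algebra K A
  for K :: "('k, 'm) ring_scheme" and A :: "('k, 'a, 'n) module_scheme" (structure) +
  fixes x :: 'a and p :: nat
  assumes prime: "Factorial_Ring.prime p"
    and char: "[p] \<cdot>\<^bsub>K\<^esub> \<one>\<^bsub>K\<^esub> = \<zero>\<^bsub>K\<^esub>"
    and x_closed [simp]: "x \<in> carrier A"
    and x_nilpotent: "x [^] p = \<zero>"
    and x_power_nonzero: "x [^] (p - 1) \<noteq> \<zero>"
    and decomposition: "\<And>a. a \<in> carrier A \<Longrightarrow> \<exists>k\<in>carrier K. \<exists>b\<in>carrier A. a = k \<odot> \<one> \<oplus> b \<otimes> x"
begin

lemma p_gt_1: "p > 1"
  using prime by (rule prime_gt_1_nat)

lemma powers_index: "{..<p} = {..p - 1}" "Suc (p - 1) = p"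
  using p_gt_1 by auto

text \<open>In characteristic \<open>p\<close> the \<open>p\<close>-th power is additive, and it kills \<open>b \<otimes> x\<close>. For \<open>k \<noteq> \<zero>\<close> the
  computation is reduced to \<open>\<one> \<oplus> u\<close> by taking out the factor \<open>k\<close>.\<close>

lemma power_p:
  assumes k: "k \<in> carrier K" and b: "b \<in> carrier A"
  shows "(k \<odot> \<one> \<oplus> b \<otimes> x) [^] p = (k [^]\<^bsub>K\<^esub> p) \<odot> \<one>"
proof (cases "k = \<zero>\<^bsub>K\<^esub>")
  case True
  then show ?thesis
    using b p_gt_1 by (simp add: A.nat_pow_distrib x_nilpotent K.nat_pow_zero)
next
  case False
  let ?u = "(inv\<^bsub>K\<^esub> k \<odot> b) \<otimes> x"
  have ik: "inv\<^bsub>K\<^esub> k \<in> carrier K" "k \<otimes>\<^bsub>K\<^esub> inv\<^bsub>K\<^esub> k = \<one>\<^bsub>K\<^esub>"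
    using False k by (auto simp: K.field_Units)
  have u: "?u \<in> carrier A" using ik b by simp
  have charA: "[p] \<cdot>\<^bsub>A\<^esub> \<one> = \<zero>" using smult_add_pow[of "\<one>\<^bsub>K\<^esub>" \<one> p] char by simp
  have "?u [^] p = \<zero>" using ik b by (simp add: A.nat_pow_distrib x_nilpotent)
  then have one: "(\<one> \<oplus> ?u) [^] p = \<one>"
    using A.one_plus_power_prime[OF prime charA u] by simp
  have "k \<odot> \<one> \<oplus> b \<otimes> x = k \<odot> (\<one> \<oplus> ?u)"
    using k ik b u smult_assoc1[of k "inv\<^bsub>K\<^esub> k" "b \<otimes> x"] by (simp add: smult_r_distr smult_assoc2)
  then show ?thesis using k u by (simp add: smult_pow one)
qed

lemma ideal_x: "ideal (PIdl x) A"
  by (rule A.cgenideal_ideal) simp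

lemma ideal_subgroup: "ideal W A \<Longrightarrow> subgroup W (add_monoid A)"
  using additive_subgroup.a_subgroup ideal.axioms(1) by blast

text \<open>The scalar \<open>k\<close> is the residue of \<open>a\<close> modulo \<open>x\<close>. If it were zero, \<open>a = b \<otimes> x\<close>
  would lie in the ideal.\<close>

lemma power_p_outside_ideal:
  assumes "a \<in> carrier A" "a \<notin> PIdl x"
  obtains k where "k \<in> carrier K" "k \<noteq> \<zero>\<^bsub>K\<^esub>" "a [^] p = (k [^]\<^bsub>K\<^esub> p) \<odot> \<one>"
proof -
  obtain k b where kb: "k \<in> carrier K" "b \<in> carrier A" "a = k \<odot> \<one> \<oplus> b \<otimes> x"
    using decomposition[OF assms(1)] by blast
  have "k \<noteq> \<zero>\<^bsub>K\<^esub>"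
  proof
    assume "k = \<zero>\<^bsub>K\<^esub>"
    then have "a = b \<otimes> x" using kb by simp
    then show False using assms(2) kb(2) unfolding cgenideal_def by blast
  qed
  then show thesis using that[OF kb(1)] power_p[OF kb(1,2)] kb(3) by simp
qed

lemma one_not_in_ideal: "\<one> \<notin> PIdl x"
proof
  assume "\<one> \<in> PIdl x"
  then obtain b where b: "b \<in> carrier A" "\<one> = b \<otimes> x" by (auto simp: cgenideal_def)
  have "\<one> [^] p = b [^] p \<otimes> x [^] p" unfolding b(2) using b(1) by (simp add: A.nat_pow_distrib)
  then show False using one_not_zero b(1) by (simp add: x_nilpotent)
qed

text \<open>The remainder \<open>b\<close> can be decomposed again.\<close>

lemma x_spanning:
  fixes n :: nat
  assumes "a \<in> carrier A"
  shows "\<exists>c\<in>{..<n} \<rightarrow> carrier K. \<exists>b\<in>carrier A. a = (\<Oplus>i\<in>{..<n}. c i \<odot> x [^] i) \<oplus> b \<otimes> x [^] n"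
proof (induction n)
  case 0
  show ?case using assms by (intro bexI[of _ "\<lambda>_. \<zero>\<^bsub>K\<^esub>"] bexI[of _ a]) auto
next
  case (Suc n)
  then obtain c b where cb: "c \<in> {..<n} \<rightarrow> carrier K" "b \<in> carrier A"
    "a = (\<Oplus>i\<in>{..<n}. c i \<odot> x [^] i) \<oplus> b \<otimes> x [^] n" by blast
  obtain k b' where kb: "k \<in> carrier K" "b' \<in> carrier A" "b = k \<odot> \<one> \<oplus> b' \<otimes> x"
    using decomposition[OF cb(2)] by blast
  let ?c = "c(n := k)"
  have S: "(\<Oplus>i\<in>{..<n}. c i \<odot> x [^] i) \<in> carrier A" using cb(1) by (intro lincomb_closed) auto
  have "(\<Oplus>i\<in>{..<Suc n}. ?c i \<odot> x [^] i) = k \<odot> x [^] n \<oplus> (\<Oplus>i\<in>{..<n}. ?c i \<odot> x [^] i)"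
    unfolding lessThan_Suc using cb(1) kb(1) by (subst A.finsum_insert) (auto simp: Pi_iff)
  also have "(\<Oplus>i\<in>{..<n}. ?c i \<odot> x [^] i) = (\<Oplus>i\<in>{..<n}. c i \<odot> x [^] i)"
    using cb(1) by (intro A.finsum_cong) (auto simp: simp_implies_def Pi_iff)
  finally have "(\<Oplus>i\<in>{..<Suc n}. ?c i \<odot> x [^] i) \<oplus> b' \<otimes> x [^] Suc n
      = k \<odot> x [^] n \<oplus> (\<Oplus>i\<in>{..<n}. c i \<odot> x [^] i) \<oplus> b' \<otimes> (x \<otimes> x [^] n)"
    by (simp add: A.m_comm)
  also have "\<dots> = (\<Oplus>i\<in>{..<n}. c i \<odot> x [^] i) \<oplus> (k \<odot> x [^] n \<oplus> (b' \<otimes> x) \<otimes> x [^] n)"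
    using S kb by (simp add: A.a_ac A.m_assoc)
  also have "k \<odot> x [^] n \<oplus> (b' \<otimes> x) \<otimes> x [^] n = b \<otimes> x [^] n"
    unfolding kb(3) using kb(1,2) by (simp add: A.l_distr smult_assoc2)
  finally show ?case
    unfolding cb(3) using cb(1) kb by (intro bexI[of _ ?c] bexI[of _ b']) (auto simp: Pi_iff)
qed

lemma basis_x: "basis {..<p} (\<lambda>i. x [^] i)"
proof -
  have "spanning {..<p} (\<lambda>i. x [^] i)"
    unfolding spanning_def
  proof
    fix a assume "a \<in> carrier A"
    from x_spanning[OF this, of p] obtain c b where cb: "c \<in> {..<p} \<rightarrow> carrier K" "b \<in> carrier A"
      "a = (\<Oplus>i\<in>{..<p}. c i \<odot> x [^] i) \<oplus> b \<otimes> \<zero>" unfolding x_nilpotent by blast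
    moreover have "(\<Oplus>i\<in>{..<p}. c i \<odot> x [^] i) \<in> carrier A" using cb(1) by (intro lincomb_closed) auto
    ultimately show "\<exists>c\<in>{..<p} \<rightarrow> carrier K. a = (\<Oplus>i\<in>{..<p}. c i \<odot> x [^] i)" by auto
  qed
  moreover have "lin_independent {..<p} (\<lambda>i. x [^] i)"
    using powers_independent[of x "p - 1"] x_nilpotent x_power_nonzero unfolding powers_index by simp
  ultimately show ?thesis by (simp add: basis_def)
qed

lemma nilpotent_basis:
  assumes "y \<in> carrier A" "y [^] p = \<zero>" "y [^] (p - 1) \<noteq> \<zero>"
  shows "basis {..<p} (\<lambda>i. y [^] i)"
proof (rule independent_imp_basis[OF basis_x])
  show "lin_independent {..<p} (\<lambda>i. y [^] i)"
    using powers_independent[of y "p - 1"] assms unfolding powers_index by simp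
qed (use assms in auto)

text \<open>Multiplying \<open>(a \<otimes> x) [^] (p - 1)\<close> by \<open>a\<close> gives \<open>a [^] p \<otimes> x [^] (p - 1)\<close>, and \<open>a [^] p\<close>
  is a nonzero scalar.\<close>

lemma unit_multiple_nilpotent:
  assumes "a \<in> carrier A" "a \<notin> PIdl x"
  shows "(a \<otimes> x) [^] p = \<zero>" "(a \<otimes> x) [^] (p - 1) \<noteq> \<zero>"
proof -
  show "(a \<otimes> x) [^] p = \<zero>" using assms(1) by (simp add: A.nat_pow_distrib x_nilpotent)
  obtain k where k: "k \<in> carrier K" "k \<noteq> \<zero>\<^bsub>K\<^esub>" "a [^] p = (k [^]\<^bsub>K\<^esub> p) \<odot> \<one>"
    using power_p_outside_ideal[OF assms] .
  have kp: "k [^]\<^bsub>K\<^esub> p \<noteq> \<zero>\<^bsub>K\<^esub>" using k by (simp add: scalar_pow_nonzero)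
  have "a \<otimes> (a \<otimes> x) [^] (p - 1) = a [^] p \<otimes> x [^] (p - 1)"
    using assms(1) A.nat_pow_Suc2[of a "p - 1"] powers_index(2)
    by (simp add: A.nat_pow_distrib A.m_assoc)
  also have "\<dots> = (k [^]\<^bsub>K\<^esub> p) \<odot> x [^] (p - 1)" using k by (simp add: smult_assoc2)
  also have "\<dots> \<noteq> \<zero>" using smult_eq_zero_iff k kp x_power_nonzero by simp
  finally show "(a \<otimes> x) [^] (p - 1) \<noteq> \<zero>" using assms(1) by auto
qed

text \<open>From \<open>x = (a \<otimes> x) \<otimes> x\<close> it would follow that \<open>x = (a \<otimes> x) [^] n \<otimes> x\<close> for all \<open>n\<close>, but
  \<open>a \<otimes> x\<close> is nilpotent.\<close>

lemma x_not_in_square: "x \<notin> PIdl (x \<otimes> x)"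
proof
  assume "x \<in> PIdl (x \<otimes> x)"
  then obtain a where a: "a \<in> carrier A" "x = a \<otimes> (x \<otimes> x)" by (auto simp: cgenideal_def)
  have "x = (a \<otimes> x) [^] n \<otimes> x" for n :: nat
  proof (induction n)
    case (Suc n)
    have "(a \<otimes> x) [^] Suc n \<otimes> x = (a \<otimes> x) [^] n \<otimes> (a \<otimes> (x \<otimes> x))"
      using a(1) by (simp add: A.m_assoc)
    then show ?case using Suc a(2) by simp
  qed simp
  from this[of p] have "x = \<zero>" using a(1) by (simp add: A.nat_pow_distrib x_nilpotent)
  then show False using x_power_nonzero p_gt_1 by (simp add: A.nat_pow_zero)
qed

end

section \<open>Homogeneous elements of a graded truncated line\<close>

context truncated_line
begin

context
  fixes G :: "('g, 'o) monoid_scheme" and U :: "'g \<Rightarrow> 'a set"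
  assumes grading: "grading K A G U"
begin

interpretation G: group G using grading by (simp add: grading_def)

lemma component_submodule: "s \<in> carrier G \<Longrightarrow> submodule (U s) K A"
  using grading by (simp add: grading_def)

lemma component_closed: "s \<in> carrier G \<Longrightarrow> a \<in> U s \<Longrightarrow> a \<in> carrier A"
  using component_submodule submodule_subset by blast

text \<open>The nonzero scalar \<open>a [^] p\<close> has degree \<open>h = g [^] p\<close>, so \<open>\<one>\<close> has degree \<open>h\<close>. Then
  \<open>\<one> = \<one> \<otimes> \<one>\<close> has degree \<open>h \<otimes> h\<close> too, which forces \<open>h\<close> to be the unit of the group.\<close>

lemma invertible_component:
  assumes g: "g \<in> carrier G" and a: "a \<in> U g" "a \<notin> PIdl x"
  shows "\<one>\<^bsub>A\<^esub> \<in> U \<one>\<^bsub>G\<^esub>" and "g [^]\<^bsub>G\<^esub> p = \<one>\<^bsub>G\<^esub>"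
proof -
  have aA: "a \<in> carrier A" using component_closed g a by blast
  obtain k where k: "k \<in> carrier K" "k \<noteq> \<zero>\<^bsub>K\<^esub>" "a [^]\<^bsub>A\<^esub> p = (k [^]\<^bsub>K\<^esub> p) \<odot>\<^bsub>A\<^esub> \<one>\<^bsub>A\<^esub>"
    using power_p_outside_ideal[OF aA a(2)] .
  have kp: "k [^]\<^bsub>K\<^esub> p \<in> carrier K" "k [^]\<^bsub>K\<^esub> p \<noteq> \<zero>\<^bsub>K\<^esub>" using k by (auto simp: scalar_pow_nonzero)
  let ?h = "g [^]\<^bsub>G\<^esub> p"
  have h: "?h \<in> carrier G" using g by simp
  have ap: "a [^]\<^bsub>A\<^esub> p \<in> U ?h" using homogeneous_power[OF grading g a(1), of "p - 1"] powers_index by simp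
  have "inv\<^bsub>K\<^esub> (k [^]\<^bsub>K\<^esub> p) \<in> carrier K" using kp by (simp add: K.field_Units)
  from submoduleE(4)[OF component_submodule[OF h] this ap]
  have "inv\<^bsub>K\<^esub> (k [^]\<^bsub>K\<^esub> p) \<odot>\<^bsub>A\<^esub> ((k [^]\<^bsub>K\<^esub> p) \<odot>\<^bsub>A\<^esub> \<one>\<^bsub>A\<^esub>) \<in> U ?h"
    unfolding k(3) .
  then have one: "\<one>\<^bsub>A\<^esub> \<in> U ?h" using smult_cancel[OF kp, of "\<one>\<^bsub>A\<^esub>"] by simp
  then have "\<one>\<^bsub>A\<^esub> \<otimes>\<^bsub>A\<^esub> \<one>\<^bsub>A\<^esub> \<in> U (?h \<otimes>\<^bsub>G\<^esub> ?h)" using grading h unfolding grading_def by blast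
  then have sq: "\<one>\<^bsub>A\<^esub> \<in> U (?h \<otimes>\<^bsub>G\<^esub> ?h)" by simp
  have "?h \<otimes>\<^bsub>G\<^esub> ?h = ?h"
    by (rule homogeneous_components_disjoint[OF grading _ h sq one one_not_zero]) (use h in simp)
  then show "?h = \<one>\<^bsub>G\<^esub>" using h by simp
  then show "\<one>\<^bsub>A\<^esub> \<in> U \<one>\<^bsub>G\<^esub>" using one by simp
qed

text \<open>Otherwise \<open>a\<close>, being the sum of its components, would lie in \<open>W\<close>.\<close>

lemma component_outside_subgroup:
  assumes "subgroup W (add_monoid A)" "a \<in> carrier A" "a \<notin> W" "homogeneous_projections G U P"
  obtains s where "s \<in> carrier G" "P s a \<notin> W"
proof -
  let ?T = "{s \<in> carrier G. P s a \<noteq> \<zero>\<^bsub>A\<^esub>}"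
  have "\<not> (\<lambda>s. P s a) \<in> ?T \<rightarrow> W"
    using A.subgroup_finsum_closed[OF assms(1) projection_finite[OF assms(4,2)], of "\<lambda>s. P s a"]
      projection_sum[OF assms(4,2)] assms(3) by auto
  then show thesis using that by blast
qed

text \<open>Some component of \<open>\<one>\<close> lies outside the proper ideal generated by \<open>x\<close>.\<close>

lemma one_homogeneous: "\<one>\<^bsub>A\<^esub> \<in> U \<one>\<^bsub>G\<^esub>"
proof -
  obtain P where P: "homogeneous_projections G U P" using grading_projections[OF grading] ..
  obtain s where s: "s \<in> carrier G" "P s \<one>\<^bsub>A\<^esub> \<notin> PIdl\<^bsub>A\<^esub> x"
    using component_outside_subgroup[OF ideal_subgroup[OF ideal_x] A.one_closed one_not_in_ideal P] .
  show ?thesis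
    by (rule invertible_component(1)[OF s(1) projection_mem[OF P s(1) A.one_closed] s(2)])
qed

lemma powers_homogeneous:
  fixes i :: nat
  assumes "g \<in> carrier G" "a \<in> U g"
  shows "a [^]\<^bsub>A\<^esub> i \<in> U (g [^]\<^bsub>G\<^esub> i)"
  using homogeneous_power[OF grading assms, of "i - 1"] one_homogeneous by (cases i) simp_all

text \<open>All components of \<open>x\<close> lie in the ideal generated by \<open>x\<close>: those of nontrivial degree by
  assumption, and the remaining one because it is the difference of \<open>x\<close> and the others. As \<open>x\<close> is not
  a multiple of \<open>x \<otimes> x\<close>, one of its components is \<open>a \<otimes> x\<close> with \<open>a\<close> outside that ideal.\<close>

lemma homogeneous_nilpotent_generator:
  assumes radical: "\<And>s. s \<in> carrier G \<Longrightarrow> s \<noteq> \<one>\<^bsub>G\<^esub> \<Longrightarrow> U s \<subseteq> PIdl\<^bsub>A\<^esub> x"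
  obtains g y where "g \<in> carrier G" "y \<in> U g" "y [^]\<^bsub>A\<^esub> p = \<zero>\<^bsub>A\<^esub>" "y [^]\<^bsub>A\<^esub> (p - 1) \<noteq> \<zero>\<^bsub>A\<^esub>"
proof -
  let ?M = "PIdl\<^bsub>A\<^esub> x"
  obtain P where P: "homogeneous_projections G U P" using grading_projections[OF grading] ..
  have PU: "P s x \<in> U s" if "s \<in> carrier G" for s using projection_mem[OF P that x_closed] .
  have PA: "P s x \<in> carrier A" if "s \<in> carrier G" for s using PU component_closed that by blast
  note M = ideal_subgroup[OF ideal_x]
  have MA: "?M \<subseteq> carrier A" using subgroup.subset[OF M] by simp
  have PM: "P s x \<in> ?M" if s: "s \<in> carrier G" for s
  proof (cases "s = \<one>\<^bsub>G\<^esub>")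
    case False
    then show ?thesis using PU radical s by blast
  next
    case True
    let ?N = "{s \<in> carrier G. P s x \<noteq> \<zero>\<^bsub>A\<^esub>} - {\<one>\<^bsub>G\<^esub>}"
    let ?r = "\<Oplus>\<^bsub>A\<^esub>s\<in>?N. P s x"
    note fin = projection_finite[OF P x_closed]
    have r: "?r \<in> ?M"
      using fin PU radical by (intro A.subgroup_finsum_closed[OF M]) auto
    have "x = (\<Oplus>\<^bsub>A\<^esub>s\<in>{s \<in> carrier G. P s x \<noteq> \<zero>\<^bsub>A\<^esub>}. P s x)"
      by (rule projection_sum[OF P x_closed, symmetric])
    also have "\<dots> = (\<Oplus>\<^bsub>A\<^esub>s\<in>insert \<one>\<^bsub>G\<^esub> ?N. P s x)"
      using fin PA by (intro A.add.finprod_mono_neutral_cong_left) auto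
    also have "\<dots> = P \<one>\<^bsub>G\<^esub> x \<oplus>\<^bsub>A\<^esub> ?r"
      using fin PA by (intro A.finsum_insert) auto
    finally have P1: "P \<one>\<^bsub>G\<^esub> x = x \<oplus>\<^bsub>A\<^esub> \<ominus>\<^bsub>A\<^esub> ?r"
      using r MA PA[of "\<one>\<^bsub>G\<^esub>"] by (metis A.add.inv_solve_right G.one_closed subsetD x_closed)
    have "x \<in> ?M" using A.cgenideal_self[OF x_closed] .
    moreover have "\<ominus>\<^bsub>A\<^esub> ?r \<in> ?M"
      using subgroup.m_inv_closed[OF M r] by (simp only: a_inv_def)
    ultimately have "x \<oplus>\<^bsub>A\<^esub> \<ominus>\<^bsub>A\<^esub> ?r \<in> ?M" using subgroup.m_closed[OF M] by simp
    then show ?thesis unfolding True P1 .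
  qed
  have "ideal (PIdl\<^bsub>A\<^esub> (x \<otimes>\<^bsub>A\<^esub> x)) A" by (rule A.cgenideal_ideal) simp
  from component_outside_subgroup[OF ideal_subgroup[OF this] x_closed x_not_in_square P]
  obtain s where s: "s \<in> carrier G" "P s x \<notin> PIdl\<^bsub>A\<^esub> (x \<otimes>\<^bsub>A\<^esub> x)" .
  obtain a where a: "a \<in> carrier A" "P s x = a \<otimes>\<^bsub>A\<^esub> x" using PM[OF s(1)] by (auto simp: cgenideal_def)
  have "a \<notin> ?M" using s(2) a(2) by (auto simp: cgenideal_def A.m_assoc)
  with unit_multiple_nilpotent[OF a(1)] show thesis using that[OF s(1) PU[OF s(1)]] a(2) by simp
qed

text \<open>The degree \<open>g\<close> has order \<open>p\<close>, so the first \<open>p\<close> powers of \<open>a\<close> are nonzero elements of different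
  degrees. Hence they are independent, and they form a basis because \<open>p\<close> is the dimension.
  Dividing \<open>a\<close> by its residue modulo \<open>x\<close> makes the \<open>p\<close>-th power \<open>\<one>\<close>.\<close>

lemma homogeneous_group_element:
  assumes g: "g \<in> carrier G" "g \<noteq> \<one>\<^bsub>G\<^esub>" and a: "a \<in> U g" "a \<notin> PIdl\<^bsub>A\<^esub> x"
  obtains b where "b \<in> U g" "b [^]\<^bsub>A\<^esub> p = \<one>\<^bsub>A\<^esub>" "basis {..<p} (\<lambda>i. b [^]\<^bsub>A\<^esub> i)" "G.ord g = p"
proof -
  have aA: "a \<in> carrier A" using component_closed g a by blast
  obtain k where k: "k \<in> carrier K" "k \<noteq> \<zero>\<^bsub>K\<^esub>" "a [^]\<^bsub>A\<^esub> p = (k [^]\<^bsub>K\<^esub> p) \<odot>\<^bsub>A\<^esub> \<one>\<^bsub>A\<^esub>"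
    using power_p_outside_ideal[OF aA a(2)] .
  have ik: "inv\<^bsub>K\<^esub> k \<in> carrier K" "inv\<^bsub>K\<^esub> k \<otimes>\<^bsub>K\<^esub> k = \<one>\<^bsub>K\<^esub>" using k by (auto simp: K.field_Units)
  define b where "b = inv\<^bsub>K\<^esub> k \<odot>\<^bsub>A\<^esub> a"
  have b: "b \<in> U g" unfolding b_def using submoduleE(4)[OF component_submodule[OF g(1)] ik(1) a(1)] .
  have bA: "b \<in> carrier A" using component_closed g(1) b by blast
  have "b [^]\<^bsub>A\<^esub> p = ((inv\<^bsub>K\<^esub> k) [^]\<^bsub>K\<^esub> p \<otimes>\<^bsub>K\<^esub> k [^]\<^bsub>K\<^esub> p) \<odot>\<^bsub>A\<^esub> \<one>\<^bsub>A\<^esub>"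
    unfolding b_def using ik k aA by (simp add: smult_pow smult_assoc1)
  also have "(inv\<^bsub>K\<^esub> k) [^]\<^bsub>K\<^esub> p \<otimes>\<^bsub>K\<^esub> k [^]\<^bsub>K\<^esub> p = \<one>\<^bsub>K\<^esub>"
    using ik k by (simp add: K.nat_pow_distrib[symmetric])
  finally have bp: "b [^]\<^bsub>A\<^esub> p = \<one>\<^bsub>A\<^esub>" by simp
  have bi: "b [^]\<^bsub>A\<^esub> i \<noteq> \<zero>\<^bsub>A\<^esub>" if "i < p" for i :: nat
  proof
    assume "b [^]\<^bsub>A\<^esub> i = \<zero>\<^bsub>A\<^esub>"
    then have "b [^]\<^bsub>A\<^esub> (i + (p - i)) = \<zero>\<^bsub>A\<^esub>" using bA by (simp add: A.nat_pow_mult[symmetric])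
    then show False using that bp one_not_zero by simp
  qed
  have ord: "G.ord g = p"
    using invertible_component(2)[OF g(1) a] G.pow_eq_id[OF g(1)] G.ord_eq_1[OF g(1)] g(2) prime
      prime_nat_iff by auto
  have inj: "inj_on (\<lambda>i::nat. g [^]\<^bsub>G\<^esub> i) {..<p}"
    using G.ord_inj[OF g(1)] ord p_gt_1 powers_index by (simp add: atLeast0AtMost)
  obtain P where P: "homogeneous_projections G U P" using grading_projections[OF grading] ..
  note homP = projection_hom[OF P]
  have "lin_independent {..<p} (\<lambda>i. b [^]\<^bsub>A\<^esub> i)"
    unfolding lin_independent_def
  proof (intro ballI impI)
    fix c j assume c: "c \<in> {..<p} \<rightarrow> carrier K" and sum: "(\<Oplus>\<^bsub>A\<^esub>i\<in>{..<p}. c i \<odot>\<^bsub>A\<^esub> b [^]\<^bsub>A\<^esub> i) = \<zero>\<^bsub>A\<^esub>"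
      and j: "j \<in> {..<p}"
    let ?s = "g [^]\<^bsub>G\<^esub> j"
    have s: "?s \<in> carrier G" using g by simp
    have summand: "P ?s (c i \<odot>\<^bsub>A\<^esub> b [^]\<^bsub>A\<^esub> i) = (if j = i then c i \<odot>\<^bsub>A\<^esub> b [^]\<^bsub>A\<^esub> i else \<zero>\<^bsub>A\<^esub>)"
      if i: "i \<in> {..<p}" for i
    proof -
      have "c i \<odot>\<^bsub>A\<^esub> b [^]\<^bsub>A\<^esub> i \<in> U (g [^]\<^bsub>G\<^esub> i)"
        using powers_homogeneous[OF g(1) b] c i g(1)
        by (intro submoduleE(4)[OF component_submodule]) auto
      from projection_component[OF P s _ this] g(1) have "P ?s (c i \<odot>\<^bsub>A\<^esub> b [^]\<^bsub>A\<^esub> i) =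
          (if ?s = g [^]\<^bsub>G\<^esub> i then c i \<odot>\<^bsub>A\<^esub> b [^]\<^bsub>A\<^esub> i else \<zero>\<^bsub>A\<^esub>)"
        by simp
      moreover have "?s = g [^]\<^bsub>G\<^esub> i \<longleftrightarrow> j = i" using inj i j by (auto simp: inj_on_def)
      ultimately show ?thesis by simp
    qed
    have "P ?s \<zero>\<^bsub>A\<^esub> = \<zero>\<^bsub>A\<^esub>"
      using finsum_additive_map[OF A.is_abelian_group A.is_abelian_group homP[OF s], of "{}" undefined] by simp
    then have "\<zero>\<^bsub>A\<^esub> = P ?s (\<Oplus>\<^bsub>A\<^esub>i\<in>{..<p}. c i \<odot>\<^bsub>A\<^esub> b [^]\<^bsub>A\<^esub> i)" unfolding sum by simp
    also have "\<dots> = (\<Oplus>\<^bsub>A\<^esub>i\<in>{..<p}. P ?s (c i \<odot>\<^bsub>A\<^esub> b [^]\<^bsub>A\<^esub> i))"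
      using c bA by (intro finsum_additive_map[OF A.is_abelian_group A.is_abelian_group homP[OF s]]) auto
    also have "\<dots> = (\<Oplus>\<^bsub>A\<^esub>i\<in>{..<p}. if j = i then c i \<odot>\<^bsub>A\<^esub> b [^]\<^bsub>A\<^esub> i else \<zero>\<^bsub>A\<^esub>)"
      using c bA summand by (intro A.finsum_cong) (auto simp: simp_implies_def Pi_iff)
    also have "\<dots> = c j \<odot>\<^bsub>A\<^esub> b [^]\<^bsub>A\<^esub> j"
      using c bA j by (intro A.finsum_singleton) auto
    finally have "c j \<odot>\<^bsub>A\<^esub> b [^]\<^bsub>A\<^esub> j = \<zero>\<^bsub>A\<^esub>" by (rule sym)
    then show "c j = \<zero>\<^bsub>K\<^esub>"
      using smult_eq_zero_iff[of "c j" "b [^]\<^bsub>A\<^esub> j"] c j bA bi by auto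
  qed
  then have "basis {..<p} (\<lambda>i. b [^]\<^bsub>A\<^esub> i)"
    using bA by (intro independent_imp_basis[OF basis_x]) auto
  then show thesis using that b bp ord by blast
qed

text \<open>The component of degree \<open>s\<close> is spanned by those basis vectors \<open>y [^] i\<close> with \<open>g [^] i = s\<close>, so
  only powers of \<open>g\<close> are in the support.\<close>

lemma connected_cyclic:
  assumes conn: "generate G (grading_support A G U) = carrier G"
    and g: "g \<in> carrier G" and y: "y \<in> U g" and basis: "basis {..<p} (\<lambda>i. y [^]\<^bsub>A\<^esub> i)"
  shows "carrier G = generate G {g}"
proof -
  have "grading_support A G U \<subseteq> generate G {g}"
  proof
    fix s assume "s \<in> grading_support A G U"
    then have s: "s \<in> carrier G" "U s \<noteq> {\<zero>\<^bsub>A\<^esub>}" by (auto simp: grading_support_def)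
    let ?B = "basis_component {..<p} (\<lambda>i. y [^]\<^bsub>A\<^esub> i) (\<lambda>i::nat. g [^]\<^bsub>G\<^esub> i) s"
    have "U s = ?B"
      using powers_homogeneous[OF g y] g s(1)
      by (intro homogeneous_basis_component[OF grading basis]) auto
    moreover have "\<zero>\<^bsub>A\<^esub> \<in> U s" using submodule_zero[OF component_submodule[OF s(1)]] .
    ultimately have nz: "\<not> ?B \<subseteq> {\<zero>\<^bsub>A\<^esub>}" using s(2) by blast
    have "(\<lambda>i. y [^]\<^bsub>A\<^esub> i) \<in> {..<p} \<rightarrow> carrier A" using basis by (simp add: basis_def)
    from basis_component_empty[OF this, of s "\<lambda>i. g [^]\<^bsub>G\<^esub> i"] nz
    have "s \<in> (\<lambda>i::nat. g [^]\<^bsub>G\<^esub> i) ` {..<p}" by argo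
    then obtain i :: nat where "s = g [^]\<^bsub>G\<^esub> i" by auto
    then have "s = g [^]\<^bsub>G\<^esub> int i" by (simp add: int_pow_int)
    then show "s \<in> generate G {g}" using G.generate_pow[OF g] by blast
  qed
  then have "carrier G \<subseteq> generate G {g}"
    using G.generate_subgroup_incl[OF _ G.generate_is_subgroup[of "{g}"], of "grading_support A G U"] g
    by (simp add: conn)
  then show ?thesis using G.generate_incl[of "{g}"] g by auto
qed

end
end

section \<open>Group algebras and multiplicative bases\<close>

context field_algebra
begin

text \<open>These are the images of the group elements under the isomorphisms from the group algebra
  to \<open>A\<close>.\<close>

definition multiplicative_basis :: "('g, 'o) monoid_scheme \<Rightarrow> ('g \<Rightarrow> 'a) \<Rightarrow> bool"
  where "multiplicative_basis G e \<longleftrightarrow> basis (carrier G) e \<and> e \<one>\<^bsub>G\<^esub> = \<one> \<and>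
    (\<forall>g\<in>carrier G. \<forall>h\<in>carrier G. e (g \<otimes>\<^bsub>G\<^esub> h) = e g \<otimes> e h)"

lemma group_algebra_carrier:
  "finite (carrier G) \<Longrightarrow> carrier (group_algebra K G) = (carrier G \<rightarrow>\<^sub>E carrier K)"
  by (auto simp: group_algebra_def)

lemma group_algebra_mult:
  assumes G: "group G" "finite (carrier G)"
    and u: "u \<in> carrier (group_algebra K G)" and v: "v \<in> carrier (group_algebra K G)"
    and g: "g \<in> carrier G"
  shows "(u \<otimes>\<^bsub>group_algebra K G\<^esub> v) g =
    (\<Oplus>\<^bsub>K\<^esub>a\<in>carrier G. u a \<otimes>\<^bsub>K\<^esub> v (inv\<^bsub>G\<^esub> a \<otimes>\<^bsub>G\<^esub> g))"
proof -
  interpret G: group G by fact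
  have uv: "u a \<in> carrier K" "v a \<in> carrier K" if "a \<in> carrier G" for a
    using u v that unfolding group_algebra_carrier[OF G(2)] by auto
  have "(u \<otimes>\<^bsub>group_algebra K G\<^esub> v) g =
      (\<Oplus>\<^bsub>K\<^esub>a\<in>{a \<in> carrier G. u a \<noteq> \<zero>\<^bsub>K\<^esub>}. u a \<otimes>\<^bsub>K\<^esub> v (inv\<^bsub>G\<^esub> a \<otimes>\<^bsub>G\<^esub> g))"
    using g by (simp add: group_algebra_def)
  also have "\<dots> = (\<Oplus>\<^bsub>K\<^esub>a\<in>carrier G. u a \<otimes>\<^bsub>K\<^esub> v (inv\<^bsub>G\<^esub> a \<otimes>\<^bsub>G\<^esub> g))"
    using uv g G(2) by (intro K.add.finprod_mono_neutral_cong_left) auto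
  finally show ?thesis .
qed

lemma group_algebra_add:
  "g \<in> carrier G \<Longrightarrow> (u \<oplus>\<^bsub>group_algebra K G\<^esub> v) g = u g \<oplus>\<^bsub>K\<^esub> v g"
  by (simp add: group_algebra_def)

lemma group_algebra_smult:
  "g \<in> carrier G \<Longrightarrow> (k \<odot>\<^bsub>group_algebra K G\<^esub> u) g = k \<otimes>\<^bsub>K\<^esub> u g"
  by (simp add: group_algebra_def)

lemma group_element_closed:
  "finite (carrier G) \<Longrightarrow> group_element K G g \<in> carrier (group_algebra K G)"
  by (auto simp: group_algebra_carrier group_element_def)

lemma group_algebra_map_group_element:
  assumes "finite (carrier G)" "e \<in> carrier G \<rightarrow> carrier A" "g \<in> carrier G"
  shows "(\<Oplus>h\<in>carrier G. group_element K G g h \<odot> e h) = e g"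
proof -
  have "(\<Oplus>h\<in>carrier G. group_element K G g h \<odot> e h) =
      (\<Oplus>h\<in>carrier G. (if g = h then \<one>\<^bsub>K\<^esub> else \<zero>\<^bsub>K\<^esub>) \<odot> e h)"
    using assms by (intro A.finsum_cong) (auto simp: group_element_def simp_implies_def Pi_iff)
  also have "\<dots> = \<one>\<^bsub>K\<^esub> \<odot> e g" by (rule lincomb_delta) (use assms in auto)
  finally show ?thesis using assms(2,3) by (simp add: Pi_iff)
qed

text \<open>In the convolution sum, the substitution \<open>g = a b\<close> produces the terms
  \<open>(u a \<odot> e a) \<otimes> (v b \<odot> e b)\<close>.\<close>

lemma multiplicative_basis_map_mult:
  assumes G: "group G" "finite (carrier G)" and e: "e \<in> carrier G \<rightarrow> carrier A"
    and mult: "\<And>g h. g \<in> carrier G \<Longrightarrow> h \<in> carrier G \<Longrightarrow> e (g \<otimes>\<^bsub>G\<^esub> h) = e g \<otimes> e h"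
    and u: "u \<in> carrier (group_algebra K G)" and v: "v \<in> carrier (group_algebra K G)"
  shows "(\<Oplus>g\<in>carrier G. (u \<otimes>\<^bsub>group_algebra K G\<^esub> v) g \<odot> e g) =
    (\<Oplus>g\<in>carrier G. u g \<odot> e g) \<otimes> (\<Oplus>g\<in>carrier G. v g \<odot> e g)"
proof -
  interpret G: group G by fact
  have uv: "u a \<in> carrier K" "v a \<in> carrier K" if "a \<in> carrier G" for a
    using u v that unfolding group_algebra_carrier[OF G(2)] by auto
  have eA: "e g \<in> carrier A" if "g \<in> carrier G" for g using e that by auto
  have "(\<Oplus>g\<in>carrier G. (u \<otimes>\<^bsub>group_algebra K G\<^esub> v) g \<odot> e g) =
      (\<Oplus>g\<in>carrier G. \<Oplus>a\<in>carrier G. (u a \<otimes>\<^bsub>K\<^esub> v (inv\<^bsub>G\<^esub> a \<otimes>\<^bsub>G\<^esub> g)) \<odot> e g)"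
  proof (rule A.finsum_cong'[OF refl])
    show "(\<lambda>g. \<Oplus>a\<in>carrier G. (u a \<otimes>\<^bsub>K\<^esub> v (inv\<^bsub>G\<^esub> a \<otimes>\<^bsub>G\<^esub> g)) \<odot> e g) \<in> carrier G \<rightarrow> carrier A"
      using uv eA by (intro Pi_I A.finsum_closed) auto
    fix g assume g: "g \<in> carrier G"
    show "(u \<otimes>\<^bsub>group_algebra K G\<^esub> v) g \<odot> e g =
        (\<Oplus>a\<in>carrier G. (u a \<otimes>\<^bsub>K\<^esub> v (inv\<^bsub>G\<^esub> a \<otimes>\<^bsub>G\<^esub> g)) \<odot> e g)"
      unfolding group_algebra_mult[OF G u v g]
      by (rule finsum_additive_map[where h = "\<lambda>k. k \<odot> e g", OF K.is_abelian_group A.is_abelian_group])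
        (use g eA uv G(2) in \<open>auto simp: hom_def smult_l_distr\<close>)
  qed
  also have "\<dots> = (\<Oplus>a\<in>carrier G. \<Oplus>g\<in>carrier G. (u a \<otimes>\<^bsub>K\<^esub> v (inv\<^bsub>G\<^esub> a \<otimes>\<^bsub>G\<^esub> g)) \<odot> e g)"
    using uv eA G(2) by (intro A.finsum_swap) auto
  also have "\<dots> = (\<Oplus>a\<in>carrier G. (u a \<odot> e a) \<otimes> (\<Oplus>g\<in>carrier G. v g \<odot> e g))"
  proof (rule A.finsum_cong'[OF refl])
    show "(\<lambda>a. (u a \<odot> e a) \<otimes> (\<Oplus>g\<in>carrier G. v g \<odot> e g)) \<in> carrier G \<rightarrow> carrier A"
      using uv eA by (intro Pi_I A.m_closed A.finsum_closed) auto
    fix a assume a: "a \<in> carrier G"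
    show "(\<Oplus>g\<in>carrier G. (u a \<otimes>\<^bsub>K\<^esub> v (inv\<^bsub>G\<^esub> a \<otimes>\<^bsub>G\<^esub> g)) \<odot> e g) =
        (u a \<odot> e a) \<otimes> (\<Oplus>g\<in>carrier G. v g \<odot> e g)"
    proof -
      have bij: "(\<lambda>b. a \<otimes>\<^bsub>G\<^esub> b) ` carrier G = carrier G" "inj_on (\<lambda>b. a \<otimes>\<^bsub>G\<^esub> b) (carrier G)"
        using a G.surj_const_mult G.inj_on_cmult by auto
      have "(\<Oplus>g\<in>carrier G. (u a \<otimes>\<^bsub>K\<^esub> v (inv\<^bsub>G\<^esub> a \<otimes>\<^bsub>G\<^esub> g)) \<odot> e g) =
          (\<Oplus>g\<in>(\<lambda>b. a \<otimes>\<^bsub>G\<^esub> b) ` carrier G. (u a \<otimes>\<^bsub>K\<^esub> v (inv\<^bsub>G\<^esub> a \<otimes>\<^bsub>G\<^esub> g)) \<odot> e g)"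
        by (simp only: bij(1))
      also have "\<dots> = (\<Oplus>b\<in>carrier G. (u a \<otimes>\<^bsub>K\<^esub> v (inv\<^bsub>G\<^esub> a \<otimes>\<^bsub>G\<^esub> (a \<otimes>\<^bsub>G\<^esub> b))) \<odot> e (a \<otimes>\<^bsub>G\<^esub> b))"
        by (rule A.finsum_reindex[OF _ bij(2)]) (use a uv eA in auto)
      also have "\<dots> = (\<Oplus>b\<in>carrier G. (u a \<odot> e a) \<otimes> (v b \<odot> e b))"
        using a uv eA
        by (intro A.finsum_cong)
          (auto simp: simp_implies_def mult smult_mult_smult G.m_assoc[symmetric])
      also have "\<dots> = (u a \<odot> e a) \<otimes> (\<Oplus>g\<in>carrier G. v g \<odot> e g)"
        using a uv eA G(2) by (intro A.finsum_rdistr[symmetric]) auto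
      finally show ?thesis .
    qed
  qed
  also have "\<dots> = (\<Oplus>g\<in>carrier G. u g \<odot> e g) \<otimes> (\<Oplus>g\<in>carrier G. v g \<odot> e g)"
    using uv eA G(2) by (intro A.finsum_ldistr[symmetric] A.finsum_closed) auto
  finally show ?thesis .
qed

lemma multiplicative_basis_algebra_iso:
  assumes G: "group G" "finite (carrier G)" and "multiplicative_basis G e"
  defines "\<phi> \<equiv> \<lambda>u. \<Oplus>g\<in>carrier G. u g \<odot> e g"
  shows "\<phi> \<in> algebra_iso K (group_algebra K G) A"
    and "g \<in> carrier G \<Longrightarrow> \<phi> (group_element K G g) = e g"
proof -
  interpret G: group G by fact
  let ?B = "group_algebra K G"
  have basis: "basis (carrier G) e" and one: "e \<one>\<^bsub>G\<^esub> = \<one>"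
    and mult: "\<And>g h. g \<in> carrier G \<Longrightarrow> h \<in> carrier G \<Longrightarrow> e (g \<otimes>\<^bsub>G\<^esub> h) = e g \<otimes> e h"
    using assms(3) by (auto simp: multiplicative_basis_def)
  have e: "e \<in> carrier G \<rightarrow> carrier A" and span: "spanning (carrier G) e" using basis by (auto simp: basis_def)
  note B = group_algebra_carrier[OF G(2)]
  show elem: "\<phi> (group_element K G g) = e g" if "g \<in> carrier G" for g
    unfolding \<phi>_def by (rule group_algebra_map_group_element[OF G(2) e that])
  have uK: "u \<in> carrier G \<rightarrow> carrier K" if "u \<in> carrier ?B" for u using that by (auto simp: B)
  have cong: "(\<Oplus>g\<in>carrier G. f g \<odot> e g) = (\<Oplus>g\<in>carrier G. h g \<odot> e g)"
    if "h \<in> carrier G \<rightarrow> carrier K" "\<And>g. g \<in> carrier G \<Longrightarrow> f g = h g" for f h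
    using that e by (intro A.finsum_cong) (auto simp: simp_implies_def Pi_iff)
  have "\<phi> \<in> ring_hom ?B A"
  proof (rule ring_hom_memI)
    fix u v assume u: "u \<in> carrier ?B" and v: "v \<in> carrier ?B"
    show "\<phi> u \<in> carrier A" unfolding \<phi>_def by (rule lincomb_closed[OF e uK[OF u]])
    show "\<phi> (u \<otimes>\<^bsub>?B\<^esub> v) = \<phi> u \<otimes> \<phi> v"
      unfolding \<phi>_def by (rule multiplicative_basis_map_mult[OF G e mult u v])
    have "\<phi> (u \<oplus>\<^bsub>?B\<^esub> v) = (\<Oplus>g\<in>carrier G. (u g \<oplus>\<^bsub>K\<^esub> v g) \<odot> e g)"
      unfolding \<phi>_def using uK[OF u] uK[OF v] by (intro cong) (auto simp: group_algebra_add)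
    then show "\<phi> (u \<oplus>\<^bsub>?B\<^esub> v) = \<phi> u \<oplus> \<phi> v"
      unfolding \<phi>_def using lincomb_add[OF e uK[OF u] uK[OF v]] by simp
  next
    have "\<one>\<^bsub>?B\<^esub> = group_element K G \<one>\<^bsub>G\<^esub>" by (simp add: group_algebra_def group_element_def)
    then show "\<phi> \<one>\<^bsub>?B\<^esub> = \<one>" using elem[of "\<one>\<^bsub>G\<^esub>"] one by simp
  qed
  moreover have "bij_betw \<phi> (carrier ?B) (carrier A)"
    unfolding bij_betw_def
  proof
    show "inj_on \<phi> (carrier ?B)"
    proof (rule inj_onI)
      fix u v assume u: "u \<in> carrier ?B" and v: "v \<in> carrier ?B" and "\<phi> u = \<phi> v"
      then have "u g = v g" if "g \<in> carrier G" for g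
        using basis_unique[OF basis uK[OF u] uK[OF v]] that by (simp add: \<phi>_def)
      moreover have "u \<in> extensional (carrier G)" "v \<in> extensional (carrier G)"
        using u v by (auto simp: B PiE_def)
      ultimately show "u = v" by (rule extensionalityI[rotated 2])
    qed
    show "\<phi> ` carrier ?B = carrier A"
    proof
      show "\<phi> ` carrier ?B \<subseteq> carrier A" unfolding \<phi>_def using lincomb_closed[OF e uK] by blast
      show "carrier A \<subseteq> \<phi> ` carrier ?B"
      proof
        fix a assume "a \<in> carrier A"
        then obtain c where c: "c \<in> carrier G \<rightarrow> carrier K" "a = (\<Oplus>g\<in>carrier G. c g \<odot> e g)"
          using span by (auto simp: spanning_def)
        have "\<phi> (restrict c (carrier G)) = a" unfolding \<phi>_def c(2) by (rule cong[OF c(1)]) simp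
        moreover have "restrict c (carrier G) \<in> carrier ?B" using c(1) by (auto simp: B)
        ultimately show "a \<in> \<phi> ` carrier ?B" by blast
      qed
    qed
  qed
  moreover have "\<phi> (k \<odot>\<^bsub>?B\<^esub> u) = k \<odot> \<phi> u" if k: "k \<in> carrier K" and u: "u \<in> carrier ?B" for k u
  proof -
    have "\<phi> (k \<odot>\<^bsub>?B\<^esub> u) = (\<Oplus>g\<in>carrier G. (k \<otimes>\<^bsub>K\<^esub> u g) \<odot> e g)"
      unfolding \<phi>_def using k uK[OF u] by (intro cong) (auto simp: group_algebra_smult)
    also have "\<dots> = k \<odot> \<phi> u" unfolding \<phi>_def using lincomb_smult[OF G(2) e uK[OF u] k] by simp
    finally show ?thesis .
  qed
  ultimately show "\<phi> \<in> algebra_iso K ?B A" by (auto simp: algebra_iso_def ring_iso_def)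
qed

lemma algebra_iso_group_grading:
  assumes "\<phi> \<in> algebra_iso K (group_algebra K G) A" "finite (carrier G)"
  shows "\<phi> ` group_algebra_grading K G g = {k \<odot> \<phi> (group_element K G g) | k. k \<in> carrier K}"
proof -
  let ?\<delta> = "group_element K G g"
  have smult: "\<phi> (k \<odot>\<^bsub>group_algebra K G\<^esub> ?\<delta>) = k \<odot> \<phi> ?\<delta>" if "k \<in> carrier K" for k
    using assms(1) group_element_closed[OF assms(2)] that by (simp add: algebra_iso_def)
  have "group_algebra_grading K G g = (\<lambda>k. k \<odot>\<^bsub>group_algebra K G\<^esub> ?\<delta>) ` carrier K"
    unfolding group_algebra_grading_def by blast
  then have "\<phi> ` group_algebra_grading K G g = (\<lambda>k. \<phi> (k \<odot>\<^bsub>group_algebra K G\<^esub> ?\<delta>)) ` carrier K"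
    by (simp only: image_image)
  also have "\<dots> = (\<lambda>k. k \<odot> \<phi> ?\<delta>) ` carrier K" by (rule image_cong[OF refl smult])
  finally show ?thesis by blast
qed

text \<open>The point is that \<open>\<phi>\<close> maps \<open>u\<close> to the linear combination of the \<open>e g\<close> with coefficients
  \<open>u g\<close>. This is shown by switching on the values of \<open>u\<close> one group element at a time.\<close>

lemma algebra_iso_multiplicative_basis:
  assumes G: "group G" "finite (carrier G)" and \<phi>: "\<phi> \<in> algebra_iso K (group_algebra K G) A"
  shows "multiplicative_basis G (\<lambda>g. \<phi> (group_element K G g))"
proof -
  interpret G: group G by fact
  let ?B = "group_algebra K G" and ?e = "\<lambda>g. \<phi> (group_element K G g)"
  note B = group_algebra_carrier[OF G(2)]
  have hom: "\<phi> \<in> ring_hom ?B A" and bij: "bij_betw \<phi> (carrier ?B) (carrier A)"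
    and smult: "\<And>k u. k \<in> carrier K \<Longrightarrow> u \<in> carrier ?B \<Longrightarrow> \<phi> (k \<odot>\<^bsub>?B\<^esub> u) = k \<odot> \<phi> u"
    using \<phi> by (auto simp: algebra_iso_def ring_iso_def)
  have \<phi>A: "\<phi> u \<in> carrier A" if "u \<in> carrier ?B" for u using ring_hom_closed[OF hom that] .
  have e: "?e \<in> carrier G \<rightarrow> carrier A" using \<phi>A group_element_closed[OF G(2)] by auto
  define trunc where "trunc u F = (\<lambda>g\<in>carrier G. if g \<in> F then u g else \<zero>\<^bsub>K\<^esub>)" for u F
  have trunc_closed: "trunc u F \<in> carrier ?B" if "u \<in> carrier G \<rightarrow> carrier K" for u F
    using that by (auto simp: B trunc_def)
  have zero: "\<phi> (trunc u {}) = \<zero>" if u: "u \<in> carrier G \<rightarrow> carrier K" for u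
  proof -
    have "trunc u {} \<oplus>\<^bsub>?B\<^esub> trunc u {} = trunc u {}"
      by (rule ext) (auto simp: trunc_def group_algebra_def)
    then have "\<phi> (trunc u {}) \<oplus> \<phi> (trunc u {}) = \<phi> (trunc u {})"
      using ring_hom_add[OF hom trunc_closed[OF u] trunc_closed[OF u], of "{}" "{}"] by simp
    then show ?thesis using \<phi>A[OF trunc_closed[OF u]] by simp
  qed
  have expand: "\<phi> (trunc u F) = (\<Oplus>g\<in>F. u g \<odot> ?e g)"
    if u: "u \<in> carrier G \<rightarrow> carrier K" and F: "finite F" "F \<subseteq> carrier G" for u F
    using F
  proof (induction F rule: finite_induct)
    case empty
    then show ?case using zero[OF u] by simp
  next
    case (insert g F)
    then have g: "g \<in> carrier G" "u g \<in> carrier K" using u by auto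
    have "trunc u (insert g F) = (u g \<odot>\<^bsub>?B\<^esub> group_element K G g) \<oplus>\<^bsub>?B\<^esub> trunc u F"
      using u g insert.hyps(2)
      by (intro ext) (auto simp: trunc_def group_algebra_def group_element_def Pi_iff)
    moreover have "u g \<odot>\<^bsub>?B\<^esub> group_element K G g \<in> carrier ?B"
      using g by (auto simp: B group_algebra_def group_element_def)
    ultimately have "\<phi> (trunc u (insert g F)) = u g \<odot> ?e g \<oplus> \<phi> (trunc u F)"
      using ring_hom_add[OF hom _ trunc_closed[OF u]] smult[OF g(2) group_element_closed[OF G(2)]] by simp
    also have "\<dots> = (\<Oplus>h\<in>insert g F. u h \<odot> ?e h)"
      using insert u e by (subst A.finsum_insert) (auto simp: Pi_iff subset_iff)
    finally show ?case .
  qed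
  have trunc_all: "trunc u (carrier G) = u" if "u \<in> carrier ?B" for u
    using that by (intro ext) (auto simp: B trunc_def PiE_def extensional_def)
  have "spanning (carrier G) ?e"
    unfolding spanning_def
  proof
    fix a assume "a \<in> carrier A"
    then obtain u where u: "u \<in> carrier ?B" "a = \<phi> u" using bij by (auto simp: bij_betw_def)
    then have "u \<in> carrier G \<rightarrow> carrier K" by (auto simp: B)
    with expand[OF this G(2)] trunc_all[OF u(1)] u(2)
    show "\<exists>c\<in>carrier G \<rightarrow> carrier K. a = (\<Oplus>g\<in>carrier G. c g \<odot> ?e g)" by auto
  qed
  moreover have "lin_independent (carrier G) ?e"
    unfolding lin_independent_def
  proof (intro ballI impI)
    fix c g assume c: "c \<in> carrier G \<rightarrow> carrier K" "(\<Oplus>g\<in>carrier G. c g \<odot> ?e g) = \<zero>" and g: "g \<in> carrier G"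
    then have "\<phi> (trunc c (carrier G)) = \<phi> (trunc c {})" using expand[OF c(1) G(2)] zero[OF c(1)] by simp
    then have "trunc c (carrier G) = trunc c {}"
      using bij trunc_closed[OF c(1)] by (auto simp: bij_betw_def inj_on_def)
    from fun_cong[OF this, of g] show "c g = \<zero>\<^bsub>K\<^esub>" using g by (simp add: trunc_def)
  qed
  ultimately have "basis (carrier G) ?e" using e G(2) by (simp add: basis_def)
  moreover have "?e \<one>\<^bsub>G\<^esub> = \<one>"
  proof -
    have "\<one>\<^bsub>?B\<^esub> = group_element K G \<one>\<^bsub>G\<^esub>" by (simp add: group_algebra_def group_element_def)
    then show ?thesis using ring_hom_one[OF hom] by simp
  qed
  moreover have "?e (g \<otimes>\<^bsub>G\<^esub> h) = ?e g \<otimes> ?e h" if gh: "g \<in> carrier G" "h \<in> carrier G" for g h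
  proof -
    have "group_element K G g \<otimes>\<^bsub>?B\<^esub> group_element K G h = group_element K G (g \<otimes>\<^bsub>G\<^esub> h)"
    proof (rule extensionalityI)
      show "group_element K G g \<otimes>\<^bsub>?B\<^esub> group_element K G h \<in> extensional (carrier G)"
        by (simp add: group_algebra_def)
      show "group_element K G (g \<otimes>\<^bsub>G\<^esub> h) \<in> extensional (carrier G)" by (simp add: group_element_def)
      fix a assume a: "a \<in> carrier G"
      have iff: "inv\<^bsub>G\<^esub> g \<otimes>\<^bsub>G\<^esub> a = h \<longleftrightarrow> a = g \<otimes>\<^bsub>G\<^esub> h" using a gh G.inv_solve_left' by metis
      have "(group_element K G g \<otimes>\<^bsub>?B\<^esub> group_element K G h) a =
          (\<Oplus>\<^bsub>K\<^esub>b\<in>carrier G. group_element K G g b \<otimes>\<^bsub>K\<^esub> group_element K G h (inv\<^bsub>G\<^esub> b \<otimes>\<^bsub>G\<^esub> a))"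
        by (rule group_algebra_mult[OF G group_element_closed group_element_closed a]) (fact G(2))+
      also have "\<dots> = (\<Oplus>\<^bsub>K\<^esub>b\<in>carrier G. if g = b then if a = g \<otimes>\<^bsub>G\<^esub> h then \<one>\<^bsub>K\<^esub> else \<zero>\<^bsub>K\<^esub> else \<zero>\<^bsub>K\<^esub>)"
        using a gh iff by (intro K.finsum_cong) (auto simp: group_element_def simp_implies_def)
      also have "\<dots> = (if a = g \<otimes>\<^bsub>G\<^esub> h then \<one>\<^bsub>K\<^esub> else \<zero>\<^bsub>K\<^esub>)"
        using gh G(2) by (intro K.finsum_singleton) auto
      finally show "(group_element K G g \<otimes>\<^bsub>?B\<^esub> group_element K G h) a = group_element K G (g \<otimes>\<^bsub>G\<^esub> h) a"
        using a by (simp add: group_element_def)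
    qed
    then show ?thesis
      using ring_hom_mult[OF hom group_element_closed group_element_closed] G(2) by metis
  qed
  ultimately show ?thesis by (simp add: multiplicative_basis_def)
qed

end

section \<open>Quotient gradings\<close>

context field_algebra
begin

text \<open>A homogeneous element stays homogeneous in a quotient grading.\<close>

lemma component_subset_quotient:
  assumes "grading K A G U" "\<alpha> \<subseteq> carrier G" "s \<in> \<alpha>"
  shows "U s \<subseteq> quotient_grading A U \<alpha>"
proof
  fix u assume u: "u \<in> U s"
  have sub: "\<forall>t\<in>\<alpha>. submodule (U t) K A" using assms(1,2) by (auto simp: grading_def)
  show "u \<in> quotient_grading A U \<alpha>"
    unfolding quotient_grading_def using single_family[OF sub assms(3) u]
    by (intro image_eqI[where x = "\<lambda>t\<in>\<alpha>. if t = s then u else \<zero>"]) simp_all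
qed

lemma quotient_singleton_subset:
  assumes "submodule (U s) K A"
  shows "quotient_grading A U {s} \<subseteq> U s"
proof
  fix a assume "a \<in> quotient_grading A U {s}"
  then obtain f where f: "f \<in> finite_families A {s} U" "a = family_sum A {s} f"
    by (auto simp: quotient_grading_def)
  have fs: "f s \<in> U s" using finite_families_mem[OF f(1)] by simp
  then have "f s \<in> carrier A" using assms submodule_subset by blast
  then have "family_sum A {s} f = finsum A f {s}" by (intro family_sum_eq_finsum) auto
  then show "a \<in> U s" using f(2) fs \<open>f s \<in> carrier A\<close> by simp
qed

lemma quotient_whole_group:
  assumes "grading K A G U"
  shows "quotient_grading A U (carrier G) = carrier A"
  using assms by (simp add: grading_def bij_betw_def quotient_grading_def)

end

text \<open>Divide by the whole group.\<close>

lemma trivial_grading_is_quotient: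
  assumes "field_algebra K A" "grading K A G U" "trivial_grading K A L W"
  shows "is_quotient_grading A G U L W"
proof -
  interpret field_algebra K A by fact
  have "group G" using assms(2) by (simp add: grading_def)
  interpret G: group G by fact
  have gradW: "grading K A L W" and L: "carrier L = {\<one>\<^bsub>L\<^esub>}"
    using assms(3) by (auto simp: trivial_grading_def trivial_group_def)
  have "group L" using gradW by (simp add: grading_def)
  interpret L: group L by fact
  have car: "carrier (G Mod carrier G) = {carrier G}"
    unfolding carrier_FactGroup using G.coset_join2[OF _ G.subgroup_self] by (auto intro!: image_eqI[of _ _ "\<one>\<^bsub>G\<^esub>"])
  have "quotient_grading A W {\<one>\<^bsub>L\<^esub>} = carrier A" using quotient_whole_group[OF gradW] L by simp
  moreover have sub: "submodule (W \<one>\<^bsub>L\<^esub>) K A" using gradW by (simp add: grading_def)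
  ultimately have "W \<one>\<^bsub>L\<^esub> = carrier A"
    using quotient_singleton_subset[of W "\<one>\<^bsub>L\<^esub>", OF sub] submodule_subset[OF sub] by blast
  then have "\<forall>\<alpha>\<in>carrier (G Mod carrier G). W ((\<lambda>_. \<one>\<^bsub>L\<^esub>) \<alpha>) = quotient_grading A U \<alpha>"
    unfolding car using quotient_whole_group[OF assms(2)] by simp
  moreover have "(\<lambda>_. \<one>\<^bsub>L\<^esub>) \<in> iso (G Mod carrier G) L"
    by (auto simp: iso_def hom_def bij_betw_def car L)
  ultimately have "same_grading (G Mod carrier G) (quotient_grading A U) L W"
    unfolding same_grading_def by (rule_tac bexI[of _ "\<lambda>_. \<one>\<^bsub>L\<^esub>"])
  then show ?thesis
    unfolding is_quotient_grading_def by (intro exI[of _ "carrier G"] conjI G.normal_self)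
qed

section \<open>The two types of gradings of a truncated line\<close>

context truncated_line
begin

abbreviation cyc :: "int monoid"
  where "cyc \<equiv> integer_mod_group p"

text \<open>This is \<^const>\<open>first_type\<close> with an arbitrary truncated line in place of the truncated
  polynomial algebra.\<close>

definition group_algebra_type :: "('g, 'o) monoid_scheme \<Rightarrow> ('g \<Rightarrow> 'a set) \<Rightarrow> bool"
  where "group_algebra_type G U \<longleftrightarrow>
    (\<exists>\<phi>\<in>algebra_iso K (group_algebra K cyc) A.
      same_grading cyc (\<lambda>c. \<phi> ` group_algebra_grading K cyc c) G U)"

lemma carrier_cyc: "carrier cyc = {0..<int p}"
  using p_gt_1 by (simp add: carrier_integer_mod_group)

lemma finite_cyc: "finite (carrier cyc)"
  by (simp add: carrier_cyc)

lemma group_algebra_type_iff: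
  "group_algebra_type G U \<longleftrightarrow> (\<exists>e \<theta>. multiplicative_basis cyc e \<and> \<theta> \<in> iso cyc G \<and>
    (\<forall>c\<in>carrier cyc. U (\<theta> c) = {k \<odot> e c | k. k \<in> carrier K}))" (is "_ \<longleftrightarrow> ?R")
proof
  assume "group_algebra_type G U"
  then obtain \<phi> \<theta> where \<phi>: "\<phi> \<in> algebra_iso K (group_algebra K cyc) A" and \<theta>: "\<theta> \<in> iso cyc G"
    and U: "\<And>c. c \<in> carrier cyc \<Longrightarrow> U (\<theta> c) = \<phi> ` group_algebra_grading K cyc c"
    unfolding group_algebra_type_def same_grading_def by blast
  have "\<forall>c\<in>carrier cyc. U (\<theta> c) = {k \<odot> \<phi> (group_element K cyc c) | k. k \<in> carrier K}"
    using U algebra_iso_group_grading[OF \<phi> finite_cyc] by simp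
  with algebra_iso_multiplicative_basis[OF group_integer_mod_group finite_cyc \<phi>] \<theta>
  show ?R by (intro exI[of _ "\<lambda>c. \<phi> (group_element K cyc c)"] exI[of _ \<theta>] conjI)
next
  assume ?R
  then obtain e \<theta> where e: "multiplicative_basis cyc e" and \<theta>: "\<theta> \<in> iso cyc G"
    and U: "\<And>c. c \<in> carrier cyc \<Longrightarrow> U (\<theta> c) = {k \<odot> e c | k. k \<in> carrier K}"
    by blast
  let ?\<phi> = "\<lambda>u. \<Oplus>g\<in>carrier cyc. u g \<odot> e g"
  note \<phi> = multiplicative_basis_algebra_iso[OF group_integer_mod_group finite_cyc e]
  have "\<forall>c\<in>carrier cyc. U (\<theta> c) = ?\<phi> ` group_algebra_grading K cyc c"
    using U algebra_iso_group_grading[OF \<phi>(1) finite_cyc] \<phi>(2) by simp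
  with \<theta> \<phi>(1) show "group_algebra_type G U"
    unfolding group_algebra_type_def same_grading_def by blast
qed

lemma group_algebra_type_connected:
  assumes "group_algebra_type G U" and G: "group G"
  shows "connected_grading K A G U"
proof -
  interpret G: group G by fact
  obtain e \<theta> where e: "multiplicative_basis cyc e" and \<theta>: "\<theta> \<in> iso cyc G"
    and U: "\<And>c. c \<in> carrier cyc \<Longrightarrow> U (\<theta> c) = {k \<odot> e c | k. k \<in> carrier K}"
    using assms(1) unfolding group_algebra_type_iff by blast
  have basis: "basis (carrier cyc) e" using e by (simp add: multiplicative_basis_def)
  then have eA: "e \<in> carrier cyc \<rightarrow> carrier A" by (simp add: basis_def)
  have \<theta>_bij: "bij_betw \<theta> (carrier cyc) (carrier G)" and \<theta>_hom: "\<theta> \<in> hom cyc G"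
    using \<theta> by (auto simp: iso_def)
  then have inj: "inj_on \<theta> (carrier cyc)" and im: "\<theta> ` carrier cyc = carrier G"
    by (auto simp: bij_betw_def)
  note component = basis_component_inj[OF finite_cyc eA inj]
  have "grading K A G (basis_component (carrier cyc) e \<theta>)"
  proof (rule basis_grading[OF basis G])
    show "\<theta> \<in> carrier cyc \<rightarrow> carrier G" using im by auto
    fix i j assume ij: "i \<in> carrier cyc" "j \<in> carrier cyc"
    then have c: "i \<otimes>\<^bsub>cyc\<^esub> j \<in> carrier cyc" using group.is_monoid[OF group_integer_mod_group] monoid.m_closed by metis
    show "e i \<otimes> e j \<in> basis_component (carrier cyc) e \<theta> (\<theta> i \<otimes>\<^bsub>G\<^esub> \<theta> j)"
      using basis_in_component[OF finite_cyc eA c, of \<theta>] hom_mult[OF \<theta>_hom ij] e ij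
      by (simp only: multiplicative_basis_def)
  qed
  moreover have "basis_component (carrier cyc) e \<theta> s = U s" if s: "s \<in> carrier G" for s
  proof -
    obtain c where "c \<in> carrier cyc" "s = \<theta> c" using s im by blast
    then show ?thesis using component U by simp
  qed
  ultimately have grading: "grading K A G U" by (rule grading_cong)
  have "s \<in> grading_support A G U" if s: "s \<in> carrier G" for s
  proof -
    obtain c where c: "c \<in> carrier cyc" "s = \<theta> c" using s im by blast
    have "\<one>\<^bsub>K\<^esub> \<odot> e c \<in> U s" unfolding c(2) U[OF c(1)] by blast
    then have "e c \<in> U s" using eA c(1) by (simp add: Pi_iff)
    then show ?thesis using basis_nonzero[OF basis c(1)] s by (auto simp: grading_support_def)
  qed
  then have "grading_support A G U = carrier G" by (auto simp: grading_support_def)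
  moreover have "generate G (carrier G) = carrier G"
    using G.generate_incl[of "carrier G"] generate.incl[of _ "carrier G" G] by auto
  ultimately show ?thesis using grading by (simp add: connected_grading_def)
qed

text \<open>Every component is spanned by a unit \<open>e c\<close>, whose inverse is \<open>e\<close> at the inverse of \<open>c\<close>. So
  no nonzero homogeneous element is nilpotent.\<close>

lemma group_algebra_type_reduced:
  assumes "group_algebra_type G U" "s \<in> carrier G" "u \<in> U s" "u [^] p = \<zero>"
  shows "u = \<zero>"
proof -
  interpret C: group cyc by simp
  obtain e \<theta> where e: "multiplicative_basis cyc e" and \<theta>: "\<theta> \<in> iso cyc G"
    and U: "\<And>c. c \<in> carrier cyc \<Longrightarrow> U (\<theta> c) = {k \<odot> e c | k. k \<in> carrier K}"
    using assms(1) unfolding group_algebra_type_iff by blast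
  have eA: "e c \<in> carrier A" if "c \<in> carrier cyc" for c
    using e that by (auto simp: multiplicative_basis_def basis_def)
  obtain c where c: "c \<in> carrier cyc" "s = \<theta> c"
    using assms(2) \<theta> by (auto simp: iso_def bij_betw_def)
  obtain k where k: "k \<in> carrier K" "u = k \<odot> e c" using U[OF c(1)] assms(3) c(2) by auto
  have c': "inv\<^bsub>cyc\<^esub> c \<in> carrier cyc" using c(1) by (rule C.inv_closed)
  have "e c \<otimes> e (inv\<^bsub>cyc\<^esub> c) = e (c \<otimes>\<^bsub>cyc\<^esub> inv\<^bsub>cyc\<^esub> c)"
    using e c(1) c' by (simp only: multiplicative_basis_def)
  also have "\<dots> = \<one>" using e C.r_inv[OF c(1)] by (simp only: multiplicative_basis_def)
  finally have "e c [^] p \<otimes> e (inv\<^bsub>cyc\<^esub> c) [^] p = \<one>"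
    using eA[OF c(1)] eA[OF c'] A.nat_pow_distrib[of "e c" "e (inv\<^bsub>cyc\<^esub> c)" p] by simp
  then have "e c [^] p \<noteq> \<zero>" using one_not_zero eA[OF c'] by auto
  moreover have "(k [^]\<^bsub>K\<^esub> p) \<odot> (e c [^] p) = \<zero>" using assms(4) k eA[OF c(1)] by (simp add: smult_pow)
  ultimately have "k [^]\<^bsub>K\<^esub> p = \<zero>\<^bsub>K\<^esub>" using smult_eq_zero_iff eA[OF c(1)] k(1) by auto
  then have "k = \<zero>\<^bsub>K\<^esub>" using scalar_pow_nonzero[OF k(1)] by blast
  then show ?thesis using k(2) eA[OF c(1)] by simp
qed

lemma power_mod:
  assumes "b \<in> carrier A" "b [^] p = \<one>"
  shows "b [^] (n mod p) = b [^] n"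
proof -
  have "b [^] n = b [^] (p * (n div p) + n mod p)" by simp
  also have "\<dots> = (b [^] p) [^] (n div p) \<otimes> b [^] (n mod p)"
    using assms(1) by (simp only: A.nat_pow_mult A.nat_pow_pow A.nat_pow_closed)
  also have "\<dots> = b [^] (n mod p)" using assms by simp
  finally show ?thesis by simp
qed

lemma bij_betw_nat_cyc: "bij_betw nat (carrier cyc) {..<p}"
  unfolding carrier_cyc by (rule bij_betw_byWitness[where f' = int]) auto

lemma powers_multiplicative_basis:
  assumes b: "b \<in> carrier A" "b [^] p = \<one>" and basis: "basis {..<p} (\<lambda>i. b [^] i)"
  shows "multiplicative_basis cyc (\<lambda>i. b [^] nat i)"
  unfolding multiplicative_basis_def
proof (intro conjI ballI)
  show "basis (carrier cyc) (\<lambda>i. b [^] nat i)" by (rule basis_reindex[OF basis bij_betw_nat_cyc])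
  show "b [^] nat \<one>\<^bsub>cyc\<^esub> = \<one>" by simp
  fix i j assume ij: "i \<in> carrier cyc" "j \<in> carrier cyc"
  then have "nat ((i + j) mod int p) = (nat i + nat j) mod p"
    by (simp add: carrier_cyc nat_mod_distrib nat_add_distrib)
  then show "b [^] nat (i \<otimes>\<^bsub>cyc\<^esub> j) = b [^] nat i \<otimes> b [^] nat j"
    using power_mod[OF b] b(1) by (simp add: A.nat_pow_mult)
qed

lemma cyclic_iso:
  assumes G: "group G" and g: "g \<in> carrier G" "group.ord G g = p" "carrier G = generate G {g}"
  shows "(\<lambda>i::int. g [^]\<^bsub>G\<^esub> i) \<in> iso cyc G"
proof -
  interpret G: group G by fact
  have eq: "g [^]\<^bsub>G\<^esub> i = g [^]\<^bsub>G\<^esub> j \<longleftrightarrow> int p dvd j - i" for i j :: int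
    using G.int_pow_eq[OF g(1)] g(2) by simp
  have reduce: "g [^]\<^bsub>G\<^esub> (i mod int p) = g [^]\<^bsub>G\<^esub> i" for i :: int
    unfolding eq by (rule dvd_minus_mod)
  show ?thesis
    unfolding iso_def mem_Collect_eq
  proof
    show "(\<lambda>i::int. g [^]\<^bsub>G\<^esub> i) \<in> hom cyc G"
      using g(1) by (intro homI) (auto simp: reduce G.int_pow_mult)
    show "bij_betw (\<lambda>i::int. g [^]\<^bsub>G\<^esub> i) (carrier cyc) (carrier G)"
      unfolding bij_betw_def
    proof
      show "inj_on (\<lambda>i::int. g [^]\<^bsub>G\<^esub> i) (carrier cyc)"
      proof (rule inj_onI)
        fix i j :: int assume ij: "i \<in> carrier cyc" "j \<in> carrier cyc" and "g [^]\<^bsub>G\<^esub> i = g [^]\<^bsub>G\<^esub> j"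
        then have "int p dvd j - i" using eq by simp
        then have "j mod int p = i mod int p" by (simp add: mod_eq_dvd_iff)
        then show "i = j" using ij by (simp add: carrier_cyc)
      qed
      show "(\<lambda>i::int. g [^]\<^bsub>G\<^esub> i) ` carrier cyc = carrier G"
      proof
        show "(\<lambda>i::int. g [^]\<^bsub>G\<^esub> i) ` carrier cyc \<subseteq> carrier G" using g(1) by auto
        show "carrier G \<subseteq> (\<lambda>i::int. g [^]\<^bsub>G\<^esub> i) ` carrier cyc"
        proof
          fix s assume "s \<in> carrier G"
          then obtain i :: int where "s = g [^]\<^bsub>G\<^esub> i" using g(3) G.generate_pow[OF g(1)] by auto
          then have "s = g [^]\<^bsub>G\<^esub> (i mod int p)" using reduce by simp
          moreover have "i mod int p \<in> carrier cyc" using p_gt_1 by (simp add: carrier_cyc)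
          ultimately show "s \<in> (\<lambda>i::int. g [^]\<^bsub>G\<^esub> i) ` carrier cyc" by blast
        qed
      qed
    qed
  qed
qed

text \<open>The powers of \<open>b\<close> are a homogeneous basis which multiplies like the cyclic group of order
  \<open>p\<close>.\<close>

lemma unit_powers_group_algebra_type:
  assumes grading: "grading K A G U" and g: "g \<in> carrier G" "group.ord G g = p" "carrier G = generate G {g}"
    and b: "b \<in> U g" "b [^] p = \<one>" "basis {..<p} (\<lambda>i. b [^] i)"
  shows "group_algebra_type G U"
proof -
  have G: "group G" using grading by (simp add: grading_def)
  interpret G: group G by fact
  let ?e = "\<lambda>i. b [^] nat i" and ?\<theta> = "\<lambda>i::int. g [^]\<^bsub>G\<^esub> i"
  have bA: "b \<in> carrier A" using component_closed[OF grading g(1) b(1)] .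
  have e: "multiplicative_basis cyc ?e" by (rule powers_multiplicative_basis[OF bA b(2,3)])
  then have basis: "basis (carrier cyc) ?e" by (simp add: multiplicative_basis_def)
  have \<theta>: "?\<theta> \<in> iso cyc G" by (rule cyclic_iso[OF G g])
  then have inj: "inj_on ?\<theta> (carrier cyc)" and \<theta>G: "?\<theta> \<in> carrier cyc \<rightarrow> carrier G"
    by (auto simp: iso_def bij_betw_def)
  have hom: "?e i \<in> U (?\<theta> i)" if "i \<in> carrier cyc" for i
  proof -
    have "?\<theta> i = g [^]\<^bsub>G\<^esub> nat i" using that int_pow_int[of G g "nat i"] by (simp add: carrier_cyc)
    then show ?thesis using powers_homogeneous[OF grading g(1) b(1), of "nat i"] by simp
  qed
  have "U (?\<theta> c) = {k \<odot> ?e c | k. k \<in> carrier K}" if c: "c \<in> carrier cyc" for c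
  proof -
    have "?\<theta> c \<in> carrier G" using g(1) by simp
    from homogeneous_basis_component[OF grading basis \<theta>G hom this]
    have "U (?\<theta> c) = basis_component (carrier cyc) ?e ?\<theta> (?\<theta> c)" .
    also have "\<dots> = {k \<odot> ?e c | k. k \<in> carrier K}"
      using bA by (intro basis_component_inj[OF finite_cyc _ inj c]) auto
    finally show ?thesis .
  qed
  then show ?thesis unfolding group_algebra_type_iff using e \<theta> by blast
qed

text \<open>A homogeneous element of nontrivial degree outside the ideal generated by \<open>x\<close> would make
  this a grading of the group algebra. So there is none, and some homogeneous nilpotent \<open>y\<close> has a basis
  of powers.\<close>

lemma other_type_generator:
  assumes conn: "connected_grading K A G U" and other: "\<not> group_algebra_type G U"
  obtains g y where "g \<in> carrier G" "carrier G = generate G {g}" "y \<in> U g" "y \<noteq> \<zero>" "y [^] p = \<zero>"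
proof -
  have grading: "grading K A G U" and gen: "generate G (grading_support A G U) = carrier G"
    using conn by (auto simp: connected_grading_def)
  have "U s \<subseteq> PIdl x" if s: "s \<in> carrier G" "s \<noteq> \<one>\<^bsub>G\<^esub>" for s
  proof
    fix a assume a: "a \<in> U s"
    show "a \<in> PIdl x"
    proof (rule ccontr)
      assume "a \<notin> PIdl x"
      from homogeneous_group_element[OF grading s a this] obtain b where
        b: "b \<in> U s" "b [^] p = \<one>" "basis {..<p} (\<lambda>i. b [^] i)" and ord: "group.ord G s = p" .
      have "carrier G = generate G {s}" by (rule connected_cyclic[OF grading gen s(1) b(1,3)])
      then show False using unit_powers_group_algebra_type[OF grading s(1) ord _ b] other by blast
    qed
  qed
  from homogeneous_nilpotent_generator[OF grading this] obtain g y where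
    gy: "g \<in> carrier G" "y \<in> U g" "y [^] p = \<zero>" "y [^] (p - 1) \<noteq> \<zero>" by blast
  have yA: "y \<in> carrier A" by (rule component_closed[OF grading gy(1,2)])
  have "carrier G = generate G {g}"
    by (rule connected_cyclic[OF grading gen gy(1,2) nilpotent_basis[OF yA gy(3,4)]])
  moreover have "y \<noteq> \<zero>" using gy(4) p_gt_1 by (auto simp: A.nat_pow_zero)
  ultimately show thesis using that gy by blast
qed

text \<open>Put \<open>b = \<one> \<oplus> x\<close>. As \<open>b [^] p = \<one>\<close>, the span of the first \<open>p\<close> powers of \<open>b\<close> is stable under
  multiplication by \<open>b\<close>, hence by \<open>x\<close>. It contains \<open>\<one>\<close>, so it contains all powers of \<open>x\<close> and is the
  whole algebra.\<close>

lemma one_plus_x_basis: "basis {..<p} (\<lambda>i. (\<one> \<oplus> x) [^] i)"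
proof (rule spanning_imp_basis[OF basis_x])
  let ?b = "\<one> \<oplus> x"
  \<comment> \<open>with one degree for all basis vectors, this is the span of the powers of \<open>b\<close>\<close>
  let ?W = "basis_component {..<p} (\<lambda>i. ?b [^] i) (\<lambda>_. ()) ()"
  have bA: "?b \<in> carrier A" by simp
  have bp: "?b [^] p = \<one>" using power_p[of "\<one>\<^bsub>K\<^esub>" \<one>] by simp
  have e: "(\<lambda>i. ?b [^] i) \<in> {..<p} \<rightarrow> carrier A" by auto
  have fin: "finite {..<p}" by simp
  note sub = submodule_basis_component[OF fin e, of "\<lambda>_. ()" "()"]
  have powW: "?b [^] i \<in> ?W" for i :: nat
  proof -
    have "?b [^] (i mod p) \<in> ?W"
      using basis_in_component[OF fin e, of "i mod p" "\<lambda>_. ()"] p_gt_1 by simp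
    then show ?thesis using power_mod[OF bA bp] by simp
  qed
  have WA: "?W \<subseteq> carrier A" by (rule submodule_subset[OF sub])
  have bW: "?b \<otimes> w \<in> ?W" if w: "w \<in> ?W" for w
  proof -
    obtain c where c: "c \<in> {..<p} \<rightarrow> carrier K" "w = (\<Oplus>i\<in>{..<p}. c i \<odot> ?b [^] i)"
      using w by (auto simp: basis_component_def)
    have cK: "c i \<in> carrier K" if "i < p" for i using c that by auto
    have "?b \<otimes> w = (\<Oplus>i\<in>{..<p}. ?b \<otimes> (c i \<odot> ?b [^] i))"
      unfolding c(2) using cK by (intro A.finsum_rdistr) auto
    moreover have "?b \<otimes> (c i \<odot> ?b [^] i) \<in> ?W" if "i < p" for i
    proof -
      have "?b \<otimes> (c i \<odot> ?b [^] i) = c i \<odot> ?b [^] Suc i"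
        using cK[OF that] by (simp add: mult_smult A.m_comm)
      then show ?thesis using submoduleE(4)[OF sub cK[OF that] powW] by metis
    qed
    ultimately show ?thesis
      using A.subgroup_finsum_closed[OF submodule_subgroup[OF sub] fin, of "\<lambda>i. ?b \<otimes> (c i \<odot> ?b [^] i)"]
      by (simp add: Pi_iff)
  qed
  have xW: "x \<otimes> w \<in> ?W" if w: "w \<in> ?W" for w
  proof -
    have wA: "w \<in> carrier A" using w WA by blast
    have "x \<otimes> w = ?b \<otimes> w \<oplus> \<ominus> w"
      using wA by (simp add: A.l_distr A.a_ac A.r_neg1 A.r_neg2)
    then show ?thesis using submoduleE(5)[OF sub bW[OF w] submoduleE(3)[OF sub w]] by simp
  qed
  have xi: "x [^] i \<in> ?W" for i :: nat
  proof (induction i)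
    case 0
    show ?case using powW[of 0] by simp
  next
    case (Suc i)
    have "x [^] Suc i = x \<otimes> x [^] i" by (simp add: A.m_comm)
    then show ?case using xW[OF Suc] by metis
  qed
  show "spanning {..<p} (\<lambda>i. ?b [^] i)"
    unfolding spanning_def
  proof
    fix a assume "a \<in> carrier A"
    then obtain c where c: "c \<in> {..<p} \<rightarrow> carrier K" "a = (\<Oplus>i\<in>{..<p}. c i \<odot> x [^] i)"
      using basis_x by (auto simp: basis_def spanning_def)
    have "c i \<odot> x [^] i \<in> ?W" if "i \<in> {..<p}" for i
      using submoduleE(4)[OF sub _ xi] c(1) that by auto
    then have "a \<in> ?W"
      unfolding c(2) by (intro A.subgroup_finsum_closed[OF submodule_subgroup[OF sub] fin]) auto
    then show "\<exists>c\<in>{..<p} \<rightarrow> carrier K. a = (\<Oplus>i\<in>{..<p}. c i \<odot> ?b [^] i)"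
      by (auto simp: basis_component_def)
  qed
qed auto

text \<open>The powers of \<open>\<one> \<oplus> x\<close> realise the group algebra.\<close>

lemma group_algebra_type_exists_iff:
  assumes G: "group G"
  shows "(\<exists>U. group_algebra_type G U) \<longleftrightarrow> G \<cong> cyc"
proof
  assume "\<exists>U. group_algebra_type G U"
  then have "cyc \<cong> G" unfolding group_algebra_type_iff is_iso_def by blast
  then show "G \<cong> cyc" by (rule group.iso_sym[OF group_integer_mod_group])
next
  assume "G \<cong> cyc"
  then have "cyc \<cong> G" by (rule group.iso_sym[OF G])
  then obtain \<theta> where \<theta>: "\<theta> \<in> iso cyc G" unfolding is_iso_def by blast
  then have inj: "inj_on \<theta> (carrier cyc)" by (simp add: iso_def bij_betw_def)
  have "(\<one> \<oplus> x) [^] p = \<one>" using power_p[of "\<one>\<^bsub>K\<^esub>" \<one>] by simp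
  then have e: "multiplicative_basis cyc (\<lambda>i. (\<one> \<oplus> x) [^] nat i)"
    by (intro powers_multiplicative_basis one_plus_x_basis) auto
  let ?U = "\<lambda>s. {k \<odot> (\<one> \<oplus> x) [^] nat (inv_into (carrier cyc) \<theta> s) | k. k \<in> carrier K}"
  have "\<forall>c\<in>carrier cyc. ?U (\<theta> c) = {k \<odot> (\<one> \<oplus> x) [^] nat c | k. k \<in> carrier K}"
    using inj by simp
  with e \<theta> have "group_algebra_type G ?U" unfolding group_algebra_type_iff by blast
  then show "\<exists>U. group_algebra_type G U" by blast
qed

text \<open>Give \<open>x\<close> the degree \<open>g\<close>. Then \<open>x\<close> is a nonzero nilpotent homogeneous element.\<close>

lemma other_type_exists:
  assumes G: "group G" and g: "g \<in> carrier G" "carrier G = generate G {g}"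
  obtains U where "connected_grading K A G U" "\<not> group_algebra_type G U"
proof -
  interpret G: group G by fact
  let ?e = "\<lambda>i. x [^] i" and ?d = "\<lambda>i::nat. g [^]\<^bsub>G\<^esub> i"
  let ?U = "basis_component {..<p} ?e ?d"
  have e: "?e \<in> {..<p} \<rightarrow> carrier A" and fin: "finite {..<p}" by auto
  have grading: "grading K A G ?U"
  proof (rule basis_grading[OF basis_x G])
    show "?d \<in> {..<p} \<rightarrow> carrier G" using g(1) by auto
    fix i j assume "i \<in> {..<p}" "j \<in> {..<p}"
    have prod: "x [^] i \<otimes> x [^] j = x [^] (i + j)" "?d i \<otimes>\<^bsub>G\<^esub> ?d j = ?d (i + j)"
      using g(1) by (simp_all add: A.nat_pow_mult G.nat_pow_mult)
    show "x [^] i \<otimes> x [^] j \<in> ?U (?d i \<otimes>\<^bsub>G\<^esub> ?d j)"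
    proof (cases "i + j < p")
      case True
      then show ?thesis unfolding prod using basis_in_component[OF fin e, of "i + j" ?d] by simp
    next
      case False
      then have "x [^] (i + j) = x [^] p \<otimes> x [^] (i + j - p)" by (simp add: A.nat_pow_mult)
      then have "x [^] (i + j) = \<zero>" by (simp add: x_nilpotent)
      then show ?thesis unfolding prod using submodule_zero[OF submodule_basis_component[OF fin e]] by simp
    qed
  qed
  have x: "x \<in> ?U g" using basis_in_component[OF fin e, of 1 ?d] p_gt_1 g(1) by simp
  have x0: "x \<noteq> \<zero>" using basis_nonzero[OF basis_x, of 1] p_gt_1 by simp
  have "g \<in> grading_support A G ?U" using x x0 g(1) by (auto simp: grading_support_def)
  then have "generate G {g} \<subseteq> generate G (grading_support A G ?U)" by (intro G.mono_generate) auto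
  moreover have "generate G (grading_support A G ?U) \<subseteq> carrier G"
    by (rule G.generate_incl) (auto simp: grading_support_def)
  ultimately have "connected_grading K A G ?U" using grading g(2) by (simp add: connected_grading_def)
  moreover have "\<not> group_algebra_type G ?U"
    using group_algebra_type_reduced[of G ?U g x] g(1) x x_nilpotent x0 by blast
  ultimately show thesis by (rule that)
qed

text \<open>The second grading has a nonzero nilpotent homogeneous element \<open>y\<close>, which stays homogeneous
  in the common quotient. The first grading has no such element, so the subgroup \<open>N\<close> by which it is
  divided is not trivial; as the group has prime order, \<open>N\<close> is the whole group.\<close>

lemma common_quotient_trivial:
  assumes G: "group G" and H: "group H" and L: "group L"
    and U: "group_algebra_type G U" and V: "connected_grading K A H V" "\<not> group_algebra_type H V"
    and W: "common_quotient K A G U H V L W"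
  shows "trivial_group L"
proof -
  interpret G: group G by fact
  interpret H: group H by fact
  have gradU: "grading K A G U" using group_algebra_type_connected[OF U G] by (simp add: connected_grading_def)
  have gradV: "grading K A H V" using V(1) by (simp add: connected_grading_def)
  obtain N \<theta> where N: "N \<lhd> G" and \<theta>: "\<theta> \<in> iso (G Mod N) L"
    and W1: "\<And>\<alpha>. \<alpha> \<in> carrier (G Mod N) \<Longrightarrow> W (\<theta> \<alpha>) = quotient_grading A U \<alpha>"
    using W by (auto simp: common_quotient_def is_quotient_grading_def same_grading_def)
  obtain M \<eta> where M: "M \<lhd> H" and \<eta>: "\<eta> \<in> iso (H Mod M) L"
    and W2: "\<And>\<beta>. \<beta> \<in> carrier (H Mod M) \<Longrightarrow> W (\<eta> \<beta>) = quotient_grading A V \<beta>"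
    using W by (auto simp: common_quotient_def is_quotient_grading_def same_grading_def)
  have subN: "subgroup N G" and subM: "subgroup M H" using N M normal_imp_subgroup by blast+
  obtain h y where hy: "h \<in> carrier H" "y \<in> V h" "y \<noteq> \<zero>" "y [^] p = \<zero>"
    using other_type_generator[OF V] by metis
  let ?\<beta> = "M #>\<^bsub>H\<^esub> h"
  have \<beta>: "?\<beta> \<in> carrier (H Mod M)" using hy(1) by (auto simp: carrier_FactGroup)
  have "?\<beta> \<subseteq> carrier H" using H.r_coset_subset_G[OF subgroup.subset[OF subM] hy(1)] .
  then have "y \<in> W (\<eta> ?\<beta>)"
    using component_subset_quotient[OF gradV _ H.rcos_self[OF hy(1) subM]] W2[OF \<beta>] hy(2)
    by blast
  moreover have "\<eta> ?\<beta> \<in> carrier L" using \<eta> \<beta> by (auto simp: iso_def bij_betw_def)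
  then obtain \<alpha> where \<alpha>: "\<alpha> \<in> carrier (G Mod N)" "\<eta> ?\<beta> = \<theta> \<alpha>"
    using \<theta> by (auto simp: iso_def bij_betw_def)
  ultimately have y\<alpha>: "y \<in> quotient_grading A U \<alpha>" using W1 by simp
  have N_ne: "N \<noteq> {\<one>\<^bsub>G\<^esub>}"
  proof
    assume N1: "N = {\<one>\<^bsub>G\<^esub>}"
    obtain s where s: "s \<in> carrier G" "\<alpha> = N #>\<^bsub>G\<^esub> s" using \<alpha>(1) by (auto simp: carrier_FactGroup)
    then have "\<alpha> = {s}" using N1 by (simp add: r_coset_def)
    moreover have "submodule (U s) K A" using gradU s(1) by (simp add: grading_def)
    ultimately have "y \<in> U s" using quotient_singleton_subset[of U s] y\<alpha> by auto
    then show False using group_algebra_type_reduced[OF U s(1) _ hy(4)] hy(3) by blast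
  qed
  have "cyc \<cong> G" using U unfolding group_algebra_type_iff is_iso_def by blast
  then have "card (carrier G) = p" using iso_same_card[of cyc G] by (simp add: carrier_cyc)
  then have order: "order G = p" and fin: "finite (carrier G)"
    using p_gt_1 by (auto simp: order_def intro: card_ge_0_finite)
  have finN: "finite N" using fin subgroup.subset[OF subN] finite_subset by blast
  have "card N dvd p" using G.lagrange[OF subN] order by (metis dvd_triv_right)
  then have "card N = 1 \<or> card N = p" using prime by (simp add: prime_nat_iff)
  moreover have "card N \<noteq> 1"
  proof
    assume "card N = 1"
    then obtain a where "N = {a}" by (auto simp: card_1_singleton_iff)
    then show False using N_ne subgroup.one_closed[OF subN] by auto
  qed
  ultimately have "N = carrier G"
    using card_subset_eq[OF fin subgroup.subset[OF subN]] order by (simp add: order_def)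
  then have "carrier (G Mod N) = {N}"
    unfolding carrier_FactGroup using G.coset_join2[OF _ subN] by (auto intro!: image_eqI[of _ _ "\<one>\<^bsub>G\<^esub>"])
  then have "carrier L = {\<theta> N}" using \<theta> by (auto simp: iso_def bij_betw_def)
  then show ?thesis using group.trivial_group[OF L] by blast
qed

end

section \<open>Cyclic groups as quotients of the integers\<close>

text \<open>A generator \<open>g\<close> makes the powers of \<open>g\<close> an epimorphism from the integers.\<close>

lemma cyclic_iff_quotient_of_integers:
  assumes "group G"
  shows "(\<exists>g\<in>carrier G. carrier G = generate G {g}) \<longleftrightarrow>
    (\<exists>N. N \<lhd> integer_group \<and> G \<cong> integer_group Mod N)"
proof -
  interpret G: group G by fact
  interpret Z: group integer_group by simp
  have cyclic: "(\<exists>g\<in>carrier G. carrier G = generate G {g}) \<longleftrightarrow> cyclic_group G"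
    unfolding G.cyclic_group by (rule bex_cong[OF refl]) (simp add: G.generate_pow full_SetCompr_eq)
  show ?thesis
    unfolding cyclic
  proof
    assume "cyclic_group G"
    then obtain g where g: "g \<in> carrier G" "carrier G = range (\<lambda>n::int. g [^]\<^bsub>G\<^esub> n)"
      unfolding G.cyclic_group by blast
    interpret h: group_hom integer_group G "\<lambda>n::int. g [^]\<^bsub>G\<^esub> n"
      using G.hom_integer_group_pow[OF g(1)] by unfold_locales simp
    have "integer_group Mod kernel integer_group G (\<lambda>n::int. g [^]\<^bsub>G\<^esub> n) \<cong> G"
      by (rule h.FactGroup_iso) (use g(2) in simp)
    then have "G \<cong> integer_group Mod kernel integer_group G (\<lambda>n::int. g [^]\<^bsub>G\<^esub> n)"
      using group.iso_sym[OF normal.factorgroup_is_group[OF h.normal_kernel]] by blast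
    then show "\<exists>N. N \<lhd> integer_group \<and> G \<cong> integer_group Mod N" using h.normal_kernel by blast
  next
    assume "\<exists>N. N \<lhd> integer_group \<and> G \<cong> integer_group Mod N"
    then obtain N where N: "N \<lhd> integer_group" and iso: "G \<cong> integer_group Mod N" by blast
    have Q: "group (integer_group Mod N)" by (rule normal.factorgroup_is_group[OF N])
    have "(\<lambda>a. N #>\<^bsub>integer_group\<^esub> a) \<in> epi integer_group (integer_group Mod N)"
      using normal.r_coset_hom_Mod[OF N] by (simp add: epi_def carrier_FactGroup)
    from Z.cyclic_group_epimorphic_image[OF this cyclic_integer_group Q]
    have "cyclic_group (integer_group Mod N)" .
    then show "cyclic_group G" using isomorphic_group_cyclicity[OF iso assms Q] by blast
  qed
qed

section \<open>The truncated polynomial algebra\<close>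

lemma cring_extend:
  assumes "cring R"
  shows "cring (ring.extend R m)"
proof -
  interpret cring R by fact
  show ?thesis
  proof (intro cringI abelian_groupI comm_monoidI)
    fix a assume "a \<in> carrier (ring.extend R m)"
    then show "\<exists>b\<in>carrier (ring.extend R m). b \<oplus>\<^bsub>ring.extend R m\<^esub> a = \<zero>\<^bsub>ring.extend R m\<^esub>"
      using l_neg by (auto simp: ring.extend_def)
  qed (auto simp: ring.extend_def a_ac m_ac l_distr r_distr)
qed

lemma quotient_algebra_is_algebra:
  assumes "algebra K A" "ideal I A"
  shows "algebra K (quotient_algebra A I)"
proof -
  interpret algebra K A by fact
  interpret I: ideal I A by fact
  let ?Q = "quotient_algebra A I" and ?\<pi> = "\<lambda>a. I +>\<^bsub>A\<^esub> a"
  have ops: "carrier ?Q = carrier (A Quot I)" "monoid.mult ?Q = monoid.mult (A Quot I)"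
    "ring.add ?Q = ring.add (A Quot I)"
    by (simp_all add: quotient_algebra_def ring.extend_def)
  have Q: "S \<in> carrier ?Q \<longleftrightarrow> (\<exists>a\<in>carrier A. S = ?\<pi> a)" for S
    unfolding ops FactRing_def A_RCOSETS_def' by auto
  have \<pi>: "?\<pi> a \<in> carrier ?Q" if "a \<in> carrier A" for a using that Q by blast
  have mult: "?\<pi> a \<otimes>\<^bsub>?Q\<^esub> ?\<pi> b = ?\<pi> (a \<otimes>\<^bsub>A\<^esub> b)" and add: "?\<pi> a \<oplus>\<^bsub>?Q\<^esub> ?\<pi> b = ?\<pi> (a \<oplus>\<^bsub>A\<^esub> b)"
    if "a \<in> carrier A" "b \<in> carrier A" for a b
    using ring_hom_mult[OF I.rcos_ring_hom that] ring_hom_add[OF I.rcos_ring_hom that] by (simp_all add: ops)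
  note smult = quotient_algebra_smult[OF assms]
  show ?thesis
  proof (rule algebraI)
    show "cring K" by (rule R_cring)
    show "cring ?Q"
      unfolding quotient_algebra_def by (rule cring_extend) (rule I.quotient_is_cring[OF M_cring])
    fix a S assume a: "a \<in> carrier K" and S: "S \<in> carrier ?Q"
    obtain s where s: "s \<in> carrier A" "S = ?\<pi> s" using S Q by blast
    show "a \<odot>\<^bsub>?Q\<^esub> S \<in> carrier ?Q" using a s smult \<pi> by simp
    fix b assume b: "b \<in> carrier K"
    show "(a \<oplus>\<^bsub>K\<^esub> b) \<odot>\<^bsub>?Q\<^esub> S = a \<odot>\<^bsub>?Q\<^esub> S \<oplus>\<^bsub>?Q\<^esub> b \<odot>\<^bsub>?Q\<^esub> S"
      using a b s by (simp add: smult add smult_l_distr)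
    show "(a \<otimes>\<^bsub>K\<^esub> b) \<odot>\<^bsub>?Q\<^esub> S = a \<odot>\<^bsub>?Q\<^esub> (b \<odot>\<^bsub>?Q\<^esub> S)"
      using a b s by (simp add: smult smult_assoc1)
  next
    fix S assume "S \<in> carrier ?Q"
    then obtain s where "s \<in> carrier A" "S = ?\<pi> s" using Q by blast
    then show "\<one>\<^bsub>K\<^esub> \<odot>\<^bsub>?Q\<^esub> S = S" using smult by simp
  next
    fix a S T assume a: "a \<in> carrier K" and S: "S \<in> carrier ?Q" and T: "T \<in> carrier ?Q"
    obtain s where s: "s \<in> carrier A" "S = ?\<pi> s" using S Q by blast
    obtain t where t: "t \<in> carrier A" "T = ?\<pi> t" using T Q by blast
    show "a \<odot>\<^bsub>?Q\<^esub> (S \<oplus>\<^bsub>?Q\<^esub> T) = a \<odot>\<^bsub>?Q\<^esub> S \<oplus>\<^bsub>?Q\<^esub> a \<odot>\<^bsub>?Q\<^esub> T"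
      using a s t by (simp add: smult add smult_r_distr)
    show "(a \<odot>\<^bsub>?Q\<^esub> S) \<otimes>\<^bsub>?Q\<^esub> T = a \<odot>\<^bsub>?Q\<^esub> (S \<otimes>\<^bsub>?Q\<^esub> T)"
      using a s t smult_assoc2[OF a s(1) t(1)] by (simp add: smult mult)
  qed
qed

text \<open>The polynomial \<open>g\<close> is \<open>f\<close> with its coefficients shifted down by one.\<close>

lemma (in UP_ring) split_constant_term:
  assumes f: "f \<in> carrier P"
  shows "\<exists>g\<in>carrier P. f = up_ring.coeff P f 0 \<odot>\<^bsub>P\<^esub> \<one>\<^bsub>P\<^esub> \<oplus>\<^bsub>P\<^esub> up_ring.monom P \<one> 1 \<otimes>\<^bsub>P\<^esub> g"
proof (rule bexI)
  let ?g = "\<lambda>n. f (Suc n)"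
  have fup: "f \<in> up R" using f by (simp add: P_def UP_def)
  then obtain n where "bound \<zero> n f" by auto
  then have "bound \<zero> n ?g" by (auto simp: bound_def)
  then have gup: "?g \<in> up R" using fup by (auto simp: up_def)
  have carP: "carrier P = up R" by (simp add: P_def UP_def)
  show g: "?g \<in> carrier P" unfolding carP by (rule gup)
  have coeff_g: "up_ring.coeff P ?g m = up_ring.coeff P f (Suc m)" for m
    unfolding P_def UP_def using fup gup by simp
  let ?h = "up_ring.coeff P f 0 \<odot>\<^bsub>P\<^esub> \<one>\<^bsub>P\<^esub> \<oplus>\<^bsub>P\<^esub> up_ring.monom P \<one> 1 \<otimes>\<^bsub>P\<^esub> ?g"
  show "f = ?h"
  proof (rule up_eqI)
    fix m
    show "up_ring.coeff P f m = up_ring.coeff P ?h m"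
    proof (cases m)
      case 0
      then show ?thesis using f g by simp
    next
      case (Suc k)
      have "up_ring.coeff P (up_ring.monom P \<one> 1 \<otimes>\<^bsub>P\<^esub> ?g) (k + 1) = up_ring.coeff P f (Suc k)"
        using coeff_monom_mult[of \<one> ?g 1 k] g f coeff_g by simp
      then show ?thesis using f g Suc by (simp del: coeff_mult)
    qed
  qed (use f g in auto)
qed

text \<open>The coefficients below \<open>n\<close> of a multiple of the \<open>n\<close>-th power of the variable vanish.\<close>

lemma (in UP_cring) monom_not_in_power_ideal:
  assumes "\<one> \<noteq> \<zero>" "j < n"
  shows "up_ring.monom P \<one> j \<notin> PIdl\<^bsub>P\<^esub> (up_ring.monom P \<one> n)"
proof
  assume "up_ring.monom P \<one> j \<in> PIdl\<^bsub>P\<^esub> (up_ring.monom P \<one> n)"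
  then obtain q where q: "q \<in> carrier P" "up_ring.monom P \<one> j = q \<otimes>\<^bsub>P\<^esub> up_ring.monom P \<one> n"
    by (auto simp: cgenideal_def)
  have "\<one> = up_ring.coeff P (up_ring.monom P \<one> j) j" by simp
  also have "\<dots> = up_ring.coeff P (up_ring.monom P \<one> n \<otimes>\<^bsub>P\<^esub> q) j" unfolding q(2) using q(1) by (simp only: UP_m_comm monom_closed R.one_closed)
  also have "\<dots> = (\<Oplus>i\<in>{..j}. up_ring.coeff P (up_ring.monom P \<one> n) i \<otimes> up_ring.coeff P q (j - i))"
    using q(1) by (intro coeff_mult) auto
  also have "\<dots> = \<zero>" using assms(2) q(1) by (intro R.add.finprod_one_eqI) auto
  finally show False using assms(1) by simp
qed

lemma truncated_polynomial_algebra_line: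
  assumes "Factorial_Ring.prime p" "field K" "characteristic K = p"
  shows "truncated_line K (truncated_polynomial_algebra K p)
    (PIdl\<^bsub>UP K\<^esub> (up_ring.monom (UP K) \<one>\<^bsub>K\<^esub> p) +>\<^bsub>UP K\<^esub> up_ring.monom (UP K) \<one>\<^bsub>K\<^esub> 1) p"
proof -
  interpret K: field K by fact
  interpret UP_cring K "UP K" by unfold_locales
  let ?P = "UP K" and ?X = "\<lambda>n. up_ring.monom (UP K) \<one>\<^bsub>K\<^esub> n"
  let ?I = "PIdl\<^bsub>?P\<^esub> (?X p)" and ?A = "truncated_polynomial_algebra K p"
  have I: "ideal ?I ?P" by (rule P.cgenideal_ideal) simp
  interpret I: ideal ?I ?P by (rule I)
  let ?\<pi> = "\<lambda>f. ?I +>\<^bsub>?P\<^esub> f"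
  have A_def: "?A = quotient_algebra ?P ?I" by (simp add: truncated_polynomial_algebra_def)
  have alg: "algebra K ?A" unfolding A_def by (rule quotient_algebra_is_algebra[OF UP_algebra I])
  interpret A: cring ?A using alg by (rule algebra.M_cring)
  have ops: "carrier ?A = carrier (?P Quot ?I)" "monoid.mult ?A = monoid.mult (?P Quot ?I)"
    "ring.add ?A = ring.add (?P Quot ?I)" "\<one>\<^bsub>?A\<^esub> = \<one>\<^bsub>?P Quot ?I\<^esub>" "\<zero>\<^bsub>?A\<^esub> = ?I"
    by (simp_all add: A_def quotient_algebra_def ring.extend_def FactRing_def)
  have car: "S \<in> carrier ?A \<longleftrightarrow> (\<exists>f\<in>carrier ?P. S = ?\<pi> f)" for S
    unfolding ops FactRing_def A_RCOSETS_def' by auto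
  have \<pi>: "?\<pi> f \<in> carrier ?A" if "f \<in> carrier ?P" for f using that car by blast
  have mult: "?\<pi> f \<otimes>\<^bsub>?A\<^esub> ?\<pi> g = ?\<pi> (f \<otimes>\<^bsub>?P\<^esub> g)" and add: "?\<pi> f \<oplus>\<^bsub>?A\<^esub> ?\<pi> g = ?\<pi> (f \<oplus>\<^bsub>?P\<^esub> g)"
    if "f \<in> carrier ?P" "g \<in> carrier ?P" for f g
    using ring_hom_mult[OF I.rcos_ring_hom that] ring_hom_add[OF I.rcos_ring_hom that] by (simp_all add: ops)
  have one: "\<one>\<^bsub>?A\<^esub> = ?\<pi> \<one>\<^bsub>?P\<^esub>" using ring_hom_one[OF I.rcos_ring_hom] by (simp add: ops)
  have smult: "c \<odot>\<^bsub>?A\<^esub> ?\<pi> f = ?\<pi> (c \<odot>\<^bsub>?P\<^esub> f)" if "c \<in> carrier K" "f \<in> carrier ?P" for c f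
    unfolding A_def by (rule quotient_algebra_smult[OF UP_algebra I that])
  have pow: "?\<pi> (?X 1) [^]\<^bsub>?A\<^esub> n = ?\<pi> (?X n)" for n :: nat
  proof (induction n)
    case 0
    show ?case using one monom_one by simp
  next
    case (Suc n)
    have "?\<pi> (?X 1) [^]\<^bsub>?A\<^esub> Suc n = ?\<pi> (?X n) \<otimes>\<^bsub>?A\<^esub> ?\<pi> (?X 1)" using Suc by simp
    also have "\<dots> = ?\<pi> (?X n \<otimes>\<^bsub>?P\<^esub> ?X 1)" by (rule mult) auto
    also have "?X n \<otimes>\<^bsub>?P\<^esub> ?X 1 = ?X (Suc n)" by (rule monom_one_Suc[symmetric])
    finally show ?case .
  qed
  have nonzero: "?\<pi> (?X j) \<noteq> \<zero>\<^bsub>?A\<^esub>" if "j < p" for j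
  proof
    assume "?\<pi> (?X j) = \<zero>\<^bsub>?A\<^esub>"
    then have "?X j \<in> ?I" using I.a_rcos_self[of "?X j"] by (simp add: ops)
    then show False using monom_not_in_power_ideal[OF K.one_not_zero that] by simp
  qed
  have p1: "p > 1" using assms(1) by (rule prime_gt_1_nat)
  show ?thesis
  proof (intro truncated_line.intro field_algebra.intro field_algebra_axioms.intro truncated_line_axioms.intro)
    show "field K" by fact
    show "cring ?A" by (rule A.is_cring)
    show "algebra K ?A" by (rule alg)
    show "\<one>\<^bsub>?A\<^esub> \<noteq> \<zero>\<^bsub>?A\<^esub>" using nonzero[of 0] p1 one monom_one by simp
    show "Factorial_Ring.prime p" by fact
    show "[p] \<cdot>\<^bsub>K\<^esub> \<one>\<^bsub>K\<^esub> = \<zero>\<^bsub>K\<^esub>"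
      using K.add.pow_ord_eq_1[OF K.one_closed] unfolding assms(3)[unfolded characteristic_def] .
    show "?\<pi> (?X 1) \<in> carrier ?A" by (rule \<pi>) simp
    have "?X p \<in> ?I" by (rule P.cgenideal_self) simp
    then have "?\<pi> (?X p) = \<zero>\<^bsub>?A\<^esub>" unfolding ops by (rule I.a_rcos_const)
    then show "?\<pi> (?X 1) [^]\<^bsub>?A\<^esub> p = \<zero>\<^bsub>?A\<^esub>" unfolding pow .
    show "?\<pi> (?X 1) [^]\<^bsub>?A\<^esub> (p - 1) \<noteq> \<zero>\<^bsub>?A\<^esub>" unfolding pow using nonzero p1 by simp
    fix a assume "a \<in> carrier ?A"
    then obtain f where f: "f \<in> carrier ?P" "a = ?\<pi> f" using car by blast
    obtain g where g: "g \<in> carrier ?P"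
      "f = up_ring.coeff ?P f 0 \<odot>\<^bsub>?P\<^esub> \<one>\<^bsub>?P\<^esub> \<oplus>\<^bsub>?P\<^esub> ?X 1 \<otimes>\<^bsub>?P\<^esub> g"
      using split_constant_term[OF f(1)] by blast
    let ?c = "up_ring.coeff ?P f 0"
    have c: "?c \<in> carrier K" using f(1) by simp
    have "a = ?\<pi> (?c \<odot>\<^bsub>?P\<^esub> \<one>\<^bsub>?P\<^esub> \<oplus>\<^bsub>?P\<^esub> ?X 1 \<otimes>\<^bsub>?P\<^esub> g)" using f(2) g(2) by simp
    also have "\<dots> = ?c \<odot>\<^bsub>?A\<^esub> \<one>\<^bsub>?A\<^esub> \<oplus>\<^bsub>?A\<^esub> ?\<pi> (?X 1) \<otimes>\<^bsub>?A\<^esub> ?\<pi> g"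
      using c g(1) by (simp add: one smult mult add)
    also have "?\<pi> (?X 1) \<otimes>\<^bsub>?A\<^esub> ?\<pi> g = ?\<pi> g \<otimes>\<^bsub>?A\<^esub> ?\<pi> (?X 1)"
      using g(1) by (intro A.m_comm \<pi>) auto
    finally show "\<exists>k\<in>carrier K. \<exists>b\<in>carrier ?A. a = k \<odot>\<^bsub>?A\<^esub> \<one>\<^bsub>?A\<^esub> \<oplus>\<^bsub>?A\<^esub> b \<otimes>\<^bsub>?A\<^esub> ?\<pi> (?X 1)"
      using c \<pi>[OF g(1)] by blast
  qed
qed

section \<open>Classification of the connected gradings\<close>

theorem theorem5p4:
  fixes K :: "('k, 'm) ring_scheme" and p :: nat
    and G :: "('g, 'n) monoid_scheme" and H :: "('h, 'o) monoid_scheme"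
    and L :: "('l, 'q) monoid_scheme"
  assumes "Factorial_Ring.prime p" and "field K" and "characteristic K = p"
    and "group G" and "group H" and "group L"
  shows
    "(\<forall>U. connected_grading K (truncated_polynomial_algebra K p) G U
        \<longleftrightarrow> first_type K p G U \<or> second_type K p G U) \<and>
     ((\<exists>U. first_type K p G U) \<longleftrightarrow> G \<cong> integer_mod_group p) \<and>
     ((\<exists>U. second_type K p G U) \<longleftrightarrow>
        (\<exists>N. N \<lhd> integer_group \<and> G \<cong> integer_group Mod N)) \<and>
     (\<forall>U V W. first_type K p G U \<longrightarrow> second_type K p H V \<longrightarrow>
        (common_quotient K (truncated_polynomial_algebra K p) G U H V L W
          \<longleftrightarrow> trivial_grading K (truncated_polynomial_algebra K p) L W))"
proof -
  let ?A = "truncated_polynomial_algebra K p"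
  interpret T: truncated_line K ?A
    "PIdl\<^bsub>UP K\<^esub> (up_ring.monom (UP K) \<one>\<^bsub>K\<^esub> p) +>\<^bsub>UP K\<^esub> up_ring.monom (UP K) \<one>\<^bsub>K\<^esub> 1" p
    by (rule truncated_polynomial_algebra_line[OF assms(1-3)])
  have firstG: "first_type K p G U \<longleftrightarrow> T.group_algebra_type G U"
    and firstH: "first_type K p H V \<longleftrightarrow> T.group_algebra_type H V" for U V
    by (simp_all add: first_type_def T.group_algebra_type_def)
  have "connected_grading K ?A G U \<longleftrightarrow> first_type K p G U \<or> second_type K p G U" for U
    using T.group_algebra_type_connected[OF _ assms(4)] by (auto simp: second_type_def firstG)
  moreover have "(\<exists>U. first_type K p G U) \<longleftrightarrow> G \<cong> integer_mod_group p"
    using T.group_algebra_type_exists_iff[OF assms(4)] by (simp add: firstG)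
  moreover have "(\<exists>U. second_type K p G U) \<longleftrightarrow> (\<exists>g\<in>carrier G. carrier G = generate G {g})"
  proof
    assume "\<exists>U. second_type K p G U"
    then obtain U where "connected_grading K ?A G U" "\<not> T.group_algebra_type G U"
      by (auto simp: second_type_def firstG)
    then show "\<exists>g\<in>carrier G. carrier G = generate G {g}"
      by (rule T.other_type_generator) blast
  next
    assume "\<exists>g\<in>carrier G. carrier G = generate G {g}"
    then obtain g where "g \<in> carrier G" "carrier G = generate G {g}" ..
    from T.other_type_exists[OF assms(4) this]
    obtain U where "connected_grading K ?A G U" "\<not> T.group_algebra_type G U" .
    then have "second_type K p G U" by (simp add: second_type_def firstG)
    then show "\<exists>U. second_type K p G U" by (rule_tac exI)
  qed
  moreover have "common_quotient K ?A G U H V L W \<longleftrightarrow> trivial_grading K ?A L W"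
    if U: "first_type K p G U" and V: "second_type K p H V" for U V W
  proof
    assume W: "common_quotient K ?A G U H V L W"
    have "trivial_group L"
      by (rule T.common_quotient_trivial[OF assms(4-6) _ _ _ W])
        (use U V in \<open>simp_all add: second_type_def firstG firstH\<close>)
    then show "trivial_grading K ?A L W" using W by (simp add: common_quotient_def trivial_grading_def)
  next
    assume W: "trivial_grading K ?A L W"
    have gradU: "grading K ?A G U"
      using T.group_algebra_type_connected[OF _ assms(4)] U by (simp add: firstG connected_grading_def)
    have gradV: "grading K ?A H V" using V by (simp add: second_type_def connected_grading_def)
    show "common_quotient K ?A G U H V L W"
      using W trivial_grading_is_quotient[OF T.field_algebra_axioms gradU W]
        trivial_grading_is_quotient[OF T.field_algebra_axioms gradV W]
      by (simp add: common_quotient_def trivial_grading_def)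
  qed
  ultimately show ?thesis by (simp add: cyclic_iff_quotient_of_integers[OF assms(4)])
qed

end
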